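(* Let $X,U,Z$, $A_m,G,M$ satisfy the standing assumptions (i)--(iv) of the context, and let $P,L$, $\mathcal{A}_{P,L}$, $Q$, $e_\lambda$, $\Delta(\lambda)$ be as in the context. For $\lambda\in\rho(A)$ with $1\in\rho(D_\lambda M)$ we have $$\lambda\in\rho(\mathcal{A}_{P,L})\iff 1\in\rho(\Delta(\lambda)).$$ In this case, $$R(\lambda,\mathcal{A}_{P,L})=\begin{pmatrix}\mathcal{R}(\lambda)_{11}&\mathcal{R}(\lambda)_{12}\\ \mathcal{R}(\lambda)_{21}&\mathcal{R}(\lambda)_{22}\end{pmatrix}$$ with $$\mathcal{R}(\lambda)_{11}=e_{-\lambda}(I-\Delta(\lambda))^{-1}e_\lambda R(\lambda,A^M),\qquad \mathcal{R}(\lambda)_{12}=e_{-\lambda}\Delta(\lambda)(I-\Delta(\lambda))^{-1}R(\lambda,Q),$$ $$\mathcal{R}(\lambda)_{21}=(I-\Delta(\lambda))^{-1}e_\lambda R(\lambda,A^M),\qquad \mathcal{R}(\lambda)_{22}=(I-\Delta(\lambda))^{-1}R(\lambda,Q).$$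
   Context: **Setting.** $X,U,Z$ are Banach spaces, $Z\subset X$ with dense and continuous embedding, and $p\ge 1$ is a real number. $A_m\colon Z\subset X\to X$ is a closed linear operator, and $G,M\colon Z\to U$ are linear operators. $\mathcal{L}(E,F)$ denotes the bounded linear operators $E\to F$; $\rho(\cdot)$ is the resolvent set and $R(\lambda,\cdot)=(\lambda-\cdot)^{-1}$. The space $\mathbb{X}:=X\times L^p([-1,0],X)$ has norm $\|x\|+\|f\|_p$. **Delay operators.** $\mu\colon[-1,0]\to\mathcal{L}(X)$ and $\nu\colon[-1,0]\to\mathcal{L}(X,U)$ are functions of bounded variation, continuous at $0$, with $\mu(0)=0$, $\nu(0)=0$, and for $f\in W^{1,p}([-1,0],X)$ $$Pf:=\int_{-1}^0 d\mu(\theta)f(\theta)\in X,\qquad Lf:=\int_{-1}^0 d\nu(\theta)f(\theta)\in U .$$ **Standing assumptions.** (i) The restriction $A$ of $A_m$ to $D(A)=\ker G$ generates a $C_0$-semigroup $(T(t))_{t\ge0}$ on $X$. (ii) $G\colon Z\to U$ is surjective. Consequently for $\lambda\in\rho(A)$ one has $Z=D(A)\oplus\ker(\lambda-A_m)$, and the Dirichlet operator $D_\lambda:=(G|_{\ker(\lambda-A_m)})^{-1}\in\mathcal{L}(U,Z)$ exists. $X_{-1}$ is the completion of $X$ for $\|R(\lambda,A)x\|$; $T_{-1}$ and $A_{-1}\colon X\to X_{-1}$ are the extensions of $T$ and $A$ to $X_{-1}$. Put $B:=(\lambda-A_{-1})D_\lambda\in\mathcal{L}(U,X_{-1})$ (independent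 of $\lambda\in\rho(A)$) and $C:=M|_{D(A)}\in\mathcal{L}(D(A),U)$, where $D(A)$ carries the graph norm. (iii) The triple $(A,B,C)$ is regular on $X,U$, meaning all of the following. - $(C,A)$ is $p$-admissible: for some $\tau>0$ there is $\gamma>0$ with $\|CT(\cdot)x\|_{L^p([0,\tau],U)}\le\gamma\|x\|$ for all $x\in D(A)$. - $(A,B)$ is $p$-admissible: for some $\tau>0$, $\Phi_\tau u:=\int_0^\tau T_{-1}(\tau-s)Bu(s)\,ds\in X$ for all $u\in L^p([0,\infty),U)$. - Well-posedness: for every $\alpha>0$, the input-output operator $(F_\alpha u)(t):=M\Phi_t u$, $t\in[0,\alpha]$, defined for $u\in W^{1,p}([0,\alpha],U)$ with $u(0)=0$ (for such $u$ one has $\Phi_tu\in Z$), satisfies $\|F_\alpha u\|_{L^p([0,\alpha],U)}\le\kappa(\alpha)\|u\|_{L^p([0,\alpha],U)}$; it is then extended to $F_\alpha\in\mathcal{L}(L^p([0,\alpha],U))$. - Regularity with zero feedthrough: $\lim_{t\to0}\frac1t\int_0^t (F_\alpha(\mathbf{1}v))(\sigma)\,d\sigma=0$ for every $v\in U$, where $\mathbf{1}v$ is the constant input $v$. (iv) $I-F_\tau$ is invertible in $L^p([0,\tau],U)$ for some $\tau>0$. **Operators in the claim.** $\mathcal{A}_{P,L}:=\begin{pmatrix} A_m&P\\ 0& \frac{d}{ds}\end{pmatrix}$ on $\mathbb{X}$ with domain $\{(x,\varphi)\in Z\times W^{1,p}([-1,0],X): (G-M)x=L\varphi,\ x=\varphi(0)\}$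 (under (i)--(iv) it generates a $C_0$-semigroup on $\mathbb{X}$). $A^M$ is the restriction of $A_m$ to $D(A^M)=\{x\in Z:Gx=Mx\}$. For $\lambda\in\rho(A)$ it is known that $1\in\rho(D_\lambda M)$ iff $\lambda\in\rho(A^M)$, where $D_\lambda M$ is an operator on $Z$, and then $R(\lambda,A^M)=(I-D_\lambda M)^{-1}R(\lambda,A)$; put $D_\lambda^M:=(I-D_\lambda M)^{-1}D_\lambda$. $Q\varphi=\varphi'$ on $L^p([-1,0],X)$ with $D(Q)=\{\varphi\in W^{1,p}([-1,0],X):\varphi(0)=0\}$. For $x\in X$, $(e_\lambda x)(\theta):=e^{\lambda\theta}x$, $\theta\in[-1,0]$. Finally $$\Delta(\lambda):=e_\lambda\bigl[D^M_\lambda L+R(\lambda,A^M)P\bigr]=e_\lambda(I-D_\lambda M)^{-1}\bigl[D_\lambda L+R(\lambda,A)P\bigr],$$ an operator from $W^{1,p}([-1,0],X)$ into itself; $\rho(\Delta(\lambda))$ is understood in this space. The symbol $e_{-\lambda}$ placed to the left of an operator with values in $\{e_\lambda x:x\in X\}$ denotes the inverse map $e_\lambda x\mapsto x$ (multiplication by $e^{-\lambda\theta}$, with constant functions identified with elements of $X$); thus $e_{-\lambda}\Delta(\lambda)=D^M_\lambda L+R(\lambda,A^M)P$. *)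

theory Defs
  imports "HOL-Analysis.Analysis"
begin

section \<open>Complex Banach spaces\<close>

class complex_vector = real_vector +
  fixes scaleC :: "complex \<Rightarrow> 'a \<Rightarrow> 'a"  (infixr "*\<^sub>C" 75)
  assumes scaleC_add_right: "c *\<^sub>C (x + y) = c *\<^sub>C x + c *\<^sub>C y"
    and scaleC_add_left: "(c + d) *\<^sub>C x = c *\<^sub>C x + d *\<^sub>C x"
    and scaleC_scaleC: "c *\<^sub>C (d *\<^sub>C x) = (c * d) *\<^sub>C x"
    and scaleC_of_real: "complex_of_real r *\<^sub>C x = r *\<^sub>R x"

class complex_normed_vector = complex_vector + real_normed_vector +
  assumes norm_scaleC: "norm (c *\<^sub>C x) = cmod c * norm x"

class complex_banach = complex_normed_vector + banach

definition clinear :: "('a::complex_vector \<Rightarrow> 'b::complex_vector) \<Rightarrow> bool" where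
  "clinear f \<longleftrightarrow> (\<forall>x y. f (x + y) = f x + f y) \<and> (\<forall>c x. f (c *\<^sub>C x) = c *\<^sub>C f x)"

definition bounded_clinear ::
    "('a::complex_normed_vector \<Rightarrow> 'b::complex_normed_vector) \<Rightarrow> bool" where
  "bounded_clinear f \<longleftrightarrow> clinear f \<and> (\<exists>K. \<forall>x. norm (f x) \<le> K * norm x)"

instantiation prod :: (complex_vector, complex_vector) complex_vector
begin

definition scaleC_prod :: "complex \<Rightarrow> 'a \<times> 'b \<Rightarrow> 'a \<times> 'b" where
  "scaleC_prod c x = (c *\<^sub>C fst x, c *\<^sub>C snd x)"

instance
  by standard
    (auto simp: scaleC_prod_def scaleC_add_right scaleC_add_left scaleC_scaleC scaleC_of_real
      scaleR_prod_def)

end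


section \<open>Unbounded operators, resolvent set and resolvent\<close>

text \<open>
  An operator is represented by its graph.  The normed space it acts in is given by a subspace
  \<open>V\<close> of some complex vector space together with a norm \<open>N\<close> on \<open>V\<close>.  This allows the same notion
  of resolvent set to be used for types with a norm (\<open>V = UNIV\<close>, \<open>N = norm\<close>) and for function
  spaces.
\<close>

definition graph_on :: "'a set \<Rightarrow> ('a \<Rightarrow> 'b) \<Rightarrow> ('a \<times> 'b) set" where
  "graph_on V f = {(x, f x) | x. x \<in> V}"

text \<open>\<open>\<lambda> - A\<close> is a bijection from the domain of \<open>A\<close> onto \<open>V\<close> and its inverse is bounded.\<close>

definition resolvent_set ::
    "'a::complex_vector set \<Rightarrow> ('a \<Rightarrow> real) \<Rightarrow> ('a \<times> 'a) set \<Rightarrow> complex set" where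
  "resolvent_set V N A =
    {l. (\<forall>y\<in>V. \<exists>!x. \<exists>w. (x, w) \<in> A \<and> l *\<^sub>C x - w = y) \<and>
        (\<exists>K. \<forall>(x, w)\<in>A. N x \<le> K * N (l *\<^sub>C x - w))}"

definition resolvent :: "('a::complex_vector \<times> 'a) set \<Rightarrow> complex \<Rightarrow> 'a \<Rightarrow> 'a" where
  "resolvent A l y = (THE x. \<exists>w. (x, w) \<in> A \<and> l *\<^sub>C x - w = y)"

definition bounded_clinear_on ::
    "'a::complex_vector set \<Rightarrow> ('a \<Rightarrow> real) \<Rightarrow> ('a \<Rightarrow> 'a) \<Rightarrow> bool" where
  "bounded_clinear_on V N f \<longleftrightarrow>
    (\<forall>x\<in>V. f x \<in> V) \<and>
    (\<forall>x\<in>V. \<forall>y\<in>V. f (x + y) = f x + f y) \<and>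
    (\<forall>c. \<forall>x\<in>V. f (c *\<^sub>C x) = c *\<^sub>C f x) \<and>
    (\<exists>K. \<forall>x\<in>V. N (f x) \<le> K * N x)"

definition C0_semigroup :: "(real \<Rightarrow> 'x::complex_banach \<Rightarrow> 'x) \<Rightarrow> bool" where
  "C0_semigroup T \<longleftrightarrow>
    (\<forall>t\<ge>0. bounded_clinear (T t)) \<and> T 0 = id \<and>
    (\<forall>s\<ge>0. \<forall>t\<ge>0. T (s + t) = T s \<circ> T t) \<and>
    (\<forall>x. continuous_on {0..} (\<lambda>t. T t x))"

definition generator :: "(real \<Rightarrow> 'x::complex_banach \<Rightarrow> 'x) \<Rightarrow> ('x \<times> 'x) set" where
  "generator T = {(x, y). ((\<lambda>t. (1 / t) *\<^sub>R (T t x - x)) \<longlongrightarrow> y) (at_right 0)}"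

text \<open>
  \<open>J\<close> exhibits the Banach space \<open>'e\<close> as a completion of \<open>X\<close> for the norm \<open>\<parallel>R(\<lambda>,A)x\<parallel>\<close>.
  Different \<open>\<lambda>\<close> give equivalent norms, so one \<open>\<lambda>\<close> is fixed.  When \<open>A\<close> is densely defined,
  \<open>'e = 'x\<close> with \<open>J = R(\<lambda>,A)\<close> is one such completion.
\<close>

definition extrapolation_space ::
    "('x::complex_banach \<times> 'x) set \<Rightarrow> ('x \<Rightarrow> 'e::complex_banach) \<Rightarrow> bool" where
  "extrapolation_space A J \<longleftrightarrow>
    clinear J \<and> closure (range J) = UNIV \<and>
    (\<exists>l \<in> resolvent_set UNIV norm A. \<forall>x. norm (J x) = norm (resolvent A l x))"


section \<open>Lebesgue and Sobolev spaces of vector-valued functions\<close>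

text \<open>Functions on the real line modulo equality almost everywhere.\<close>

quotient_type 'x aefun = "real \<Rightarrow> 'x" / "\<lambda>f g. AE t in lebesgue. f t = g t"
  morphisms rep_ae ae
proof (rule equivpI)
  show "reflp (\<lambda>f g::real \<Rightarrow> 'x. AE t in lebesgue. f t = g t)"
    by (auto intro!: reflpI)
  show "symp (\<lambda>f g::real \<Rightarrow> 'x. AE t in lebesgue. f t = g t)"
    by (rule sympI) (auto elim: eventually_mono)
  show "transp (\<lambda>f g::real \<Rightarrow> 'x. AE t in lebesgue. f t = g t)"
    by (rule transpI) (auto elim: eventually_elim2)
qed

instantiation aefun :: (complex_vector) complex_vector
begin

lift_definition zero_aefun :: "'a aefun" is "\<lambda>t. 0" .
lift_definition plus_aefun :: "'a aefun \<Rightarrow> 'a aefun \<Rightarrow> 'a aefun" is "\<lambda>f g t. f t + g t"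
  by (auto elim: eventually_elim2)
lift_definition uminus_aefun :: "'a aefun \<Rightarrow> 'a aefun" is "\<lambda>f t. - f t"
  by (auto elim: eventually_mono)
lift_definition minus_aefun :: "'a aefun \<Rightarrow> 'a aefun \<Rightarrow> 'a aefun" is "\<lambda>f g t. f t - g t"
  by (auto elim: eventually_elim2)
lift_definition scaleR_aefun :: "real \<Rightarrow> 'a aefun \<Rightarrow> 'a aefun" is "\<lambda>r f t. r *\<^sub>R f t"
  by (auto elim: eventually_mono)
lift_definition scaleC_aefun :: "complex \<Rightarrow> 'a aefun \<Rightarrow> 'a aefun" is "\<lambda>c f t. c *\<^sub>C f t"
  by (auto elim: eventually_mono)

instance
  by standard
    (transfer; simp add: algebra_simps scaleC_add_right scaleC_add_left scaleC_scaleC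
      scaleC_of_real)+

end

definition on_set :: "real set \<Rightarrow> (real \<Rightarrow> 'x::zero) \<Rightarrow> real \<Rightarrow> 'x" where
  "on_set S f = (\<lambda>t. if t \<in> S then f t else 0)"

text \<open>
  \<open>L\<^sup>p(S, X)\<close> is realised by extending functions by zero to the real line.  The values lie in an
  arbitrary, possibly non-separable, Banach space, which the Bochner integral of the library does
  not cover.  Strong (Bochner) measurability is \<open>measurable_on\<close>: pointwise limit almost everywhere
  of continuous functions.  Integrals of vector-valued functions are Henstock-Kurzweil integrals,
  which extend the Bochner integral.
\<close>

definition Lp :: "real \<Rightarrow> real set \<Rightarrow> 'x::complex_banach aefun set" where
  "Lp p S = {ae (on_set S f) | f.
      f measurable_on S \<and> set_integrable lebesgue S (\<lambda>t. norm (f t) powr p)}"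

definition Lp_norm :: "real \<Rightarrow> 'x::complex_banach aefun \<Rightarrow> real" where
  "Lp_norm p \<phi> = (LINT t|lebesgue. norm (rep_ae \<phi> t) powr p) powr (1 / p)"

text \<open>\<open>f(t) = f(a) + \<integral>\<^sub>a\<^sup>t g(s) ds\<close> on \<open>[a,b]\<close> with \<open>g \<in> L\<^sup>p\<close>.\<close>

definition has_Lp_deriv ::
    "real \<Rightarrow> real \<Rightarrow> real \<Rightarrow> (real \<Rightarrow> 'x::complex_banach) \<Rightarrow> 'x aefun \<Rightarrow> bool" where
  "has_Lp_deriv p a b f g \<longleftrightarrow>
    g \<in> Lp p {a..b} \<and> (\<forall>t\<in>{a..b}. (rep_ae g has_integral (f t - f a)) {a..t})"

definition W1p :: "real \<Rightarrow> real \<Rightarrow> real \<Rightarrow> 'x::complex_banach aefun set" where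
  "W1p p a b = {ae (on_set {a..b} f) | f. \<exists>g. has_Lp_deriv p a b f g}"

text \<open>The continuous representative on \<open>[a,b]\<close>; point values such as \<open>\<phi>(0)\<close> refer to it.\<close>

definition crep :: "real \<Rightarrow> real \<Rightarrow> 'x::complex_banach aefun \<Rightarrow> real \<Rightarrow> 'x" where
  "crep a b \<phi> = (THE f. \<phi> = ae (on_set {a..b} f) \<and> continuous_on {a..b} f \<and>
      (\<forall>t. t \<notin> {a..b} \<longrightarrow> f t = 0))"

definition weak_deriv :: "real \<Rightarrow> real \<Rightarrow> real \<Rightarrow> 'x::complex_banach aefun \<Rightarrow> 'x aefun" where
  "weak_deriv p a b \<phi> = (THE g. has_Lp_deriv p a b (crep a b \<phi>) g)"

definition W1p_norm :: "real \<Rightarrow> real \<Rightarrow> real \<Rightarrow> 'x::complex_banach aefun \<Rightarrow> real" where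
  "W1p_norm p a b \<phi> = Lp_norm p \<phi> + Lp_norm p (weak_deriv p a b \<phi>)"


section \<open>Delay operators\<close>

definition bounded_variation_on :: "real \<Rightarrow> real \<Rightarrow> (real \<Rightarrow> 'v::real_normed_vector) \<Rightarrow> bool" where
  "bounded_variation_on a b m \<longleftrightarrow>
    (\<exists>K. \<forall>d. d division_of {a..b} \<longrightarrow> (\<Sum>k\<in>d. norm (m (Sup k) - m (Inf k))) \<le> K)"

text \<open>
  Riemann-Stieltjes integral \<open>\<integral> dm(\<theta>) f(\<theta>)\<close>: limit of the sums
  \<open>\<Sum> (m(t\<^sub>i) - m(t\<^sub>i\<^sub>-\<^sub>1)) f(s\<^sub>i)\<close> as the mesh tends to \<open>0\<close>.  Fineness with respect to a gauge of
  constant radius is what makes this a mesh condition.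
\<close>

definition has_stieltjes_integral ::
    "real \<Rightarrow> real \<Rightarrow> (real \<Rightarrow> 'x::real_normed_vector \<Rightarrow>\<^sub>L 'y::real_normed_vector) \<Rightarrow>
      (real \<Rightarrow> 'x) \<Rightarrow> 'y \<Rightarrow> bool" where
  "has_stieltjes_integral a b m f I \<longleftrightarrow>
    (\<forall>\<epsilon>>0. \<exists>\<delta>>0. \<forall>q. q tagged_division_of {a..b} \<and> (\<lambda>s. ball s \<delta>) fine q \<longrightarrow>
      norm ((\<Sum>(s, k)\<in>q. blinfun_apply (m (Sup k) - m (Inf k)) (f s)) - I) < \<epsilon>)"

definition delay_kernel ::
    "(real \<Rightarrow> 'x::complex_banach \<Rightarrow>\<^sub>L 'y::complex_banach) \<Rightarrow> bool" where
  "delay_kernel m \<longleftrightarrow>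
    (\<forall>\<theta>\<in>{-1..0}. clinear (blinfun_apply (m \<theta>))) \<and>
    bounded_variation_on (-1) 0 m \<and>
    continuous (at 0 within {-1..0}) m \<and> m 0 = 0"

definition delay_operator ::
    "(real \<Rightarrow> 'x::complex_banach \<Rightarrow>\<^sub>L 'y::complex_banach) \<Rightarrow> 'x aefun \<Rightarrow> 'y" where
  "delay_operator m \<phi> = (THE I. has_stieltjes_integral (-1) 0 m (crep (-1) 0 \<phi>) I)"


section \<open>Boundary systems\<close>

text \<open>
  The inclusion of \<open>Z\<close> into \<open>X\<close> is an injective map \<open>j\<close>, and \<open>Am\<close>, \<open>G\<close>, \<open>M\<close> are maps on the Banach
  space \<open>Z\<close>.  Thus the operator \<open>A\<^sub>m\<close> in \<open>X\<close> has the graph \<open>{(j z, Am z)}\<close>.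
\<close>

definition op_A ::
    "('z::complex_banach \<Rightarrow> 'x::complex_banach) \<Rightarrow> ('z \<Rightarrow> 'x) \<Rightarrow> ('z \<Rightarrow> 'u::complex_banach) \<Rightarrow>
      ('x \<times> 'x) set" where
  "op_A j Am G = {(j z, Am z) | z. G z = 0}"

definition op_AM ::
    "('z::complex_banach \<Rightarrow> 'x::complex_banach) \<Rightarrow> ('z \<Rightarrow> 'x) \<Rightarrow> ('z \<Rightarrow> 'u::complex_banach) \<Rightarrow>
      ('z \<Rightarrow> 'u) \<Rightarrow> ('x \<times> 'x) set" where
  "op_AM j Am G M = {(j z, Am z) | z. G z = M z}"

definition dirichlet ::
    "('z::complex_banach \<Rightarrow> 'x::complex_banach) \<Rightarrow> ('z \<Rightarrow> 'x) \<Rightarrow> ('z \<Rightarrow> 'u::complex_banach) \<Rightarrow>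
      complex \<Rightarrow> 'u \<Rightarrow> 'z" where
  "dirichlet j Am G l u = (THE z. l *\<^sub>C j z - Am z = 0 \<and> G z = u)"

text \<open>The operator \<open>D\<^sub>\<lambda>M\<close> on \<open>Z\<close> and \<open>D\<^sub>\<lambda>\<^sup>M = (I - D\<^sub>\<lambda>M)\<^sup>-\<^sup>1 D\<^sub>\<lambda>\<close>.\<close>

definition op_DM ::
    "('z::complex_banach \<Rightarrow> 'x::complex_banach) \<Rightarrow> ('z \<Rightarrow> 'x) \<Rightarrow> ('z \<Rightarrow> 'u::complex_banach) \<Rightarrow>
      ('z \<Rightarrow> 'u) \<Rightarrow> complex \<Rightarrow> ('z \<times> 'z) set" where
  "op_DM j Am G M l = graph_on UNIV (\<lambda>z. dirichlet j Am G l (M z))"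

definition dirichlet_M ::
    "('z::complex_banach \<Rightarrow> 'x::complex_banach) \<Rightarrow> ('z \<Rightarrow> 'x) \<Rightarrow> ('z \<Rightarrow> 'u::complex_banach) \<Rightarrow>
      ('z \<Rightarrow> 'u) \<Rightarrow> complex \<Rightarrow> 'u \<Rightarrow> 'z" where
  "dirichlet_M j Am G M l u = resolvent (op_DM j Am G M l) 1 (dirichlet j Am G l u)"

text \<open>
  The last two conditions say \<open>D\<^sub>\<lambda> \<in> L(U, Z)\<close> and \<open>C = M|D(A) \<in> L(D(A), U)\<close>.  Neither follows
  from the linearity of \<open>G\<close> and \<open>M\<close> alone: for surjective \<open>G\<close> and \<open>A\<close> a generator, boundedness of
  \<open>D\<^sub>\<lambda>\<close> is equivalent to boundedness of \<open>G\<close>.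
\<close>

definition boundary_system ::
    "('z::complex_banach \<Rightarrow> 'x::complex_banach) \<Rightarrow> ('z \<Rightarrow> 'x) \<Rightarrow> ('z \<Rightarrow> 'u::complex_banach) \<Rightarrow>
      ('z \<Rightarrow> 'u) \<Rightarrow> (real \<Rightarrow> 'x \<Rightarrow> 'x) \<Rightarrow> bool" where
  "boundary_system j Am G M T \<longleftrightarrow>
    bounded_clinear j \<and> inj j \<and> closure (range j) = UNIV \<and>
    clinear Am \<and> closed {(j z, Am z) | z. True} \<and>
    clinear G \<and> clinear M \<and>
    C0_semigroup T \<and> op_A j Am G = generator T \<and>
    surj G \<and>
    (\<forall>l \<in> resolvent_set UNIV norm (op_A j Am G). bounded_clinear (dirichlet j Am G l)) \<and>
    (\<exists>K. \<forall>z. G z = 0 \<longrightarrow> norm (M z) \<le> K * (norm (j z) + norm (Am z)))"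

text \<open>
  \<open>J\<close> embeds \<open>X\<close> into \<open>X\<^sub>-\<^sub>1 = 'e\<close>; \<open>T1\<close> and \<open>A1\<close> are the continuous extensions of the semigroup and
  of its generator, and \<open>B = (\<lambda> - A1) D\<^sub>\<lambda>\<close> for every \<open>\<lambda>\<close> in the resolvent set.
\<close>

definition control_operator ::
    "('z::complex_banach \<Rightarrow> 'x::complex_banach) \<Rightarrow> ('z \<Rightarrow> 'x) \<Rightarrow> ('z \<Rightarrow> 'u::complex_banach) \<Rightarrow>
      (real \<Rightarrow> 'x \<Rightarrow> 'x) \<Rightarrow> ('x \<Rightarrow> 'e::complex_banach) \<Rightarrow> (real \<Rightarrow> 'e \<Rightarrow> 'e) \<Rightarrow> ('x \<Rightarrow> 'e) \<Rightarrow>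
      ('u \<Rightarrow> 'e) \<Rightarrow> bool" where
  "control_operator j Am G T J T1 A1 B \<longleftrightarrow>
    extrapolation_space (op_A j Am G) J \<and>
    (\<forall>t\<ge>0. bounded_clinear (T1 t) \<and> (\<forall>x. T1 t (J x) = J (T t x))) \<and>
    bounded_clinear A1 \<and> (\<forall>(x, y) \<in> op_A j Am G. A1 x = J y) \<and>
    (\<forall>l \<in> resolvent_set UNIV norm (op_A j Am G). \<forall>u.
      B u = l *\<^sub>C J (j (dirichlet j Am G l u)) - A1 (j (dirichlet j Am G l u)))"

text \<open>\<open>\<Phi>\<^sub>t u\<close> as an element of \<open>X\<^sub>-\<^sub>1\<close>.\<close>

definition input_map ::
    "(real \<Rightarrow> 'e::complex_banach \<Rightarrow> 'e) \<Rightarrow> ('u::complex_banach \<Rightarrow> 'e) \<Rightarrow> real \<Rightarrow> 'u aefun \<Rightarrow> 'e" where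
  "input_map T1 B t u = integral {0..t} (\<lambda>s. T1 (t - s) (B (rep_ae u s)))"

text \<open>\<open>t \<mapsto> M \<Phi>\<^sub>t u\<close> on \<open>[0,\<alpha>]\<close>, where \<open>\<Phi>\<^sub>t u \<in> X\<^sub>-\<^sub>1\<close> is regarded as an element of \<open>Z\<close>.\<close>

definition input_output ::
    "('z::complex_banach \<Rightarrow> 'x::complex_banach) \<Rightarrow> ('z \<Rightarrow> 'u::complex_banach) \<Rightarrow>
      ('x \<Rightarrow> 'e::complex_banach) \<Rightarrow> (real \<Rightarrow> 'e \<Rightarrow> 'e) \<Rightarrow> ('u \<Rightarrow> 'e) \<Rightarrow> real \<Rightarrow> 'u aefun \<Rightarrow> 'u aefun" where
  "input_output j M J T1 B \<alpha> u =
    ae (on_set {0..\<alpha>} (\<lambda>t. M (inv (J \<circ> j) (input_map T1 B t u))))"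

text \<open>
  \<open>F \<alpha>\<close> is the continuous extension to \<open>L\<^sup>p([0,\<alpha>],U)\<close> of the input-output operator; it is unique
  because \<open>{u \<in> W\<^sup>1\<^sup>,\<^sup>p. u(0) = 0}\<close> is dense in \<open>L\<^sup>p\<close>.
\<close>

definition regular_triple ::
    "real \<Rightarrow> ('z::complex_banach \<Rightarrow> 'x::complex_banach) \<Rightarrow> ('z \<Rightarrow> 'x) \<Rightarrow> ('z \<Rightarrow> 'u::complex_banach) \<Rightarrow>
      ('z \<Rightarrow> 'u) \<Rightarrow> (real \<Rightarrow> 'x \<Rightarrow> 'x) \<Rightarrow> ('x \<Rightarrow> 'e::complex_banach) \<Rightarrow> (real \<Rightarrow> 'e \<Rightarrow> 'e) \<Rightarrow>
      ('u \<Rightarrow> 'e) \<Rightarrow> (real \<Rightarrow> 'u aefun \<Rightarrow> 'u aefun) \<Rightarrow> bool" where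
  "regular_triple p j Am G M T J T1 B F \<longleftrightarrow>
    \<comment> \<open>observation operator\<close>
    (\<exists>\<tau>>0. \<exists>\<gamma>>0. \<forall>x \<in> Domain (op_A j Am G).
      ae (on_set {0..\<tau>} (\<lambda>t. M (inv j (T t x)))) \<in> Lp p {0..\<tau>} \<and>
      Lp_norm p (ae (on_set {0..\<tau>} (\<lambda>t. M (inv j (T t x))))) \<le> \<gamma> * norm x) \<and>
    \<comment> \<open>control operator\<close>
    (\<exists>\<tau>>0. \<forall>u \<in> Lp p {0..}. input_map T1 B \<tau> u \<in> range J) \<and>
    \<comment> \<open>well-posedness\<close>
    (\<forall>\<alpha>>0. \<exists>\<kappa>. \<forall>u \<in> W1p p 0 \<alpha>. crep 0 \<alpha> u 0 = 0 \<longrightarrow>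
      input_output j M J T1 B \<alpha> u \<in> Lp p {0..\<alpha>} \<and>
      Lp_norm p (input_output j M J T1 B \<alpha> u) \<le> \<kappa> * Lp_norm p u) \<and>
    (\<forall>\<alpha>>0. bounded_clinear_on (Lp p {0..\<alpha>}) (Lp_norm p) (F \<alpha>) \<and>
      (\<forall>u \<in> W1p p 0 \<alpha>. crep 0 \<alpha> u 0 = 0 \<longrightarrow> F \<alpha> u = input_output j M J T1 B \<alpha> u)) \<and>
    \<comment> \<open>regularity with zero feedthrough\<close>
    (\<forall>\<alpha>>0. \<forall>v. ((\<lambda>t. (1 / t) *\<^sub>R integral {0..t} (rep_ae (F \<alpha> (ae (on_set {0..\<alpha>} (\<lambda>_. v))))))
      \<longlongrightarrow> 0) (at_right 0))"


section \<open>The operators of the delay equation\<close>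

definition state_space :: "real \<Rightarrow> ('x::complex_banach \<times> 'x aefun) set" where
  "state_space p = UNIV \<times> Lp p {-1..0}"

definition state_norm :: "real \<Rightarrow> 'x::complex_banach \<times> 'x aefun \<Rightarrow> real" where
  "state_norm p = (\<lambda>(x, f). norm x + Lp_norm p f)"

definition op_APL ::
    "real \<Rightarrow> ('z::complex_banach \<Rightarrow> 'x::complex_banach) \<Rightarrow> ('z \<Rightarrow> 'x) \<Rightarrow> ('z \<Rightarrow> 'u::complex_banach) \<Rightarrow>
      ('z \<Rightarrow> 'u) \<Rightarrow> ('x aefun \<Rightarrow> 'x) \<Rightarrow> ('x aefun \<Rightarrow> 'u) \<Rightarrow>
      (('x \<times> 'x aefun) \<times> ('x \<times> 'x aefun)) set" where
  "op_APL p j Am G M P L =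
    {((j z, \<phi>), (Am z + P \<phi>, weak_deriv p (-1) 0 \<phi>)) | z \<phi>.
      \<phi> \<in> W1p p (-1) 0 \<and> G z - M z = L \<phi> \<and> j z = crep (-1) 0 \<phi> 0}"

definition op_Q :: "real \<Rightarrow> ('x::complex_banach aefun \<times> 'x aefun) set" where
  "op_Q p = {(\<phi>, weak_deriv p (-1) 0 \<phi>) | \<phi>. \<phi> \<in> W1p p (-1) 0 \<and> crep (-1) 0 \<phi> 0 = 0}"

definition exp_fun :: "complex \<Rightarrow> 'x::complex_banach \<Rightarrow> 'x aefun" where
  "exp_fun l x = ae (on_set {-1..0} (\<lambda>\<theta>. exp (l * complex_of_real \<theta>) *\<^sub>C x))"

definition Delta ::
    "('z::complex_banach \<Rightarrow> 'x::complex_banach) \<Rightarrow> ('z \<Rightarrow> 'x) \<Rightarrow> ('z \<Rightarrow> 'u::complex_banach) \<Rightarrow>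
      ('z \<Rightarrow> 'u) \<Rightarrow> ('x aefun \<Rightarrow> 'x) \<Rightarrow> ('x aefun \<Rightarrow> 'u) \<Rightarrow> complex \<Rightarrow> 'x aefun \<Rightarrow> 'x aefun" where
  "Delta j Am G M P L l \<phi> =
    exp_fun l (j (dirichlet_M j Am G M l (L \<phi>)) + resolvent (op_AM j Am G M) l (P \<phi>))"

end

theory Submission
  imports Defs
begin

text \<open>
  The equation \<open>(\<lambda> - \<A>\<^sub>P\<^sub>,\<^sub>L)(x, \<phi>) = (y, g)\<close> consists of \<open>\<lambda> \<phi> - \<phi>' = g\<close> and of a boundary value problem for
  \<open>x = \<phi>(0)\<close> with data \<open>y + P \<phi>\<close> and \<open>L \<phi>\<close>.  Solving both for \<open>\<phi>\<close> on the left-hand side turns it into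
  \<open>\<phi> - \<Delta>(\<lambda>) \<phi> = e\<^sub>\<lambda> R(\<lambda>,A\<^sup>M) y + R(\<lambda>,Q) g\<close>, which gives one implication and the formula.

  For the converse, a right-hand side \<open>\<psi>\<close> of \<open>\<phi> - \<Delta>(\<lambda>) \<phi> = \<psi>\<close> need not be of this form.  Writing
  \<open>\<phi> = \<psi> + \<eta> + \<chi>\<close>, one obtains the resolvent equation for \<open>\<eta>\<close> as soon as \<open>\<chi>\<close> absorbs the boundary
  inhomogeneity \<open>L \<psi>\<close>.  The choice \<open>\<chi> = e\<^sub>k z\<close> with \<open>z = D\<^sub>\<lambda>\<^sup>M u\<close> requires \<open>u - L e\<^sub>k D\<^sub>\<lambda>\<^sup>M u = L \<psi>\<close>, and this
  is solvable by contraction because \<open>\<parallel>L e\<^sub>k\<parallel> \<rightarrow> 0\<close> as \<open>k \<rightarrow> \<infinity>\<close>, the kernel \<open>\<nu>\<close> being continuous at \<open>0\<close>.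

  Functions with values in a non-separable Banach space are handled by approximating strongly measurable
  functions in \<open>L\<^sup>1\<close> by continuous ones.
\<close>

section \<open>Strongly measurable functions and Henstock-Kurzweil integrals\<close>

text \<open>The obstruction to the converse sits at theta = 0. The value there of e_l R(l,A^M) y +
  R(l,Q) g lies in D(A^M), and every psi in W^{1,p} with such a value has this form (take g = l psi
  - psi'), whereas psi(0) is in general an arbitrary element of X. Since Delta(l) phi is an
  exponential e_l z with z in Z, the unknown is moved to Delta(l) phi - chi, whose value at 0 lies
  in Z however rough psi(0) is. An exponential chi = e_k z fits because it enters the transport
  equation only through (k - l) chi. The smallness has to come from L itself: the norm of e_k in
  W^{1,p} does not tend to 0 as k grows. A second obstacle is that the two resolvent conditions use
  different norms. The resolvent of the delay operator controls phi only in L^p, while inverting I -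
  Delta(l) asks for a bound in W^{1,p}. The missing derivative is recovered from the fact that
  Delta(l) phi is an exponential, whose derivative is l times itself.\<close>

lemma measurable_on_norm:
  fixes f :: "'a::euclidean_space \<Rightarrow> 'b::real_normed_vector"
  assumes "f measurable_on S"
  shows "(\<lambda>x. norm (f x)) measurable_on S"
  using measurable_on_compose_continuous_0[OF assms, of norm] by (simp add: o_def continuous_intros)

lemma borel_measurable_norm_measurable_on:
  fixes f :: "'a::euclidean_space \<Rightarrow> 'b::real_normed_vector"
  assumes "f measurable_on S" "S \<in> sets lebesgue"
  shows "(\<lambda>x. norm (f x)) \<in> borel_measurable (lebesgue_on S)"
  using measurable_on_imp_borel_measurable_lebesgue measurable_on_norm assms by blast

text \<open>The radial retraction onto the closed ball of radius \<open>R\<close>; the form with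
  \<open>max\<close> has no case split, which makes its continuity evident.\<close>

definition clip :: "real \<Rightarrow> 'a::real_normed_vector \<Rightarrow> 'a" where
  "clip R v = (R / max R (norm v)) *\<^sub>R v"

lemma clip_zero [simp]: "clip R 0 = 0"
  by (simp add: clip_def)

lemma continuous_on_clip: "R > 0 \<Longrightarrow> continuous_on UNIV (clip R)"
  unfolding clip_def by (intro continuous_intros) (auto simp: max_def)

lemma norm_clip_le: "R > 0 \<Longrightarrow> norm (clip R v) \<le> R"
  by (auto simp: clip_def max_def divide_simps)

lemma clip_eq: "R > 0 \<Longrightarrow> norm v \<le> R \<Longrightarrow> clip R v = v"
  by (simp add: clip_def max_def)

lemma norm_diff_clip_le:
  assumes "R > 0"
  shows "norm (v - clip R v) \<le> norm v"
proof -
  have "v - clip R v = (1 - R / max R (norm v)) *\<^sub>R v"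
    by (simp add: clip_def algebra_simps)
  moreover have "\<bar>1 - R / max R (norm v)\<bar> \<le> 1"
    using assms by (auto simp: max_def divide_simps)
  ultimately show ?thesis
    by (simp add: mult_left_le_one_le)
qed

text \<open>Two truncations: \<open>clip R\<close> applied to \<open>f\<close> changes it little in
  L^1, and applied to the continuous approximants of \<open>f\<close> it supplies the uniform bound
  \<open>2 * R\<close> needed for dominated convergence. Only real-valued norms are integrated,
  because integrability of \<open>f\<close> itself is deduced later from this lemma.\<close>

lemma measurable_on_approx_L1:
  fixes f :: "real \<Rightarrow> 'x::real_normed_vector"
  assumes f: "f measurable_on {a..b}" and nf: "(\<lambda>t. norm (f t)) integrable_on {a..b}" and e: "e > 0"
  obtains h where "continuous_on UNIV h" "(\<lambda>t. norm (f t - h t)) integrable_on {a..b}"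
    "integral {a..b} (\<lambda>t. norm (f t - h t)) < e"
proof -
  let ?I = "{a..b}"
  obtain N g where N: "negligible N" and g: "\<And>n::nat. continuous_on UNIV (g n)"
    and lim: "\<And>t. t \<notin> N \<Longrightarrow> (\<lambda>n. g n t) \<longlonglongrightarrow> (if t \<in> ?I then f t else 0)"
    using f unfolding measurable_on_def by blast
  have clip_f: "(\<lambda>t. clip R (f t)) measurable_on ?I" if "R > 0" for R
    using measurable_on_compose_continuous_0[OF f continuous_on_clip[OF that]] by (simp add: o_def)
  have "(\<lambda>n. integral ?I (\<lambda>t. norm (f t - clip (Suc n) (f t)))) \<longlonglongrightarrow> integral ?I (\<lambda>t. 0)"
  proof (rule dominated_convergence[OF _ nf])
    show "(\<lambda>t. norm (f t - clip (Suc n) (f t))) integrable_on ?I" for n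
      by (rule measurable_bounded_by_integrable_imp_integrable[OF _ nf])
        (auto intro!: borel_measurable_norm_measurable_on measurable_on_diff f clip_f norm_diff_clip_le
          simp del: of_nat_Suc)
    show "norm (norm (f t - clip (Suc n) (f t))) \<le> norm (f t)" for n t
      by (simp add: norm_diff_clip_le del: of_nat_Suc)
    show "(\<lambda>n. norm (f t - clip (Suc n) (f t))) \<longlonglongrightarrow> 0" for t
    proof (rule tendsto_eventually)
      obtain m :: nat where "norm (f t) \<le> m"
        using real_arch_simple by blast
      then show "\<forall>\<^sub>F n in sequentially. norm (f t - clip (Suc n) (f t)) = 0"
        by (intro eventually_sequentiallyI[of m]) (simp add: clip_eq)
    qed
  qed
  then have "(\<lambda>n. integral ?I (\<lambda>t. norm (f t - clip (Suc n) (f t)))) \<longlonglongrightarrow> 0"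
    by simp
  then have "\<forall>\<^sub>F n in sequentially. integral ?I (\<lambda>t. norm (f t - clip (Suc n) (f t))) < e / 2"
    using e by (intro order_tendstoD(2)) auto
  then obtain m where m: "integral ?I (\<lambda>t. norm (f t - clip (Suc m) (f t))) < e / 2"
    using eventually_happens' sequentially_bot by blast
  define R where "R = real (Suc m)"
  have R: "R > 0" and fR: "integral ?I (\<lambda>t. norm (f t - clip R (f t))) < e / 2"
    using m by (auto simp: R_def)
  have fR_int: "(\<lambda>t. norm (f t - clip R (f t))) integrable_on ?I"
    by (rule measurable_bounded_by_integrable_imp_integrable[OF _ nf])
      (auto intro!: borel_measurable_norm_measurable_on measurable_on_diff f clip_f norm_diff_clip_le R)
  have clip_g: "continuous_on UNIV (\<lambda>t. clip R (g n t))" for n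
    using continuous_on_compose2[OF continuous_on_clip[OF R] g] by auto
  have clip_g_meas: "(\<lambda>t. clip R (g n t)) measurable_on ?I" for n
    by (rule measurable_on_restrict[OF continuous_imp_measurable_on[OF clip_g], THEN measurable_on_UNIV[THEN iffD1]]) auto
  have gR_int: "(\<lambda>t. norm (clip R (f t) - clip R (g n t))) integrable_on ?I" for n
  proof (rule measurable_bounded_by_integrable_imp_integrable[where g = "\<lambda>_. 2 * R"])
    show "norm (norm (clip R (f t) - clip R (g n t))) \<le> 2 * R" for t
      using norm_triangle_ineq4[of "clip R (f t)" "clip R (g n t)"] norm_clip_le[OF R, of "f t"]
        norm_clip_le[OF R, of "g n t"] by simp
  qed (auto intro!: borel_measurable_norm_measurable_on measurable_on_diff clip_f R clip_g_meas)
  \<comment> \<open>The approximants may fail to converge on the negligible set \<open>N\<close>.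
    Setting the integrand to 0 there gives convergence at every point and leaves the integrals
    unchanged.\<close>
  define k where "k n t = (if t \<in> N then 0 else norm (clip R (f t) - clip R (g n t)))" for n t
  have "(\<lambda>n. integral ?I (k n)) \<longlonglongrightarrow> integral ?I (\<lambda>t. 0)"
  proof (rule dominated_convergence[where h = "\<lambda>_. 2 * R"])
    show "k n integrable_on ?I" for n
      by (rule integrable_spike[OF gR_int N]) (auto simp: k_def)
    show "norm (k n t) \<le> 2 * R" for n t
      using norm_triangle_ineq4[of "clip R (f t)" "clip R (g n t)"] norm_clip_le[OF R, of "f t"]
        norm_clip_le[OF R, of "g n t"] R by (simp add: k_def)
    show "(\<lambda>n. k n t) \<longlonglongrightarrow> 0" if t: "t \<in> ?I" for t
    proof (cases "t \<in> N")
      case False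
      then have "(\<lambda>n. clip R (g n t)) \<longlonglongrightarrow> clip R (f t)"
        using lim[OF False] t continuous_on_tendsto_compose[OF continuous_on_clip[OF R]] by fastforce
      then have "(\<lambda>n. norm (clip R (f t) - clip R (g n t))) \<longlonglongrightarrow> norm (clip R (f t) - clip R (f t))"
        by (intro tendsto_intros)
      then show ?thesis
        using False by (simp add: k_def)
    qed (simp add: k_def)
  qed auto
  then have "\<forall>\<^sub>F n in sequentially. integral ?I (k n) < e / 2"
    using e by (intro order_tendstoD(2)) auto
  then obtain n where n: "integral ?I (k n) < e / 2"
    using eventually_happens' sequentially_bot by blast
  have "integral ?I (k n) = integral ?I (\<lambda>t. norm (clip R (f t) - clip R (g n t)))"
    by (rule integral_spike[OF N]) (auto simp: k_def)
  note n = n[unfolded this]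
  have int: "(\<lambda>t. norm (f t - clip R (g n t))) integrable_on ?I"
  proof (rule measurable_bounded_by_integrable_imp_integrable[OF _ integrable_add[OF fR_int gR_int[of n]]])
    show "norm (norm (f t - clip R (g n t))) \<le> norm (f t - clip R (f t)) + norm (clip R (f t) - clip R (g n t))" for t
      using norm_triangle_ineq[of "f t - clip R (f t)" "clip R (f t) - clip R (g n t)"] by simp
  qed (auto intro!: borel_measurable_norm_measurable_on measurable_on_diff f clip_g_meas)
  have "integral ?I (\<lambda>t. norm (f t - clip R (g n t)))
      \<le> integral ?I (\<lambda>t. norm (f t - clip R (f t)) + norm (clip R (f t) - clip R (g n t)))"
    using norm_triangle_ineq[of "f t - clip R (f t)" "clip R (f t) - clip R (g n t)" for t]
    by (intro integral_le int integrable_add fR_int gR_int) simp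
  also have "\<dots> < e"
    using n fR by (simp add: integral_add fR_int gR_int)
  finally show thesis
    using that clip_g int by blast
qed

lemma norm_diff3_less:
  fixes x :: "'a::real_normed_vector"
  assumes "norm (x - y) < e / 3" "norm (y - z) < e / 3" "norm (w - z) < e / 3"
  shows "norm (x - w) < e"
proof -
  have "x - w = (x - y) + (y - z) + (z - w)" by simp
  then have "norm (x - w) \<le> norm (x - y) + norm (y - z) + norm (z - w)"
    by (metis norm_triangle_ineq norm_triangle_mono order_refl)
  then show ?thesis
    using assms by (simp add: norm_minus_commute)
qed

text \<open>Cauchy criterion: the Riemann sums of the continuous approximant \<open>h\<close> are
  Cauchy, and those of \<open>f\<close> differ from them by at most the Riemann sum of the real
  function \<open>norm (f t - h t)\<close>, which is close to a small integral.\<close>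

lemma integrable_on_if_norm_integrable:
  fixes f :: "real \<Rightarrow> 'x::banach"
  assumes f: "f measurable_on {a..b}" and nf: "(\<lambda>t. norm (f t)) integrable_on {a..b}"
  shows "f integrable_on {a..b}"
  unfolding box_real[symmetric] integrable_Cauchy
proof (intro allI impI)
  fix e :: real assume e: "e > 0"
  obtain h where h: "continuous_on UNIV h" and int: "(\<lambda>t. norm (f t - h t)) integrable_on {a..b}"
    and less: "integral {a..b} (\<lambda>t. norm (f t - h t)) < e / 6"
    using measurable_on_approx_L1[OF f nf, of "e / 6"] e by auto
  have "h integrable_on cbox a b"
    using h by (intro integrable_continuous) (auto intro: continuous_on_subset)
  then obtain \<gamma> where \<gamma>: "gauge \<gamma>" and h_Cauchy: "\<And>p q. p tagged_division_of (cbox a b) \<Longrightarrow> \<gamma> fine p \<Longrightarrow>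
      q tagged_division_of (cbox a b) \<Longrightarrow> \<gamma> fine q \<Longrightarrow>
      norm ((\<Sum>(x,K)\<in>p. measure lborel K *\<^sub>R h x) - (\<Sum>(x,K)\<in>q. measure lborel K *\<^sub>R h x)) < e / 3"
    unfolding integrable_Cauchy using e by (metis (no_types, lifting) divide_pos_pos zero_less_numeral)
  have "((\<lambda>t. norm (f t - h t)) has_integral integral {a..b} (\<lambda>t. norm (f t - h t))) (cbox a b)"
    using int by (simp add: has_integral_integral)
  then obtain \<delta> where \<delta>: "gauge \<delta>" and sum_diff: "\<And>p. p tagged_division_of (cbox a b) \<Longrightarrow> \<delta> fine p \<Longrightarrow>
      norm ((\<Sum>(x,K)\<in>p. measure lborel K *\<^sub>R norm (f x - h x)) - integral {a..b} (\<lambda>t. norm (f t - h t))) < e / 6"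
    unfolding has_integral using e by (metis (no_types, lifting) divide_pos_pos zero_less_numeral)
  \<comment> \<open>The Riemann sum of \<open>norm (f x - h x)\<close> lies within e/6 of an
    integral that is itself below e/6.\<close>
  have close: "norm ((\<Sum>(x,K)\<in>p. measure lborel K *\<^sub>R f x) - (\<Sum>(x,K)\<in>p. measure lborel K *\<^sub>R h x)) < e / 3"
    if p: "p tagged_division_of (cbox a b)" "\<delta> fine p" for p
  proof -
    have "norm ((\<Sum>(x,K)\<in>p. measure lborel K *\<^sub>R f x) - (\<Sum>(x,K)\<in>p. measure lborel K *\<^sub>R h x))
        = norm (\<Sum>(x,K)\<in>p. measure lborel K *\<^sub>R (f x - h x))"
      by (simp add: sum_subtractf[symmetric] case_prod_unfold scaleR_diff_right)
    also have "\<dots> \<le> (\<Sum>(x,K)\<in>p. measure lborel K *\<^sub>R norm (f x - h x))"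
      by (rule order_trans[OF norm_sum]) (simp add: case_prod_unfold)
    also have "\<dots> < e / 3"
      using sum_diff[OF p] less by (simp add: abs_if split: if_splits)
    finally show ?thesis .
  qed
  show "\<exists>\<gamma>. gauge \<gamma> \<and>
          (\<forall>\<D>1 \<D>2. \<D>1 tagged_division_of (cbox a b) \<and> \<gamma> fine \<D>1 \<and>
            \<D>2 tagged_division_of (cbox a b) \<and> \<gamma> fine \<D>2 \<longrightarrow>
            norm ((\<Sum>(x,K)\<in>\<D>1. measure lborel K *\<^sub>R f x) - (\<Sum>(x,K)\<in>\<D>2. measure lborel K *\<^sub>R f x)) < e)"
  proof (intro exI[of _ "\<lambda>x. \<gamma> x \<inter> \<delta> x"] conjI allI impI, rule gauge_Int[OF \<gamma> \<delta>])
    fix p q assume pq: "p tagged_division_of (cbox a b) \<and> (\<lambda>x. \<gamma> x \<inter> \<delta> x) fine p \<and>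
            q tagged_division_of (cbox a b) \<and> (\<lambda>x. \<gamma> x \<inter> \<delta> x) fine q"
    then show "norm ((\<Sum>(x,K)\<in>p. measure lborel K *\<^sub>R f x) - (\<Sum>(x,K)\<in>q. measure lborel K *\<^sub>R f x)) < e"
      using norm_diff3_less[OF close[of p] h_Cauchy[of p q] close[of q]] by (simp add: fine_Int)
  qed
qed

text \<open>On a fine partition \<open>h\<close> is almost constant on each piece K, so |K| times
  \<open>norm (h x)\<close> is nearly the norm of the integral of \<open>h\<close> over K. As
  \<open>f\<close> integrates to 0 over K, that integral equals the one of \<open>h - f\<close> up
  to nothing, and summing the triangle inequality over the pieces gives the bound.\<close>

lemma integral_norm_le_integral_norm_diff:
  fixes f h :: "real \<Rightarrow> 'x::banach"
  assumes h: "continuous_on {a..b} h" and int: "(\<lambda>t. norm (f t - h t)) integrable_on {a..b}"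
    and zero: "\<And>t. t \<in> {a..b} \<Longrightarrow> (f has_integral 0) {a..t}"
  shows "integral {a..b} (\<lambda>t. norm (h t)) \<le> integral {a..b} (\<lambda>t. norm (f t - h t))"
proof (cases "a \<le> b")
  case False then show ?thesis by simp
next
  case ab: True
  have zero': "integral {u..v} f = 0" and f_int: "f integrable_on {u..v}" if "a \<le> u" "u \<le> v" "v \<le> b" for u v
  proof -
    have f: "f integrable_on {a..v}"
      using zero[of v] that by auto
    show "f integrable_on {u..v}"
      using integrable_subinterval_real[OF f] that by auto
    show "integral {u..v} f = 0"
      using Henstock_Kurzweil_Integration.integral_combine[of a u v f] f that zero[of u] zero[of v]
      by (auto simp: has_integral_iff)
  qed
  have nh: "(\<lambda>t. norm (h t)) integrable_on {a..b}"
    by (intro integrable_continuous_interval continuous_intros h)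
  show ?thesis
  proof (rule field_le_epsilon)
    fix e :: real assume e: "e > 0"
    \<comment> \<open>The oscillation of \<open>h\<close> contributes at most c (b - a) over the
      whole partition; the summand 1 keeps the denominator positive when
      \<open>a = b\<close>.\<close>
    define c where "c = e / (2 * (b - a + 1))"
    have c: "c > 0" "c * (b - a) \<le> e / 2"
      using e ab by (auto simp: c_def field_simps)
    obtain d where d: "d > 0" and unif: "\<And>s t. s \<in> {a..b} \<Longrightarrow> t \<in> {a..b} \<Longrightarrow> dist s t < d \<Longrightarrow> dist (h s) (h t) < c"
      using compact_uniformly_continuous[OF h] c unfolding uniformly_continuous_on_def by (metis compact_Icc)
    have "((\<lambda>t. norm (h t)) has_integral integral {a..b} (\<lambda>t. norm (h t))) (cbox a b)"
      using nh by (simp add: has_integral_integral)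
    then obtain \<gamma> where \<gamma>: "gauge \<gamma>" and sum_h: "\<And>p. p tagged_division_of (cbox a b) \<Longrightarrow> \<gamma> fine p \<Longrightarrow>
      norm ((\<Sum>(x,K)\<in>p. measure lborel K *\<^sub>R norm (h x)) - integral {a..b} (\<lambda>t. norm (h t))) < e / 2"
      unfolding has_integral using e by (metis (no_types, lifting) half_gt_zero)
    obtain p where p: "p tagged_division_of {a..b}" and fine: "(\<lambda>x. \<gamma> x \<inter> ball x d) fine p"
      using fine_division_exists_real[OF gauge_Int[OF \<gamma> gauge_ball[OF d]]] by blast
    have piece: "measure lborel K *\<^sub>R norm (h x) \<le> integral K (\<lambda>t. norm (f t - h t)) + measure lborel K * c"
      if xK: "(x, K) \<in> p" for x K
    proof -
      obtain u v where K: "K = {u..v}"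
        using p xK by (metis box_real(2) tagged_division_ofD(4))
      have x: "x \<in> {u..v}" and sub: "{u..v} \<subseteq> {a..b}"
        using p xK K tagged_division_ofD(2,3) by blast+
      then have uv: "a \<le> u" "u \<le> v" "v \<le> b" by auto
      have cont: "continuous_on {u..v} h"
        using h sub continuous_on_subset by blast
      have "norm (integral {u..v} (\<lambda>t. h x - h t)) \<le> integral {u..v} (\<lambda>t. c)"
      proof (rule integral_norm_bound_integral)
        show "norm (h x - h t) \<le> c" if "t \<in> {u..v}" for t
        proof -
          have "dist x t < d"
            using fineD[OF fine xK] that K by auto
          then show ?thesis
            using unif[of x t] x sub that by (auto simp: dist_norm)
        qed
      qed (auto intro!: integrable_continuous_interval continuous_intros cont)
      moreover have "integral {u..v} (\<lambda>t. h x - h t) = measure lborel K *\<^sub>R h x - integral {u..v} h"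
        using cont uv K by (subst integral_diff) (auto intro!: integrable_continuous_interval)
      moreover have "norm (integral {u..v} h) \<le> integral {u..v} (\<lambda>t. norm (f t - h t))"
      proof -
        have "norm (integral {u..v} (\<lambda>t. f t - h t)) \<le> integral {u..v} (\<lambda>t. norm (f t - h t))"
          using f_int[OF uv] integrable_continuous_interval[OF cont] integrable_subinterval_real[OF int sub]
          by (intro integral_norm_bound_integral integrable_diff) auto
        then show ?thesis
          using f_int[OF uv] integrable_continuous_interval[OF cont] zero'[OF uv]
          by (simp add: integral_diff)
      qed
      ultimately have "norm (measure lborel K *\<^sub>R h x) \<le> integral {u..v} (\<lambda>t. norm (f t - h t)) + measure lborel K * c"
        using norm_triangle_ineq2[of "measure lborel K *\<^sub>R h x" "integral {u..v} h"] uv K by simp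
      then show ?thesis
        using K by simp
    qed
    have "integral {a..b} (\<lambda>t. norm (h t)) \<le> (\<Sum>(x,K)\<in>p. measure lborel K *\<^sub>R norm (h x)) + e / 2"
      using sum_h[of p] p fine by (simp add: fine_Int abs_if split: if_splits)
    also have "(\<Sum>(x,K)\<in>p. measure lborel K *\<^sub>R norm (h x)) \<le> (\<Sum>(x,K)\<in>p. integral K (\<lambda>t. norm (f t - h t)) + measure lborel K * c)"
      using piece by (intro sum_mono) auto
    also have "\<dots> = (\<Sum>(x,K)\<in>p. integral K (\<lambda>t. norm (f t - h t))) + (\<Sum>(x,K)\<in>p. measure lborel K) * c"
      by (simp add: case_prod_unfold sum.distrib sum_distrib_right)
    also have "(\<Sum>(x,K)\<in>p. integral K (\<lambda>t. norm (f t - h t))) = integral {a..b} (\<lambda>t. norm (f t - h t))"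
      using integral_combine_tagged_division_topdown[of "\<lambda>t. norm (f t - h t)" a b p] int p by simp
    also have "(\<Sum>(x,K)\<in>p. measure lborel K) = b - a"
      using additive_content_tagged_division[of p a b] p ab by simp
    finally show "integral {a..b} (\<lambda>t. norm (h t)) \<le> integral {a..b} (\<lambda>t. norm (f t - h t)) + e"
      using c(2) by (simp add: mult.commute)
  qed
qed

text \<open>Splitting \<open>norm (f t)\<close> through a continuous approximant bounds its integral
  by any positive number. This replaces Lebesgue differentiation for vector-valued functions and is
  the source of uniqueness of weak derivatives.\<close>

lemma negligible_nonzero_if_integrals_zero:
  fixes f :: "real \<Rightarrow> 'x::banach"
  assumes f: "f measurable_on {a..b}" and nf: "(\<lambda>t. norm (f t)) integrable_on {a..b}"
    and zero: "\<And>t. t \<in> {a..b} \<Longrightarrow> (f has_integral 0) {a..t}"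
  shows "negligible {t \<in> {a..b}. f t \<noteq> 0}"
proof -
  have "integral {a..b} (\<lambda>t. norm (f t)) \<le> 0"
  proof (rule field_le_epsilon)
    fix e :: real assume e: "e > 0"
    obtain h where h: "continuous_on UNIV h" and int: "(\<lambda>t. norm (f t - h t)) integrable_on {a..b}"
      and less: "integral {a..b} (\<lambda>t. norm (f t - h t)) < e / 2"
      using measurable_on_approx_L1[OF f nf, of "e / 2"] e by auto
    have h': "continuous_on {a..b} h"
      using h continuous_on_subset by blast
    have nh: "(\<lambda>t. norm (h t)) integrable_on {a..b}"
      by (intro integrable_continuous_interval continuous_intros h')
    have "integral {a..b} (\<lambda>t. norm (f t)) \<le> integral {a..b} (\<lambda>t. norm (f t - h t) + norm (h t))"
      using norm_triangle_ineq[of "f t - h t" "h t" for t]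
      by (intro integral_le nf integrable_add int nh) simp
    also have "\<dots> = integral {a..b} (\<lambda>t. norm (f t - h t)) + integral {a..b} (\<lambda>t. norm (h t))"
      using int nh by (simp add: integral_add)
    also have "\<dots> \<le> e"
      using integral_norm_le_integral_norm_diff[OF h' int zero] less by simp
    finally show "integral {a..b} (\<lambda>t. norm (f t)) \<le> 0 + e" by simp
  qed
  then have eq0: "((\<lambda>t. norm (f t)) has_integral 0) {a..b}"
    using nf integral_nonneg[OF nf] by (simp add: has_integral_iff)
  have "set_integrable lebesgue {a..b} (\<lambda>t. norm (f t))"
    using nf by (simp add: absolutely_integrable_on_iff_nonneg)
  moreover from this have "set_lebesgue_integral lebesgue {a..b} (\<lambda>t. norm (f t)) = 0"
    using eq0 by (simp add: set_lebesgue_integral_eq_integral(2) has_integral_iff)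
  ultimately have "AE t in lebesgue. indicator {a..b} t *\<^sub>R norm (f t) = 0"
    unfolding set_integrable_def set_lebesgue_integral_def
    by (subst (asm) integral_nonneg_eq_0_iff_AE) auto
  then have "{t. indicator {a..b} t *\<^sub>R norm (f t) \<noteq> 0} \<in> null_sets lebesgue"
    by (simp add: completion.AE_iff_null_sets)
  moreover have "{t. indicator {a..b} t *\<^sub>R norm (f t) \<noteq> 0} = {t \<in> {a..b}. f t \<noteq> 0}"
    by (auto simp: indicator_def)
  ultimately show ?thesis
    by (simp add: negligible_iff_null_sets)
qed

section \<open>Scalar multiplication and functions modulo null sets\<close>

text \<open>Gives complex scalar multiplication the limit, continuity and differentiation rules of
  bounded bilinear maps.\<close>

lemma bounded_bilinear_scaleC:
  "bounded_bilinear (scaleC :: complex \<Rightarrow> 'a::complex_normed_vector \<Rightarrow> 'a)"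
proof
  show "(r *\<^sub>R c) *\<^sub>C x = r *\<^sub>R c *\<^sub>C x" for r c and x :: 'a
    by (simp add: scaleR_conv_of_real flip: scaleC_scaleC scaleC_of_real)
  show "c *\<^sub>C r *\<^sub>R x = r *\<^sub>R c *\<^sub>C x" for r c and x :: 'a
    by (simp add: scaleC_scaleC mult.commute flip: scaleC_of_real)
  show "\<exists>K. \<forall>c x. norm (c *\<^sub>C (x::'a)) \<le> norm c * norm x * K"
    by (rule exI[of _ 1]) (simp add: norm_scaleC)
qed (simp_all add: scaleC_add_left scaleC_add_right)

interpretation scaleC: bounded_bilinear "scaleC :: complex \<Rightarrow> 'a::complex_normed_vector \<Rightarrow> 'a"
  by (rule bounded_bilinear_scaleC)

lemma scaleC_one [simp]: "1 *\<^sub>C (x::'a::complex_vector) = x"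
  using scaleC_of_real[of 1 x] by simp

lemma scaleC_diff_right: "c *\<^sub>C (x - y) = c *\<^sub>C x - c *\<^sub>C (y::'a::complex_vector)"
  using scaleC_add_right[of c "x - y" y] by (simp add: algebra_simps)

lemma scaleC_zero_right [simp]: "c *\<^sub>C (0::'a::complex_vector) = 0"
  using scaleC_diff_right[of c 0 0] by simp

lemma scaleC_minus_one: "(-1) *\<^sub>C x = - (x::'x::complex_vector)"
  using scaleC_of_real[of "-1" x] by simp

lemma clinear_add: "clinear f \<Longrightarrow> f (x + y) = f x + f y"
  by (simp add: clinear_def)

lemma clinear_diff: "clinear f \<Longrightarrow> f (x - y) = f x - f y"
  using clinear_add[of f "x - y" y] by (simp add: algebra_simps)

lemma clinear_zero: "clinear f \<Longrightarrow> f 0 = 0"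
  using clinear_diff[of f 0 0] by simp

lemma bounded_clinearD:
  assumes "bounded_clinear f"
  shows "clinear f" "\<exists>K\<ge>0. \<forall>x. norm (f x) \<le> K * norm x"
proof -
  obtain K where "\<forall>x. norm (f x) \<le> K * norm x"
    using assms by (auto simp: bounded_clinear_def)
  then have "\<forall>x. norm (f x) \<le> max K 0 * norm x"
    by (meson max.cobounded1 mult_right_mono norm_ge_zero order_trans)
  then show "\<exists>K\<ge>0. \<forall>x. norm (f x) \<le> K * norm x"
    by (intro exI[of _ "max K 0"]) simp
qed (use assms in \<open>simp add: bounded_clinear_def\<close>)

lemma AE_lebesgue_iff_negligible: "(AE t in lebesgue. P t) \<longleftrightarrow> negligible {t. \<not> P t}"
  by (simp add: completion.AE_iff_null_sets negligible_iff_null_sets)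

lemma AE_not_in_negligible: "negligible N \<Longrightarrow> AE t in lebesgue. t \<notin> N"
  by (simp add: AE_lebesgue_iff_negligible)

lemma ae_rep_ae: "ae (rep_ae \<phi>) = \<phi>"
  by (rule Quotient3_abs_rep[OF Quotient3_aefun])

lemma rep_ae_ae: "AE t in lebesgue. rep_ae (ae f) t = f t"
  using aefun.abs_eq_iff[of "rep_ae (ae f)" f] by (simp add: ae_rep_ae)

lemma on_set_add: "on_set S (\<lambda>t. f t + g t) = (\<lambda>t. on_set S f t + (on_set S g t :: 'x::real_vector))"
  and on_set_diff: "on_set S (\<lambda>t. f t - g t) = (\<lambda>t. on_set S f t - (on_set S g t :: 'x::real_vector))"
  by (auto simp: on_set_def fun_eq_iff)

lemma on_set_scaleC: "on_set S (\<lambda>t. c *\<^sub>C f t) = (\<lambda>t. c *\<^sub>C (on_set S f t :: 'x::complex_vector))"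
  by (auto simp: on_set_def fun_eq_iff)

lemma ae_on_set_add: "ae (on_set S f) + ae (on_set S g) = ae (on_set S (\<lambda>t. f t + g t))"
  and ae_on_set_diff: "ae (on_set S f) - ae (on_set S g) = ae (on_set S (\<lambda>t. f t - g t))"
  and ae_on_set_scaleC: "c *\<^sub>C ae (on_set S f) = ae (on_set S (\<lambda>t. c *\<^sub>C f t))"
  by (simp_all add: on_set_add on_set_diff on_set_scaleC plus_aefun.abs_eq minus_aefun.abs_eq scaleC_aefun.abs_eq)

lemma ae_on_set_cong: "(\<And>t. t \<in> S \<Longrightarrow> f t = g t) \<Longrightarrow> ae (on_set S f) = ae (on_set S g)"
  by (rule arg_cong[of _ _ ae]) (auto simp: on_set_def)

text \<open>Approximants in \<open>measurable_on\<close> must be continuous on the whole line, hence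
  the detour through \<open>ext_cont\<close>, which continues \<open>f\<close> by its endpoint
  values.\<close>

lemma continuous_on_imp_measurable_on:
  fixes f :: "real \<Rightarrow> 'x::real_normed_vector"
  assumes "continuous_on {a..b} f"
  shows "f measurable_on {a..b}"
proof -
  have "continuous_on UNIV (ext_cont f a b)"
    using assms by (auto intro!: continuous_on_ext_cont)
  then have "(\<lambda>t. if t \<in> {a..b} then ext_cont f a b t else 0) measurable_on UNIV"
    by (intro measurable_on_restrict continuous_imp_measurable_on) auto
  also have "(\<lambda>t. if t \<in> {a..b} then ext_cont f a b t else 0) = (\<lambda>t. if t \<in> {a..b} then f t else 0)"
    using ext_cont_cancel_cbox[of _ a b f] by auto
  finally show ?thesis
    by (simp only: measurable_on_UNIV)
qed

section \<open>Lebesgue spaces\<close>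

text \<open>\<open>Lp\<close> speaks of some representative, while \<open>Lp_norm\<close> and
  \<open>has_Lp_deriv\<close> use the one chosen by \<open>rep_ae\<close>. The two differ on a
  negligible set, so the properties carry over.\<close>

lemma Lp_repD:
  assumes "\<phi> \<in> Lp p S" "S \<in> sets lebesgue"
  shows "rep_ae \<phi> measurable_on S" "integrable lebesgue (\<lambda>t. norm (rep_ae \<phi> t) powr p)"
    "\<phi> = ae (on_set S (rep_ae \<phi>))"
proof -
  obtain f where \<phi>: "\<phi> = ae (on_set S f)" and f: "f measurable_on S"
    and int: "set_integrable lebesgue S (\<lambda>t. norm (f t) powr p)"
    using assms by (auto simp: Lp_def)
  define N where "N = {t. rep_ae \<phi> t \<noteq> on_set S f t}"
  have N: "negligible N"
    using rep_ae_ae[of "on_set S f"] by (simp add: AE_lebesgue_iff_negligible \<phi> N_def)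
  show "rep_ae \<phi> measurable_on S"
    by (rule measurable_on_spike[OF f N]) (auto simp: N_def on_set_def)
  have "(\<lambda>t. norm (rep_ae \<phi> t) powr p) absolutely_integrable_on UNIV"
  proof (rule absolutely_integrable_spike[OF _ N])
    have "indicator S t *\<^sub>R norm (f t) powr p = indicator UNIV t *\<^sub>R norm (on_set S f t) powr p" for t
      by (auto simp: on_set_def)
    then show "(\<lambda>t. norm (on_set S f t) powr p) absolutely_integrable_on UNIV"
      using int unfolding set_integrable_def by simp
  qed (auto simp: N_def)
  then show "integrable lebesgue (\<lambda>t. norm (rep_ae \<phi> t) powr p)"
    by (simp add: set_integrable_def)
  have "AE t in lebesgue. rep_ae \<phi> t = on_set S (rep_ae \<phi>) t"
    using AE_not_in_negligible[OF N] by eventually_elim (auto simp: N_def on_set_def)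
  then show "\<phi> = ae (on_set S (rep_ae \<phi>))"
    by (metis ae_rep_ae aefun.abs_eq_iff)
qed

lemma Lp_norm_ae_on_set:
  assumes "f measurable_on S" "S \<in> sets lebesgue" "set_integrable lebesgue S (\<lambda>t. norm (f t) powr p)"
  shows "Lp_norm p (ae (on_set S f)) = (LINT t:S|lebesgue. norm (f t) powr p) powr (1 / p)"
proof -
  have "ae (on_set S f) \<in> Lp p S"
    using assms by (auto simp: Lp_def)
  note rep = Lp_repD(2)[OF this assms(2)]
  have "(LINT t|lebesgue. norm (rep_ae (ae (on_set S f)) t) powr p)
      = (LINT t|lebesgue. indicator S t *\<^sub>R norm (f t) powr p)"
  proof (rule integral_cong_AE)
    show "AE t in lebesgue. norm (rep_ae (ae (on_set S f)) t) powr p = indicator S t *\<^sub>R norm (f t) powr p"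
      using rep_ae_ae[of "on_set S f"] by eventually_elim (simp add: on_set_def)
  qed (use rep assms(3) in \<open>auto simp: set_integrable_def\<close>)
  then show ?thesis
    by (simp add: Lp_norm_def set_lebesgue_integral_def)
qed

lemma Lp_norm_nonneg: "Lp_norm p \<phi> \<ge> 0"
  by (simp add: Lp_norm_def)

lemma integral_powr_eq_Lp_norm:
  assumes "p > 0"
  shows "(LINT t|lebesgue. norm (rep_ae \<phi> t) powr p) = Lp_norm p \<phi> powr p"
  using assms by (simp add: Lp_norm_def powr_powr integral_nonneg_AE)

lemma Lp_norm_le:
  assumes "p > 0" "c \<ge> 0" "(LINT t|lebesgue. norm (rep_ae \<phi> t) powr p) \<le> c powr p"
  shows "Lp_norm p \<phi> \<le> c"
proof -
  have "Lp_norm p \<phi> \<le> (c powr p) powr (1 / p)"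
    unfolding Lp_norm_def using assms by (intro powr_mono2) (auto intro: integral_nonneg_AE)
  then show ?thesis
    using assms by (simp add: powr_powr)
qed

section \<open>Linear structure of L^p and Minkowski's inequality\<close>

lemma rep_ae_add: "AE t in lebesgue. rep_ae (\<phi> + \<psi>) t = rep_ae \<phi> t + rep_ae \<psi> t"
  using rep_ae_ae[of "\<lambda>t. rep_ae \<phi> t + rep_ae \<psi> t"] by (simp add: ae_rep_ae flip: plus_aefun.abs_eq)

lemma rep_ae_scaleC: "AE t in lebesgue. rep_ae (c *\<^sub>C \<phi>) t = c *\<^sub>C rep_ae \<phi> t"
  using rep_ae_ae[of "\<lambda>t. c *\<^sub>C rep_ae \<phi> t"] by (simp add: ae_rep_ae flip: scaleC_aefun.abs_eq)

lemma measurable_on_scaleC: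
  fixes f :: "real \<Rightarrow> 'x::complex_normed_vector"
  assumes "f measurable_on S"
  shows "(\<lambda>t. c *\<^sub>C f t) measurable_on S"
proof -
  have "((*\<^sub>C) c \<circ> f) measurable_on S"
    by (rule measurable_on_compose_continuous_0[OF assms]) (auto intro!: scaleC.continuous_on continuous_intros)
  then show ?thesis by (simp add: o_def)
qed

lemma Lp_scaleC:
  assumes "\<phi> \<in> Lp p S"
  shows "c *\<^sub>C \<phi> \<in> Lp p S"
proof -
  obtain f where \<phi>: "\<phi> = ae (on_set S f)" and f: "f measurable_on S"
    and int: "set_integrable lebesgue S (\<lambda>t. norm (f t) powr p)"
    using assms by (auto simp: Lp_def)
  have "set_integrable lebesgue S (\<lambda>t. cmod c powr p * norm (f t) powr p)"
    using int by simp
  then have "set_integrable lebesgue S (\<lambda>t. norm (c *\<^sub>C f t) powr p)"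
    by (simp add: norm_scaleC powr_mult)
  then show ?thesis
    using measurable_on_scaleC[OF f] by (auto simp: Lp_def \<phi> ae_on_set_scaleC)
qed

lemma Lp_norm_scaleC:
  assumes "\<phi> \<in> Lp p S" "S \<in> sets lebesgue" "p > 0"
  shows "Lp_norm p (c *\<^sub>C \<phi>) = cmod c * Lp_norm p \<phi>"
proof -
  have "(LINT t|lebesgue. norm (rep_ae (c *\<^sub>C \<phi>) t) powr p) = (LINT t|lebesgue. cmod c powr p * norm (rep_ae \<phi> t) powr p)"
  proof (rule integral_cong_AE)
    show "AE t in lebesgue. norm (rep_ae (c *\<^sub>C \<phi>) t) powr p = cmod c powr p * norm (rep_ae \<phi> t) powr p"
      using rep_ae_scaleC[of c \<phi>] by eventually_elim (simp add: norm_scaleC powr_mult)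
  qed (use Lp_repD(2)[OF Lp_scaleC[OF assms(1)] assms(2)] Lp_repD(2)[OF assms(1,2)] in \<open>auto dest: borel_measurable_integrable\<close>)
  also have "\<dots> = cmod c powr p * (LINT t|lebesgue. norm (rep_ae \<phi> t) powr p)"
    by simp
  finally show ?thesis
    using assms(3) by (simp add: Lp_norm_def powr_mult powr_powr integral_nonneg_AE)
qed

text \<open>Convexity of the p-th power at the points a/A and b/B with weights A/(A+B) and B/(A+B).
  The choice A = B = 1 yields closure of L^p under sums; A and B near the two norms yield
  Minkowski's inequality.\<close>

lemma powr_add_le_convex_combination:
  fixes a b A B :: real
  assumes "p \<ge> 1" "A > 0" "B > 0" "a \<ge> 0" "b \<ge> 0"
  shows "(a + b) powr p \<le> (A + B) powr p * (A / (A + B) * (a / A) powr p + B / (A + B) * (b / B) powr p)"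
proof -
  have *: "(s * x + t * y) powr p \<le> s * x powr p + t * y powr p"
    if "s > 0" "t > 0" "s + t = 1" "x \<ge> 0" "y \<ge> 0" for s t x y :: real
  proof -
    \<comment> \<open>If one of the two points is 0, convexity reduces to r^p <= r for 0 < r <
      1.\<close>
    have zero: "(r * z) powr p \<le> r * z powr p" if "0 < r" "r < 1" "z \<ge> 0" for r z :: real
    proof -
      have "r powr p \<le> r powr 1"
        using that assms(1) by (intro powr_mono') auto
      then show ?thesis
        using that by (simp add: powr_mult mult_right_mono)
    qed
    have s: "s = 1 - t"
      using that by simp
    show ?thesis
    proof (cases "x = 0 \<or> y = 0")
      case True
      then show ?thesis using zero[of s x] zero[of t y] that by auto
    next
      case False
      then show ?thesis
        using convex_onD[OF powr_convex[OF assms(1)], of t x y] that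
        by (simp add: s)
    qed
  qed
  have eq: "a + b = (A + B) * (A / (A + B) * (a / A) + B / (A + B) * (b / B))"
    using assms by (simp add: distrib_left)
  have "(A / (A + B) * (a / A) + B / (A + B) * (b / B)) powr p
      \<le> A / (A + B) * (a / A) powr p + B / (A + B) * (b / B) powr p"
    using assms by (intro *) (auto simp: divide_simps)
  then have "(A + B) powr p * (A / (A + B) * (a / A) + B / (A + B) * (b / B)) powr p
      \<le> (A + B) powr p * (A / (A + B) * (a / A) powr p + B / (A + B) * (b / B) powr p)"
    by (intro mult_left_mono) auto
  then show ?thesis
    by (subst eq) (use assms in \<open>simp add: powr_mult\<close>)
qed

lemma Lp_add:
  assumes "p \<ge> 1" "\<phi> \<in> Lp p S" "\<psi> \<in> Lp p S" "S \<in> sets lebesgue"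
  shows "\<phi> + \<psi> \<in> Lp p S"
proof -
  obtain f where \<phi>: "\<phi> = ae (on_set S f)" and f: "f measurable_on S"
    and f_int: "set_integrable lebesgue S (\<lambda>t. norm (f t) powr p)"
    using assms by (auto simp: Lp_def)
  obtain g where \<psi>: "\<psi> = ae (on_set S g)" and g: "g measurable_on S"
    and g_int: "set_integrable lebesgue S (\<lambda>t. norm (g t) powr p)"
    using assms by (auto simp: Lp_def)
  let ?h = "\<lambda>t. 2 powr p * (1 / 2 * norm (f t) powr p + 1 / 2 * norm (g t) powr p)"
  have meas: "(\<lambda>t. f t + g t) measurable_on S"
    by (intro measurable_on_add f g)
  have "set_integrable lebesgue S (\<lambda>t. norm (f t + g t) powr p)"
  proof (rule measurable_bounded_by_integrable_imp_absolutely_integrable[where g = ?h])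
    show "(\<lambda>t. norm (f t + g t) powr p) \<in> borel_measurable (lebesgue_on S)"
      using borel_measurable_norm_measurable_on[OF meas assms(4)] by measurable
    show "?h integrable_on S"
      using f_int g_int by (intro integrable_on_mult_right integrable_add) (auto dest: set_lebesgue_integral_eq_integral(1))
    show "norm (norm (f t + g t) powr p) \<le> ?h t" if "t \<in> S" for t
    proof -
      have "norm (f t + g t) powr p \<le> (norm (f t) + norm (g t)) powr p"
        using assms(1) by (intro powr_mono2 norm_triangle_ineq) auto
      also have "\<dots> \<le> ?h t"
        using powr_add_le_convex_combination[of p 1 1 "norm (f t)" "norm (g t)"] assms(1) by simp
      finally show ?thesis by simp
    qed
  qed (use assms in auto)
  then show ?thesis
    using meas by (auto simp: Lp_def \<phi> \<psi> ae_on_set_add)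
qed

text \<open>With A and B slightly above the norms, both normalised integrals are at most 1 and the
  weights sum to 1, so the integrated convexity inequality is bounded by (A+B)^p. The surplus e/2
  keeps A and B positive when a norm vanishes.\<close>

lemma Lp_norm_triangle:
  assumes "p \<ge> 1" "\<phi> \<in> Lp p S" "\<psi> \<in> Lp p S" "S \<in> sets lebesgue"
  shows "Lp_norm p (\<phi> + \<psi>) \<le> Lp_norm p \<phi> + Lp_norm p \<psi>"
proof (rule field_le_epsilon)
  fix e :: real assume e: "e > 0"
  define A where "A = Lp_norm p \<phi> + e / 2"
  define B where "B = Lp_norm p \<psi> + e / 2"
  have AB: "A > 0" "B > 0"
    using e Lp_norm_nonneg[of p \<phi>] Lp_norm_nonneg[of p \<psi>] by (auto simp: A_def B_def)
  note int = Lp_repD(2)[OF assms(2,4)] Lp_repD(2)[OF assms(3,4)]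
  have le: "(LINT t|lebesgue. (norm (rep_ae \<eta> t) / C) powr p) \<le> 1" if "C > Lp_norm p \<eta>" for \<eta> :: "'a aefun" and C
  proof -
    have C: "C > 0" using that Lp_norm_nonneg[of p \<eta>] by simp
    have "(LINT t|lebesgue. (norm (rep_ae \<eta> t) / C) powr p) = Lp_norm p \<eta> powr p / C powr p"
      using C assms(1) by (simp add: powr_divide integral_powr_eq_Lp_norm)
    also have "\<dots> \<le> 1"
      using C that assms(1) by (simp add: powr_mono2 Lp_norm_nonneg)
    finally show ?thesis .
  qed
  let ?h = "\<lambda>t. (A + B) powr p * (A / (A + B) * (norm (rep_ae \<phi> t) / A) powr p + B / (A + B) * (norm (rep_ae \<psi> t) / B) powr p)"
  have int': "integrable lebesgue (\<lambda>t. (norm (rep_ae \<phi> t) / A) powr p)" "integrable lebesgue (\<lambda>t. (norm (rep_ae \<psi> t) / B) powr p)"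
    using int AB by (simp_all add: powr_divide)
  have "(LINT t|lebesgue. norm (rep_ae (\<phi> + \<psi>) t) powr p) \<le> (LINT t|lebesgue. ?h t)"
  proof (rule integral_mono_AE)
    show "integrable lebesgue (\<lambda>t. norm (rep_ae (\<phi> + \<psi>) t) powr p)"
      using Lp_repD(2)[OF Lp_add[OF assms] assms(4)] .
    show "integrable lebesgue ?h"
      using int' by (intro integrable_mult_right integrable_add) auto
    show "AE t in lebesgue. norm (rep_ae (\<phi> + \<psi>) t) powr p \<le> ?h t"
      using rep_ae_add[of \<phi> \<psi>]
    proof eventually_elim
      case (elim t)
      have "norm (rep_ae (\<phi> + \<psi>) t) powr p \<le> (norm (rep_ae \<phi> t) + norm (rep_ae \<psi> t)) powr p"
        unfolding elim using assms(1) by (intro powr_mono2 norm_triangle_ineq) auto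
      also have "\<dots> \<le> ?h t"
        using AB assms(1) by (intro powr_add_le_convex_combination) auto
      finally show ?case .
    qed
  qed
  also have "(LINT t|lebesgue. ?h t) = (A + B) powr p * (A / (A + B) * (LINT t|lebesgue. (norm (rep_ae \<phi> t) / A) powr p)
      + B / (A + B) * (LINT t|lebesgue. (norm (rep_ae \<psi> t) / B) powr p))"
    using int' by simp
  also have "\<dots> \<le> (A + B) powr p * (A / (A + B) * 1 + B / (A + B) * 1)"
    using AB le[of \<phi> A] le[of \<psi> B] e by (intro mult_left_mono add_mono) (auto simp: A_def B_def)
  also have "A / (A + B) * 1 + B / (A + B) * 1 = 1"
    using AB by (simp add: divide_simps)
  finally have "Lp_norm p (\<phi> + \<psi>) \<le> A + B"
    using AB assms(1) by (intro Lp_norm_le) auto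
  then show "Lp_norm p (\<phi> + \<psi>) \<le> Lp_norm p \<phi> + Lp_norm p \<psi> + e"
    by (simp add: A_def B_def)
qed

lemma Lp_minus: "\<phi> \<in> Lp p S \<Longrightarrow> - \<phi> \<in> Lp p S"
  using Lp_scaleC[of \<phi> p S "-1"] by (simp add: scaleC_minus_one)

lemma Lp_norm_minus:
  "\<phi> \<in> Lp p S \<Longrightarrow> S \<in> sets lebesgue \<Longrightarrow> p > 0 \<Longrightarrow> Lp_norm p (- \<phi>) = Lp_norm p \<phi>"
  using Lp_norm_scaleC[of \<phi> p S "-1"] by (simp add: scaleC_minus_one)

lemma Lp_diff:
  assumes "p \<ge> 1" "\<phi> \<in> Lp p S" "\<psi> \<in> Lp p S" "S \<in> sets lebesgue"
  shows "\<phi> - \<psi> \<in> Lp p S"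
  using Lp_add[OF assms(1,2) Lp_minus[OF assms(3)] assms(4)] by simp

lemma Lp_norm_triangle_diff:
  assumes "p \<ge> 1" "\<phi> \<in> Lp p S" "\<psi> \<in> Lp p S" "S \<in> sets lebesgue"
  shows "Lp_norm p (\<phi> - \<psi>) \<le> Lp_norm p \<phi> + Lp_norm p \<psi>"
  using Lp_norm_triangle[OF assms(1,2) Lp_minus[OF assms(3)] assms(4)] Lp_norm_minus[OF assms(3,4)] assms(1) by simp

text \<open>The crude factor \<open>b - a + 1\<close> stands in for (b-a)^(1/p). Being at least 1,
  it dominates b - a after raising to the power p, and it gives a constant free of p.\<close>

lemma Lp_bounded:
  fixes f :: "real \<Rightarrow> 'x::complex_banach"
  assumes p: "p \<ge> 1" and f: "f measurable_on {a..b}" and le: "\<And>t. t \<in> {a..b} \<Longrightarrow> norm (f t) \<le> c" and ab: "a \<le> b"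
  shows "ae (on_set {a..b} f) \<in> Lp p {a..b}" "Lp_norm p (ae (on_set {a..b} f)) \<le> (b - a + 1) * c"
proof -
  have c: "c \<ge> 0"
    using order_trans[OF norm_ge_zero le[of a]] ab by simp
  have bound: "norm (norm (f t) powr p) \<le> c powr p" if "t \<in> {a..b}" for t
    using le[OF that] p by (simp add: powr_mono2)
  have int: "set_integrable lebesgue {a..b} (\<lambda>t. norm (f t) powr p)"
  proof (rule measurable_bounded_by_integrable_imp_absolutely_integrable[where g = "\<lambda>_. c powr p", OF _ _ _ bound])
    show "(\<lambda>t. norm (f t) powr p) \<in> borel_measurable (lebesgue_on {a..b})"
      using borel_measurable_norm_measurable_on[OF f lmeasurable_interval(1)[THEN fmeasurableD, of a b, unfolded box_real]] by measurable
  qed auto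
  then show "ae (on_set {a..b} f) \<in> Lp p {a..b}"
    using f by (auto simp: Lp_def)
  have "(LINT t:{a..b}|lebesgue. norm (f t) powr p) = integral {a..b} (\<lambda>t. norm (f t) powr p)"
    using int by (rule set_lebesgue_integral_eq_integral)
  also have "\<dots> \<le> integral {a..b} (\<lambda>t. c powr p)"
    using int bound by (intro integral_le) (auto dest: set_lebesgue_integral_eq_integral(1))
  also have "\<dots> = (b - a) * c powr p"
    using ab by simp
  also have "\<dots> \<le> (b - a + 1) powr p * c powr p"
  proof -
    have "b - a \<le> (b - a + 1) powr 1" using ab by simp
    also have "\<dots> \<le> (b - a + 1) powr p" using ab p by (intro powr_mono) auto
    finally show ?thesis by (intro mult_right_mono) auto
  qed
  also have "\<dots> = ((b - a + 1) * c) powr p"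
    using ab c by (simp add: powr_mult)
  finally have le': "(LINT t:{a..b}|lebesgue. norm (f t) powr p) \<le> ((b - a + 1) * c) powr p" .
  have "Lp_norm p (ae (on_set {a..b} f)) = (LINT t:{a..b}|lebesgue. norm (f t) powr p) powr (1 / p)"
    using Lp_norm_ae_on_set[OF f _ int] by simp
  also have "\<dots> \<le> (((b - a + 1) * c) powr p) powr (1 / p)"
    using le' p by (intro powr_mono2) (auto simp: set_lebesgue_integral_def intro!: integral_nonneg_AE)
  also have "\<dots> = (b - a + 1) * c"
    using ab c p by (simp add: powr_powr)
  finally show "Lp_norm p (ae (on_set {a..b} f)) \<le> (b - a + 1) * c" .
qed

text \<open>Replaces Hoelder's inequality by the pointwise bound x <= c (1 + (x/c)^p). Integrating
  it with c just above the L^p norm, so that c is positive even for the zero function, and letting c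
  decrease gives the last claim.\<close>

lemma Lp_imp_integrable:
  fixes \<phi> :: "'x::complex_banach aefun"
  assumes p: "p \<ge> 1" and \<phi>: "\<phi> \<in> Lp p {a..b}" and ab: "a \<le> b"
  shows "(\<lambda>t. norm (rep_ae \<phi> t)) integrable_on {a..b}" "rep_ae \<phi> integrable_on {a..b}"
    "integral {a..b} (\<lambda>t. norm (rep_ae \<phi> t)) \<le> (b - a + 1) * Lp_norm p \<phi>"
proof -
  note rep = Lp_repD[OF \<phi>, simplified]
  have pint: "(\<lambda>t. norm (rep_ae \<phi> t) powr p) absolutely_integrable_on {a..b}"
    unfolding set_integrable_def using rep(2) by (intro integrable_mult_indicator) auto
  have young: "x \<le> c * (1 + (x / c) powr p)" if "c > 0" "x \<ge> 0" for x c :: real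
  proof (cases "x \<le> c")
    case True
    then show ?thesis using that by (simp add: distrib_left add_increasing2)
  next
    case False
    then have "(x / c) powr 1 \<le> (x / c) powr p"
      using that p by (intro powr_mono) auto
    then have "x / c \<le> 1 + (x / c) powr p"
      using that by simp
    then show ?thesis using that by (simp add: field_simps)
  qed
  have bound_int: "(\<lambda>t. c * (1 + (norm (rep_ae \<phi> t) / c) powr p)) integrable_on {a..b}" if "c > 0" for c
    using pint that by (intro integrable_on_mult_right integrable_add)
      (auto simp: powr_divide intro!: integrable_on_divide dest: set_lebesgue_integral_eq_integral(1))
  show int: "(\<lambda>t. norm (rep_ae \<phi> t)) integrable_on {a..b}"
    using borel_measurable_norm_measurable_on[OF rep(1)] young[of 1]
    by (intro measurable_bounded_by_integrable_imp_integrable[OF _ bound_int[of 1]]) auto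
  show "rep_ae \<phi> integrable_on {a..b}"
    using integrable_on_if_norm_integrable[OF rep(1) int] .
  have le: "integral {a..b} (\<lambda>t. norm (rep_ae \<phi> t)) \<le> (b - a + 1) * c" if c: "c > Lp_norm p \<phi>" for c
  proof -
    have c0: "c > 0" using c Lp_norm_nonneg[of p \<phi>] by simp
    have "integral {a..b} (\<lambda>t. norm (rep_ae \<phi> t) powr p) = (LINT t:{a..b}|lebesgue. norm (rep_ae \<phi> t) powr p)"
      using pint by (simp add: set_lebesgue_integral_eq_integral(2))
    also have "\<dots> \<le> (LINT t|lebesgue. norm (rep_ae \<phi> t) powr p)"
      unfolding set_lebesgue_integral_def using rep(2) pint
      by (intro integral_mono) (auto simp: set_integrable_def indicator_def)
    also have "\<dots> \<le> c powr p"
      using p c by (simp add: integral_powr_eq_Lp_norm powr_mono2 Lp_norm_nonneg)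
    finally have *: "integral {a..b} (\<lambda>t. norm (rep_ae \<phi> t) powr p) \<le> c powr p" .
    have "integral {a..b} (\<lambda>t. norm (rep_ae \<phi> t)) \<le> integral {a..b} (\<lambda>t. c * (1 + (norm (rep_ae \<phi> t) / c) powr p))"
      using c0 by (intro integral_le int bound_int young) auto
    also have "\<dots> = c * ((b - a) + integral {a..b} (\<lambda>t. norm (rep_ae \<phi> t) powr p) / c powr p)"
      using pint c0 ab by (simp add: powr_divide integral_add integrable_on_divide set_lebesgue_integral_eq_integral(1))
    also have "\<dots> \<le> c * ((b - a) + 1)"
      using * c0 by (intro mult_left_mono add_mono) auto
    finally show ?thesis by (simp add: mult.commute)
  qed
  show "integral {a..b} (\<lambda>t. norm (rep_ae \<phi> t)) \<le> (b - a + 1) * Lp_norm p \<phi>"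
  proof (rule field_le_epsilon)
    fix e :: real assume "e > 0"
    then show "integral {a..b} (\<lambda>t. norm (rep_ae \<phi> t)) \<le> (b - a + 1) * Lp_norm p \<phi> + e"
      using le[of "Lp_norm p \<phi> + e / (b - a + 1)"] ab by (simp add: distrib_left)
  qed
qed

section \<open>Sobolev spaces on an interval\<close>

lemma AE_on_set_rep_ae:
  "\<phi> = ae (on_set S f) \<Longrightarrow> AE t in lebesgue. t \<in> S \<longrightarrow> rep_ae \<phi> t = f t"
  using rep_ae_ae[of "on_set S f"] by (auto simp: on_set_def elim!: eventually_mono)

lemma has_integral_cong_AE:
  fixes f g :: "real \<Rightarrow> 'x::banach"
  assumes "AE t in lebesgue. t \<in> S \<longrightarrow> f t = g t"
  shows "(f has_integral I) S \<longleftrightarrow> (g has_integral I) S"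
  using assms unfolding AE_lebesgue_iff_negligible by (intro has_integral_spike_eq) auto

lemma has_integral_rep_ae_add:
  fixes \<phi> \<psi> :: "'x::complex_banach aefun"
  assumes "(rep_ae \<phi> has_integral I) S" "(rep_ae \<psi> has_integral I') S"
  shows "(rep_ae (\<phi> + \<psi>) has_integral I + I') S"
proof -
  have "AE t in lebesgue. t \<in> S \<longrightarrow> rep_ae (\<phi> + \<psi>) t = rep_ae \<phi> t + rep_ae \<psi> t"
    using rep_ae_add[of \<phi> \<psi>] by (auto elim: eventually_mono)
  then show ?thesis
    using has_integral_add[OF assms] by (subst has_integral_cong_AE) auto
qed

lemma has_integral_rep_ae_scaleC:
  fixes \<phi> :: "'x::complex_banach aefun"
  assumes "(rep_ae \<phi> has_integral I) S"
  shows "(rep_ae (c *\<^sub>C \<phi>) has_integral c *\<^sub>C I) S"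
proof -
  have "AE t in lebesgue. t \<in> S \<longrightarrow> rep_ae (c *\<^sub>C \<phi>) t = c *\<^sub>C rep_ae \<phi> t"
    using rep_ae_scaleC[of c \<phi>] by (auto elim: eventually_mono)
  then show ?thesis
    using has_integral_linear[OF assms scaleC.bounded_linear_right] by (subst has_integral_cong_AE) (auto simp: o_def)
qed

text \<open>The difference of the two functions has integral 0 over every initial interval, hence
  vanishes almost everywhere. This is what makes \<open>weak_deriv\<close> well defined.\<close>

lemma Lp_eqI:
  fixes \<phi> \<psi> :: "'x::complex_banach aefun"
  assumes p: "p \<ge> 1" and \<phi>: "\<phi> \<in> Lp p {a..b}" and \<psi>: "\<psi> \<in> Lp p {a..b}" and ab: "a \<le> b"
    and int: "\<And>t. t \<in> {a..b} \<Longrightarrow> (rep_ae \<phi> has_integral I t) {a..t} \<and> (rep_ae \<psi> has_integral I t) {a..t}"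
  shows "\<phi> = \<psi>"
proof -
  let ?f = "\<lambda>t. rep_ae \<phi> t - rep_ae \<psi> t"
  have f: "?f measurable_on {a..b}"
    using Lp_repD(1)[OF \<phi>] Lp_repD(1)[OF \<psi>] by (intro measurable_on_diff) auto
  have "(\<lambda>t. norm (?f t)) integrable_on {a..b}"
    by (rule measurable_bounded_by_integrable_imp_integrable[OF _
          integrable_add[OF Lp_imp_integrable(1)[OF p \<phi> ab] Lp_imp_integrable(1)[OF p \<psi> ab]]])
      (auto intro!: borel_measurable_norm_measurable_on f norm_triangle_ineq4)
  moreover have "(?f has_integral 0) {a..t}" if "t \<in> {a..b}" for t
    using has_integral_diff[OF conjunct1[OF int[OF that]] conjunct2[OF int[OF that]]] by simp
  ultimately have "negligible {t \<in> {a..b}. ?f t \<noteq> 0}"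
    by (rule negligible_nonzero_if_integrals_zero[OF f])
  then have "AE t in lebesgue. t \<in> {a..b} \<longrightarrow> rep_ae \<phi> t = rep_ae \<psi> t"
    by (simp add: AE_lebesgue_iff_negligible conj_assoc)
  then have "AE t in lebesgue. on_set {a..b} (rep_ae \<phi>) t = on_set {a..b} (rep_ae \<psi>) t"
    by (auto simp: on_set_def elim: eventually_mono)
  then have "ae (on_set {a..b} (rep_ae \<phi>)) = ae (on_set {a..b} (rep_ae \<psi>))"
    by (simp add: aefun.abs_eq_iff)
  then show ?thesis
    using Lp_repD(3)[OF \<phi>] Lp_repD(3)[OF \<psi>] by simp
qed

lemma has_Lp_deriv_unique:
  assumes "p \<ge> 1" "a \<le> b" "has_Lp_deriv p a b f g" "has_Lp_deriv p a b f g'"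
  shows "g = g'"
  using assms Lp_eqI[OF assms(1), of g a b g' "\<lambda>t. f t - f a"] by (auto simp: has_Lp_deriv_def)

lemma has_Lp_deriv_cong:
  assumes "\<And>t. t \<in> {a..b} \<Longrightarrow> f t = f' t" "a \<le> b"
  shows "has_Lp_deriv p a b f g \<longleftrightarrow> has_Lp_deriv p a b f' g"
  using assms by (auto simp: has_Lp_deriv_def)

lemma has_Lp_deriv_add:
  assumes "p \<ge> 1" "has_Lp_deriv p a b f g" "has_Lp_deriv p a b f' g'"
  shows "has_Lp_deriv p a b (\<lambda>t. f t + f' t) (g + g')"
proof -
  have "(rep_ae (g + g') has_integral f t + f' t - (f a + f' a)) {a..t}" if "t \<in> {a..b}" for t
    using has_integral_rep_ae_add[of g "f t - f a" "{a..t}" g' "f' t - f' a"] assms that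
    by (simp add: has_Lp_deriv_def algebra_simps)
  then show ?thesis
    using assms Lp_add[of p g "{a..b}" g'] by (auto simp: has_Lp_deriv_def)
qed

lemma has_Lp_deriv_scaleC:
  assumes "has_Lp_deriv p a b f g"
  shows "has_Lp_deriv p a b (\<lambda>t. c *\<^sub>C f t) (c *\<^sub>C g)"
proof -
  have "(rep_ae (c *\<^sub>C g) has_integral c *\<^sub>C f t - c *\<^sub>C f a) {a..t}" if "t \<in> {a..b}" for t
    using has_integral_rep_ae_scaleC[of g "f t - f a" "{a..t}" c] assms that
    by (simp add: has_Lp_deriv_def scaleC_diff_right)
  then show ?thesis
    using assms Lp_scaleC by (auto simp: has_Lp_deriv_def)
qed

lemma has_Lp_deriv_diff:
  assumes "has_Lp_deriv p a b f g" "s \<in> {a..b}" "t \<in> {a..b}" "s \<le> t"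
  shows "(rep_ae g has_integral f t - f s) {s..t}"
proof -
  have int: "(rep_ae g has_integral f t - f a) {a..t}" "(rep_ae g has_integral f s - f a) {a..s}"
    using assms by (auto simp: has_Lp_deriv_def)
  have "rep_ae g integrable_on {s..t}"
    using integrable_subinterval_real[OF has_integral_integrable[OF int(1)]] assms by auto
  moreover from this have "integral {s..t} (rep_ae g) = (f t - f a) - (f s - f a)"
    using Henstock_Kurzweil_Integration.integral_combine[of a s t "rep_ae g"] int assms
    by (simp add: has_integral_iff algebra_simps) (metis add.assoc)
  ultimately show ?thesis
    by (simp add: has_integral_iff)
qed

lemma has_Lp_deriv_imp_continuous_on:
  assumes "has_Lp_deriv p a b f g"
  shows "continuous_on {a..b} f"
proof (cases "a \<le> b")
  case True
  then have "(rep_ae g has_integral f b - f a) {a..b}"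
    using assms by (auto simp: has_Lp_deriv_def)
  then have "continuous_on {a..b} (\<lambda>t. f a + integral {a..t} (rep_ae g))"
    by (intro continuous_intros indefinite_integral_continuous_1) auto
  then show ?thesis
    by (rule continuous_on_eq) (use assms in \<open>auto simp: has_Lp_deriv_def has_integral_iff\<close>)
qed auto

text \<open>The part of the open interval where \<open>f\<close> and \<open>g\<close> differ is open
  and negligible, hence empty; the endpoints follow by continuity. This justifies the definite
  description in \<open>crep\<close>.\<close>

lemma ae_on_set_continuous_eq:
  fixes f g :: "real \<Rightarrow> 'x::complex_banach"
  assumes "ae (on_set {a..b} f) = ae (on_set {a..b} g)" and cont: "continuous_on {a..b} f" "continuous_on {a..b} g"
    and ab: "a < b" and t: "t \<in> {a..b}"
  shows "f t = g t"
proof -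
  let ?U = "{t \<in> {a<..<b}. f t - g t \<in> - {0}}"
  have "AE t in lebesgue. on_set {a..b} f t = on_set {a..b} g t"
    using assms(1) by (simp add: aefun.abs_eq_iff)
  then have neg: "negligible {t. on_set {a..b} f t \<noteq> on_set {a..b} g t}"
    by (simp add: AE_lebesgue_iff_negligible)
  have "negligible ?U"
    by (rule negligible_subset[OF neg]) (auto simp: on_set_def)
  moreover have "open ?U"
    using continuous_on_subset[OF cont(1), of "{a<..<b}"] continuous_on_subset[OF cont(2), of "{a<..<b}"]
    by (intro continuous_open_preimage[unfolded vimage_def Int_def mem_Collect_eq] continuous_intros) (auto simp: greaterThanLessThan_subseteq_atLeastAtMost_iff)
  ultimately have "?U = {}"
    using open_not_negligible by blast
  then have zero: "f s - g s = 0" if "s \<in> {a<..<b}" for s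
    using that by blast
  have "f t - g t = 0"
  proof (rule continuous_constant_on_closure[OF _ zero])
    show "continuous_on (closure {a<..<b}) (\<lambda>t. f t - g t)"
      using continuous_on_diff[OF cont] ab by simp
    show "t \<in> closure {a<..<b}"
      using ab t by simp
  qed
  then show ?thesis by simp
qed

lemma crep_ae_on_set:
  assumes "continuous_on {a..b} f" "a < b"
  shows "crep a b (ae (on_set {a..b} f)) = on_set {a..b} f"
  unfolding crep_def
proof (rule the_equality, intro conjI)
  show "ae (on_set {a..b} f) = ae (on_set {a..b} (on_set {a..b} f))"
    by (rule ae_on_set_cong) (simp add: on_set_def)
  show "continuous_on {a..b} (on_set {a..b} f)"
    by (rule continuous_on_eq[OF assms(1)]) (simp add: on_set_def)
  show "\<forall>t. t \<notin> {a..b} \<longrightarrow> on_set {a..b} f t = 0"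
    by (auto simp: on_set_def)
  show "h = on_set {a..b} f"
    if "ae (on_set {a..b} f) = ae (on_set {a..b} h) \<and> continuous_on {a..b} h \<and> (\<forall>t. t \<notin> {a..b} \<longrightarrow> h t = 0)" for h
    using ae_on_set_continuous_eq[of a b f h] that assms by (auto simp: on_set_def fun_eq_iff)
qed

text \<open>Evaluates the descriptions behind \<open>crep\<close> and \<open>weak_deriv\<close> for
  a given representative, so that neither has to be unfolded afterwards.\<close>

lemma W1pI:
  assumes "p \<ge> 1" "a < b" and f: "has_Lp_deriv p a b f g"
  shows "ae (on_set {a..b} f) \<in> W1p p a b" "weak_deriv p a b (ae (on_set {a..b} f)) = g"
    "t \<in> {a..b} \<Longrightarrow> crep a b (ae (on_set {a..b} f)) t = f t"
proof -
  have crep: "crep a b (ae (on_set {a..b} f)) = on_set {a..b} f"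
    using crep_ae_on_set[OF has_Lp_deriv_imp_continuous_on[OF f]] assms by simp
  then have f': "has_Lp_deriv p a b (crep a b (ae (on_set {a..b} f))) h \<longleftrightarrow> has_Lp_deriv p a b f h" for h
    using assms by (intro has_Lp_deriv_cong) (auto simp: on_set_def)
  show "ae (on_set {a..b} f) \<in> W1p p a b"
    using f by (auto simp: W1p_def)
  show "weak_deriv p a b (ae (on_set {a..b} f)) = g"
    unfolding weak_deriv_def f'
    using has_Lp_deriv_unique[OF assms(1) less_imp_le[OF assms(2)] _ f] by (intro the_equality f)
  show "crep a b (ae (on_set {a..b} f)) t = f t" if "t \<in> {a..b}"
    unfolding crep using that by (simp add: on_set_def)
qed

lemma W1pD:
  assumes "p \<ge> 1" "a < b" and \<phi>: "\<phi> \<in> W1p p a b"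
  shows "has_Lp_deriv p a b (crep a b \<phi>) (weak_deriv p a b \<phi>)" "\<phi> = ae (on_set {a..b} (crep a b \<phi>))"
    "continuous_on {a..b} (crep a b \<phi>)"
proof -
  obtain f g where \<phi>: "\<phi> = ae (on_set {a..b} f)" and f: "has_Lp_deriv p a b f g"
    using \<phi> by (auto simp: W1p_def)
  note W1p = W1pI[OF assms(1,2) f, folded \<phi>]
  show deriv: "has_Lp_deriv p a b (crep a b \<phi>) (weak_deriv p a b \<phi>)"
    unfolding W1p(2) using assms(2) f has_Lp_deriv_cong[of a b "crep a b \<phi>" f] W1p(3) by auto
  show "\<phi> = ae (on_set {a..b} (crep a b \<phi>))"
    using W1p(3) by (subst (1) \<phi>) (auto intro!: ae_on_set_cong)
  show "continuous_on {a..b} (crep a b \<phi>)"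
    by (rule has_Lp_deriv_imp_continuous_on[OF deriv])
qed

section \<open>Linear structure of W^{1,p} and its embedding into the continuous functions\<close>

lemma W1p_add:
  assumes "p \<ge> 1" "a < b" "\<phi> \<in> W1p p a b" "\<psi> \<in> W1p p a b"
  shows "\<phi> + \<psi> \<in> W1p p a b" "weak_deriv p a b (\<phi> + \<psi>) = weak_deriv p a b \<phi> + weak_deriv p a b \<psi>"
    "t \<in> {a..b} \<Longrightarrow> crep a b (\<phi> + \<psi>) t = crep a b \<phi> t + crep a b \<psi> t"
proof -
  note deriv = has_Lp_deriv_add[OF assms(1) W1pD(1)[OF assms(1-3)] W1pD(1)[OF assms(1,2,4)]]
  have "\<phi> + \<psi> = ae (on_set {a..b} (\<lambda>t. crep a b \<phi> t + crep a b \<psi> t))"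
    using W1pD(2)[OF assms(1-3)] W1pD(2)[OF assms(1,2,4)] ae_on_set_add by metis
  then show "\<phi> + \<psi> \<in> W1p p a b" "weak_deriv p a b (\<phi> + \<psi>) = weak_deriv p a b \<phi> + weak_deriv p a b \<psi>"
    "t \<in> {a..b} \<Longrightarrow> crep a b (\<phi> + \<psi>) t = crep a b \<phi> t + crep a b \<psi> t"
    using W1pI[OF assms(1,2) deriv] by simp_all
qed

lemma W1p_scaleC:
  assumes "p \<ge> 1" "a < b" "\<phi> \<in> W1p p a b"
  shows "c *\<^sub>C \<phi> \<in> W1p p a b" "weak_deriv p a b (c *\<^sub>C \<phi>) = c *\<^sub>C weak_deriv p a b \<phi>"
    "t \<in> {a..b} \<Longrightarrow> crep a b (c *\<^sub>C \<phi>) t = c *\<^sub>C crep a b \<phi> t"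
proof -
  note deriv = has_Lp_deriv_scaleC[OF W1pD(1)[OF assms]]
  have "c *\<^sub>C \<phi> = ae (on_set {a..b} (\<lambda>t. c *\<^sub>C crep a b \<phi> t))"
    using W1pD(2)[OF assms] ae_on_set_scaleC by metis
  then show "c *\<^sub>C \<phi> \<in> W1p p a b" "weak_deriv p a b (c *\<^sub>C \<phi>) = c *\<^sub>C weak_deriv p a b \<phi>"
    "t \<in> {a..b} \<Longrightarrow> crep a b (c *\<^sub>C \<phi>) t = c *\<^sub>C crep a b \<phi> t"
    using W1pI[OF assms(1,2) deriv] by simp_all
qed

lemma W1p_diff:
  assumes "p \<ge> 1" "a < b" "\<phi> \<in> W1p p a b" "\<psi> \<in> W1p p a b"
  shows "\<phi> - \<psi> \<in> W1p p a b" "weak_deriv p a b (\<phi> - \<psi>) = weak_deriv p a b \<phi> - weak_deriv p a b \<psi>"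
    "t \<in> {a..b} \<Longrightarrow> crep a b (\<phi> - \<psi>) t = crep a b \<phi> t - crep a b \<psi> t"
  using W1p_add[OF assms(1-3) W1p_scaleC(1)[OF assms(1,2,4), where c = "-1"]] W1p_scaleC[OF assms(1,2,4), where c = "-1"]
  by (simp_all add: scaleC_minus_one)

lemma continuous_on_Icc_bounded:
  fixes f :: "real \<Rightarrow> 'x::real_normed_vector"
  assumes "continuous_on {a..b} f"
  shows "\<exists>c. \<forall>t\<in>{a..b}. norm (f t) \<le> c"
  using compact_imp_bounded[OF compact_continuous_image[OF assms compact_Icc]] by (auto simp: bounded_iff)

lemma W1p_imp_Lp:
  assumes "p \<ge> 1" "a < b" "\<phi> \<in> W1p p a b"
  shows "\<phi> \<in> Lp p {a..b}" "weak_deriv p a b \<phi> \<in> Lp p {a..b}"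
proof -
  note cont = W1pD(3)[OF assms]
  obtain c where c: "\<And>t. t \<in> {a..b} \<Longrightarrow> norm (crep a b \<phi> t) \<le> c"
    using continuous_on_Icc_bounded[OF cont] by blast
  show "\<phi> \<in> Lp p {a..b}"
    using Lp_bounded(1)[OF assms(1) continuous_on_imp_measurable_on[OF cont] c] assms(2) W1pD(2)[OF assms] by simp
  show "weak_deriv p a b \<phi> \<in> Lp p {a..b}"
    using W1pD(1)[OF assms] by (simp add: has_Lp_deriv_def)
qed

lemma W1p_norm_nonneg: "W1p_norm p a b \<phi> \<ge> 0"
  by (simp add: W1p_norm_def Lp_norm_nonneg)

lemma W1p_norm_triangle:
  assumes "p \<ge> 1" "a < b" "\<phi> \<in> W1p p a b" "\<psi> \<in> W1p p a b"
  shows "W1p_norm p a b (\<phi> + \<psi>) \<le> W1p_norm p a b \<phi> + W1p_norm p a b \<psi>"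
  using Lp_norm_triangle[OF assms(1) W1p_imp_Lp(1)[OF assms(1-3)] W1p_imp_Lp(1)[OF assms(1,2,4)]]
    Lp_norm_triangle[OF assms(1) W1p_imp_Lp(2)[OF assms(1-3)] W1p_imp_Lp(2)[OF assms(1,2,4)]]
  by (simp add: W1p_norm_def W1p_add(2)[OF assms])

text \<open>Sobolev embedding: the minimum of the norm is at most its mean, which the L^p norm of
  the function bounds, and the deviation from the minimum is at most the L^1 norm of the derivative.
  On [-1,0] the constant is 4.\<close>

lemma W1p_sup_bound:
  fixes \<phi> :: "'x::complex_banach aefun"
  assumes p: "p \<ge> 1" and ab: "a < b" and \<phi>: "\<phi> \<in> W1p p a b" and t: "t \<in> {a..b}"
  shows "norm (crep a b \<phi> t) \<le> (b - a + 1) * (1 + 1 / (b - a)) * W1p_norm p a b \<phi>"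
proof -
  let ?f = "crep a b \<phi>" and ?g = "weak_deriv p a b \<phi>"
  note W = W1pD[OF p ab \<phi>] and Lp = W1p_imp_Lp[OF p ab \<phi>]
  obtain s where s: "s \<in> {a..b}" and min: "\<And>r. r \<in> {a..b} \<Longrightarrow> norm (?f s) \<le> norm (?f r)"
    using continuous_attains_inf[OF _ _ continuous_on_norm[OF W(3)]] ab by auto
  have g: "(\<lambda>r. norm (rep_ae ?g r)) integrable_on {a..b}"
    using Lp_imp_integrable(1)[OF p Lp(2)] ab by simp
  have diff: "norm (?f v - ?f u) \<le> integral {a..b} (\<lambda>r. norm (rep_ae ?g r))"
    if "u \<in> {a..b}" "v \<in> {a..b}" "u \<le> v" for u v
  proof -
    have sub: "{u..v} \<subseteq> {a..b}" using that by auto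
    have int: "(rep_ae ?g has_integral ?f v - ?f u) {u..v}"
      using has_Lp_deriv_diff[OF W(1)] that by auto
    have "norm (integral {u..v} (rep_ae ?g)) \<le> integral {u..v} (\<lambda>r. norm (rep_ae ?g r))"
      using int integrable_subinterval_real[OF g sub] by (intro integral_norm_bound_integral) auto
    also have "\<dots> \<le> integral {a..b} (\<lambda>r. norm (rep_ae ?g r))"
      using integrable_subinterval_real[OF g sub] g sub by (intro integral_subset_le) auto
    finally show ?thesis
      using int by (simp add: has_integral_iff)
  qed
  have "norm (?f t - ?f s) \<le> integral {a..b} (\<lambda>r. norm (rep_ae ?g r))"
    using diff[of s t] diff[of t s] s t by (cases "s \<le> t") (auto simp: norm_minus_commute)
  also have "\<dots> \<le> (b - a + 1) * Lp_norm p ?g"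
    using Lp_imp_integrable(3)[OF p Lp(2)] ab by simp
  finally have 1: "norm (?f t - ?f s) \<le> (b - a + 1) * Lp_norm p ?g" .
  have "(b - a) * norm (?f s) = integral {a..b} (\<lambda>_. norm (?f s))"
    using ab by simp
  also have "\<dots> \<le> integral {a..b} (\<lambda>r. norm (?f r))"
    using W(3) min by (intro integral_le) (auto intro!: integrable_continuous_interval continuous_intros)
  also have "\<dots> = integral {a..b} (\<lambda>r. norm (rep_ae \<phi> r))"
    using AE_on_set_rep_ae[OF W(2)] unfolding AE_lebesgue_iff_negligible
    by (intro integral_spike[of "{r. \<not> (r \<in> {a..b} \<longrightarrow> rep_ae \<phi> r = ?f r)}"]) auto
  also have "\<dots> \<le> (b - a + 1) * Lp_norm p \<phi>"
    using Lp_imp_integrable(3)[OF p Lp(1)] ab by simp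
  finally have 2: "norm (?f s) \<le> (b - a + 1) * Lp_norm p \<phi> / (b - a)"
    using ab by (simp add: field_simps)
  have "norm (?f t) \<le> norm (?f t - ?f s) + norm (?f s)"
    using norm_triangle_ineq[of "?f t - ?f s" "?f s"] by simp
  also have "\<dots> \<le> (b - a + 1) * Lp_norm p ?g + (b - a + 1) * Lp_norm p \<phi> / (b - a)"
    using 1 2 by simp
  also have "\<dots> \<le> (b - a + 1) * (1 + 1 / (b - a)) * W1p_norm p a b \<phi>"
  proof -
    have "(b - a + 1) * (1 + 1 / (b - a)) * W1p_norm p a b \<phi>
      = (b - a + 1) * Lp_norm p ?g + (b - a + 1) * Lp_norm p \<phi> / (b - a)
        + ((b - a + 1) * Lp_norm p \<phi> + (b - a + 1) * Lp_norm p ?g / (b - a))"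
      by (simp add: W1p_norm_def algebra_simps add_divide_distrib)
    moreover have "0 \<le> (b - a + 1) * Lp_norm p \<phi> + (b - a + 1) * Lp_norm p ?g / (b - a)"
      using ab by (intro add_nonneg_nonneg mult_nonneg_nonneg divide_nonneg_nonneg) (auto simp: Lp_norm_nonneg)
    ultimately show ?thesis by linarith
  qed
  finally show ?thesis .
qed

lemma has_Lp_deriv_C1:
  fixes f f' :: "real \<Rightarrow> 'x::complex_banach"
  assumes p: "p \<ge> 1" and ab: "a \<le> b" and f': "continuous_on {a..b} f'"
    and deriv: "\<And>t. t \<in> {a..b} \<Longrightarrow> (f has_vector_derivative f' t) (at t within {a..b})"
  shows "has_Lp_deriv p a b f (ae (on_set {a..b} f'))"
proof -
  obtain c where c: "\<And>t. t \<in> {a..b} \<Longrightarrow> norm (f' t) \<le> c"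
    using continuous_on_Icc_bounded[OF f'] by blast
  have Lp: "ae (on_set {a..b} f') \<in> Lp p {a..b}"
    using Lp_bounded(1)[OF p continuous_on_imp_measurable_on[OF f'] c ab] by simp
  have "(rep_ae (ae (on_set {a..b} f')) has_integral f t - f a) {a..t}" if t: "t \<in> {a..b}" for t
  proof -
    have "(f' has_integral f t - f a) {a..t}"
      using t by (intro fundamental_theorem_of_calculus has_vector_derivative_within_subset[OF deriv]) auto
    moreover have "AE r in lebesgue. r \<in> {a..t} \<longrightarrow> rep_ae (ae (on_set {a..b} f')) r = f' r"
      using rep_ae_ae[of "on_set {a..b} f'"] t by (auto simp: on_set_def elim!: eventually_mono)
    ultimately show ?thesis
      using has_integral_cong_AE by blast
  qed
  then show ?thesis
    using Lp by (simp add: has_Lp_deriv_def)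
qed

section \<open>The equation \<open>l \<phi> - \<phi>' = g\<close>\<close>

lemma has_vector_derivative_exp_scaleC:
  fixes f :: "real \<Rightarrow> 'x::complex_banach"
  assumes "(f has_vector_derivative f') (at t within S)"
  shows "((\<lambda>t. exp (l * complex_of_real t) *\<^sub>C f t) has_vector_derivative
    exp (l * complex_of_real t) *\<^sub>C f' + (l * exp (l * complex_of_real t)) *\<^sub>C f t) (at t within S)"
proof -
  have "((\<lambda>t. exp (l * complex_of_real t)) has_vector_derivative l * exp (l * complex_of_real t)) (at t within S)"
    by (rule has_vector_derivative_real_field[where f = "\<lambda>z. exp (l * z)"]) (auto intro!: derivative_eq_intros)
  then show ?thesis
    by (rule scaleC.has_vector_derivative[OF _ assms])
qed

lemma continuous_on_exp_scaleC:
  fixes f :: "real \<Rightarrow> 'x::complex_normed_vector"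
  assumes "continuous_on S f"
  shows "continuous_on S (\<lambda>t. exp (l * complex_of_real t) *\<^sub>C f t)"
  by (intro scaleC.continuous_on continuous_intros assms)

lemma norm_exp_scaleC_le:
  fixes x :: "'x::complex_normed_vector"
  assumes "t \<in> {-1..0}"
  shows "norm (exp (l * complex_of_real t) *\<^sub>C x) \<le> exp (cmod l) * norm x"
proof -
  have "\<bar>t\<bar> \<le> 1"
    using assms by auto
  then have "cmod (l * complex_of_real t) \<le> cmod l"
    by (simp add: norm_mult mult_left_le)
  then have "cmod (exp (l * complex_of_real t)) \<le> exp (cmod l)"
    using complex_Re_le_cmod[of "l * complex_of_real t"] by simp
  then show ?thesis
    by (simp add: norm_scaleC mult_right_mono del: norm_exp_eq_Re)
qed

lemma has_Lp_deriv_exp: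
  fixes x :: "'x::complex_banach"
  assumes "p \<ge> 1"
  shows "has_Lp_deriv p (-1) 0 (\<lambda>t. exp (l * complex_of_real t) *\<^sub>C x) (l *\<^sub>C exp_fun l x)"
proof -
  have "has_Lp_deriv p (-1) 0 (\<lambda>t. exp (l * complex_of_real t) *\<^sub>C x)
      (ae (on_set {-1..0} (\<lambda>t. (l * exp (l * complex_of_real t)) *\<^sub>C x)))"
  proof (rule has_Lp_deriv_C1[OF assms])
    show "((\<lambda>t. exp (l * complex_of_real t) *\<^sub>C x) has_vector_derivative (l * exp (l * complex_of_real t)) *\<^sub>C x)
        (at t within {-1..0})" for t
      using has_vector_derivative_exp_scaleC[of "\<lambda>_. x" 0 t "{-1..0}" l] by simp
    show "continuous_on {-1..0} (\<lambda>t. (l * exp (l * complex_of_real t)) *\<^sub>C x)"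
      by (intro scaleC.continuous_on continuous_intros)
  qed auto
  then show ?thesis
    by (simp add: exp_fun_def ae_on_set_scaleC scaleC_scaleC)
qed

lemma exp_fun_W1p:
  fixes x :: "'x::complex_banach"
  assumes "p \<ge> 1"
  shows "exp_fun l x \<in> W1p p (-1) 0" "weak_deriv p (-1) 0 (exp_fun l x) = l *\<^sub>C exp_fun l x"
    "t \<in> {-1..0} \<Longrightarrow> crep (-1) 0 (exp_fun l x) t = exp (l * complex_of_real t) *\<^sub>C x"
  using W1pI[OF assms _ has_Lp_deriv_exp[OF assms, of l x]] by (simp_all add: exp_fun_def)

lemma exp_fun_add: "exp_fun l (x + y) = exp_fun l x + exp_fun l y"
  by (simp add: exp_fun_def ae_on_set_add scaleC_add_right)

lemma exp_fun_diff: "exp_fun l (x - y) = exp_fun l x - exp_fun l y"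
  by (simp add: exp_fun_def ae_on_set_diff scaleC_diff_right)

lemma crep_exp_fun_zero: "crep (-1) 0 (exp_fun l x) 0 = x"
  using exp_fun_W1p(3)[of 1 0 l x] by simp

text \<open>Evaluation at 0 is a left inverse, so \<open>inv (exp_fun l)\<close> is a faithful
  rendering of e_{-l} on exponentials.\<close>

lemma inj_exp_fun: "inj (exp_fun l)"
  by (rule inj_on_inverseI[of _ "\<lambda>\<phi>. crep (-1) 0 \<phi> 0"]) (rule crep_exp_fun_zero)

lemma W1p_norm_exp_fun_le:
  fixes x :: "'x::complex_banach"
  assumes "p \<ge> 1"
  shows "Lp_norm p (exp_fun l x) \<le> 2 * exp (cmod l) * norm x"
    "W1p_norm p (-1) 0 (exp_fun l x) \<le> (1 + cmod l) * (2 * exp (cmod l)) * norm x"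
proof -
  have "continuous_on {-1..0} (\<lambda>t. exp (l * complex_of_real t) *\<^sub>C x)"
    by (intro continuous_on_exp_scaleC continuous_intros)
  from Lp_bounded(2)[OF assms continuous_on_imp_measurable_on[OF this] norm_exp_scaleC_le]
  show le: "Lp_norm p (exp_fun l x) \<le> 2 * exp (cmod l) * norm x"
    by (simp add: exp_fun_def)
  have "Lp_norm p (l *\<^sub>C exp_fun l x) = cmod l * Lp_norm p (exp_fun l x)"
    using assms W1p_imp_Lp(1)[OF assms _ exp_fun_W1p(1)[OF assms]] by (intro Lp_norm_scaleC) auto
  then have "W1p_norm p (-1) 0 (exp_fun l x) = (1 + cmod l) * Lp_norm p (exp_fun l x)"
    by (simp add: W1p_norm_def exp_fun_W1p(2)[OF assms] algebra_simps)
  also have "\<dots> \<le> (1 + cmod l) * (2 * exp (cmod l) * norm x)"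
    by (intro mult_left_mono le) auto
  finally show "W1p_norm p (-1) 0 (exp_fun l x) \<le> (1 + cmod l) * (2 * exp (cmod l)) * norm x"
    by (simp add: mult.assoc)
qed

text \<open>A regularity bootstrap: the weak derivative agrees almost everywhere with the continuous
  function l f, so f is differentiable in the classical sense and e^{-l t} f(t) has derivative
  0.\<close>

lemma eq_exp_fun_if_weak_deriv_eq:
  fixes \<phi> :: "'x::complex_banach aefun"
  assumes p: "p \<ge> 1" and \<phi>: "\<phi> \<in> W1p p (-1) 0" and eq: "weak_deriv p (-1) 0 \<phi> = l *\<^sub>C \<phi>"
  shows "\<phi> = exp_fun l (crep (-1) 0 \<phi> 0)"
proof -
  let ?f = "crep (-1) 0 \<phi>" and ?S = "{-1..0::real}"
  note W = W1pD[OF p _ \<phi>, simplified]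
  have AE: "AE t in lebesgue. t \<in> ?S \<longrightarrow> rep_ae (l *\<^sub>C \<phi>) t = l *\<^sub>C ?f t"
    using rep_ae_scaleC[of l \<phi>] AE_on_set_rep_ae[OF W(2)] by eventually_elim auto
  have cont: "continuous_on ?S (\<lambda>t. l *\<^sub>C ?f t)"
    using W(3) by (intro scaleC.continuous_on continuous_intros)
  have int: "((\<lambda>t. l *\<^sub>C ?f t) has_integral ?f t - ?f (-1)) {-1..t}" if t: "t \<in> ?S" for t
  proof -
    have "(rep_ae (l *\<^sub>C \<phi>) has_integral ?f t - ?f (-1)) {-1..t}"
      using W(1) t by (auto simp: has_Lp_deriv_def eq)
    moreover have "AE r in lebesgue. r \<in> {-1..t} \<longrightarrow> rep_ae (l *\<^sub>C \<phi>) r = l *\<^sub>C ?f r"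
      using AE t by (auto elim!: eventually_mono)
    ultimately show ?thesis
      by (rule has_integral_cong_AE[THEN iffD1, rotated])
  qed
  have "(?f has_vector_derivative l *\<^sub>C ?f t) (at t within ?S)" if t: "t \<in> ?S" for t
  proof -
    have "((\<lambda>t. integral {-1..t} (\<lambda>t. l *\<^sub>C ?f t) + ?f (-1)) has_vector_derivative l *\<^sub>C ?f t + 0) (at t within ?S)"
      by (intro has_vector_derivative_add integral_has_vector_derivative cont t has_vector_derivative_const)
    then have "((\<lambda>t. integral {-1..t} (\<lambda>t. l *\<^sub>C ?f t) + ?f (-1)) has_vector_derivative l *\<^sub>C ?f t) (at t within ?S)"
      by simp
    then show ?thesis
      using t int by (rule_tac has_vector_derivative_transform[of t ?S]) (auto simp: has_integral_iff)
  qed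
  then have "((\<lambda>t. exp (- l * complex_of_real t) *\<^sub>C ?f t) has_vector_derivative 0) (at t within ?S)" if "t \<in> ?S" for t
    using has_vector_derivative_exp_scaleC[of ?f "l *\<^sub>C ?f t" t ?S "- l"] that
    by (simp add: scaleC_scaleC scaleC.zero_left mult.commute flip: scaleC_add_left)
  then obtain c where c: "\<And>t. t \<in> ?S \<Longrightarrow> exp (- l * complex_of_real t) *\<^sub>C ?f t = c"
    using has_vector_derivative_zero_constant[of ?S "\<lambda>t. exp (- l * complex_of_real t) *\<^sub>C ?f t"] by auto
  have "?f t = exp (l * complex_of_real t) *\<^sub>C ?f 0" if "t \<in> ?S" for t
  proof -
    have "?f t = (exp (l * complex_of_real t) * exp (- l * complex_of_real t)) *\<^sub>C ?f t"
      by (simp flip: exp_add)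
    also have "\<dots> = exp (l * complex_of_real t) *\<^sub>C c"
      using c[OF that] by (simp flip: scaleC_scaleC)
    also have "c = ?f 0"
      using c[of 0] by simp
    finally show ?thesis .
  qed
  then have "ae (on_set ?S ?f) = exp_fun l (?f 0)"
    unfolding exp_fun_def by (rule ae_on_set_cong)
  with W(2) show ?thesis
    by (rule trans)
qed

text \<open>Variation of constants, written so that only continuous functions are differentiated: with
  \<open>h(t) = \<integral>\<^sub>t\<^sup>0 g\<close> and \<open>v' = l v + h\<close>, \<open>v(0) = 0\<close>, the solution is \<open>v'\<close>.\<close>

lemma ex_solution_transport:
  fixes g :: "'x::complex_banach aefun"
  assumes p: "p \<ge> 1" and g: "g \<in> Lp p {-1..0}"
  shows "\<exists>\<phi> \<in> W1p p (-1) 0. crep (-1) 0 \<phi> 0 = 0 \<and> l *\<^sub>C \<phi> - weak_deriv p (-1) 0 \<phi> = g \<and>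
    Lp_norm p \<phi> \<le> 4 * (1 + cmod l * exp (cmod l) * exp (cmod l)) * Lp_norm p g"
proof -
  let ?S = "{-1..0::real}"
  define \<gamma> where "\<gamma> = integral ?S (\<lambda>t. norm (rep_ae g t))"
  note g_int = Lp_imp_integrable[OF p g, simplified]
  have \<gamma>: "\<gamma> \<le> 2 * Lp_norm p g"
    using g_int(3) by (simp add: \<gamma>_def)
  have \<gamma>0: "\<gamma> \<ge> 0"
    unfolding \<gamma>_def using g_int(1) by (intro integral_nonneg) auto
  define h where "h t = integral ?S (rep_ae g) - integral {-1..t} (rep_ae g)" for t
  have h_cont: "continuous_on ?S h"
    unfolding h_def using g_int(2) by (intro continuous_intros indefinite_integral_continuous_1)
  have h_le: "norm (h t) \<le> \<gamma>" if t: "t \<in> ?S" for t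
  proof -
    have sub: "{t..0} \<subseteq> ?S" using t by auto
    have "h t = integral {t..0} (rep_ae g)"
      using Henstock_Kurzweil_Integration.integral_combine[of "-1" t 0 "rep_ae g"] t g_int(2)
      by (auto simp: h_def algebra_simps)
    also have "norm \<dots> \<le> integral {t..0} (\<lambda>t. norm (rep_ae g t))"
      using integrable_subinterval_real[OF g_int(1) sub] integrable_subinterval_real[OF g_int(2) sub]
      by (intro integral_norm_bound_integral) auto
    also have "\<dots> \<le> \<gamma>"
      unfolding \<gamma>_def using integrable_subinterval_real[OF g_int(1) sub] g_int(1) sub
      by (intro integral_subset_le) auto
    finally show ?thesis .
  qed
  \<comment> \<open>Substituting v(t) = e^{l t} q(t) reduces v' = l v + h to q' = e^{-l t} h; the
    constant in \<open>q\<close> is fixed by q(0) = 0.\<close>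
  define k where "k s = exp (- l * complex_of_real s) *\<^sub>C h s" for s
  have k_cont: "continuous_on ?S k"
    unfolding k_def by (intro continuous_on_exp_scaleC h_cont)
  have k_le: "norm (k t) \<le> exp (cmod l) * \<gamma>" if t: "t \<in> ?S" for t
    using order_trans[OF norm_exp_scaleC_le[OF t, of "- l" "h t"] mult_left_mono[OF h_le[OF t]]]
    by (simp add: k_def)
  define q where "q t = integral {-1..t} k - integral ?S k" for t
  have q_deriv: "(q has_vector_derivative k t) (at t within ?S)" if "t \<in> ?S" for t
    using has_vector_derivative_diff[OF integral_has_vector_derivative[OF k_cont that] has_vector_derivative_const]
    by (simp add: q_def[abs_def])
  have q_le: "norm (q t) \<le> exp (cmod l) * \<gamma>" if t: "t \<in> ?S" for t
  proof -
    have sub: "{t..0} \<subseteq> ?S" using t by auto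
    have "q t = - integral {t..0} k"
      using Henstock_Kurzweil_Integration.integral_combine[of "-1" t 0 k] t integrable_continuous_interval[OF k_cont]
      by (auto simp: q_def algebra_simps)
    also have "norm \<dots> \<le> exp (cmod l) * \<gamma> * (0 - t)"
      using t sub k_le continuous_on_subset[OF k_cont sub] by (simp only: norm_minus_cancel) (intro integral_bound, auto)
    also have "\<dots> \<le> exp (cmod l) * \<gamma> * 1"
      using t \<gamma>0 by (intro mult_left_mono) auto
    finally show ?thesis by simp
  qed
  define v where "v t = exp (l * complex_of_real t) *\<^sub>C q t" for t
  \<comment> \<open>This is v'. In the weak sense h' = -g, hence w' = -g + l w, which is the
    required equation.\<close>
  define w where "w t = h t + l *\<^sub>C v t" for t
  have v_deriv: "(v has_vector_derivative w t) (at t within ?S)" if "t \<in> ?S" for t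
  proof -
    have "exp (l * complex_of_real t) *\<^sub>C k t + (l * exp (l * complex_of_real t)) *\<^sub>C q t = w t"
      by (simp add: k_def w_def v_def scaleC_scaleC flip: exp_add)
    then show ?thesis
      using has_vector_derivative_exp_scaleC[OF q_deriv[OF that], of l] by (simp add: v_def[abs_def])
  qed
  have v_cont: "continuous_on ?S v"
    using v_deriv has_vector_derivative_continuous continuous_on_eq_continuous_within by blast
  have w_cont: "continuous_on ?S w"
    unfolding w_def by (intro continuous_intros scaleC.continuous_on h_cont v_cont)
  have w_le: "norm (w t) \<le> (1 + cmod l * exp (cmod l) * exp (cmod l)) * \<gamma>" if t: "t \<in> ?S" for t
  proof -
    have "norm (v t) \<le> exp (cmod l) * (exp (cmod l) * \<gamma>)"
      using order_trans[OF norm_exp_scaleC_le[OF t, of l "q t"] mult_left_mono[OF q_le[OF t]]] by (simp add: v_def)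
    then have "norm (l *\<^sub>C v t) \<le> cmod l * (exp (cmod l) * (exp (cmod l) * \<gamma>))"
      by (simp add: norm_scaleC mult_left_mono)
    then show ?thesis
      using h_le[OF t] norm_triangle_ineq[of "h t" "l *\<^sub>C v t"] by (simp add: w_def algebra_simps)
  qed
  define \<phi> where "\<phi> = ae (on_set ?S w)"
  note \<phi>_Lp = Lp_bounded[OF p continuous_on_imp_measurable_on[OF w_cont] w_le, simplified, folded \<phi>_def]
  have "has_Lp_deriv p (-1) 0 w (l *\<^sub>C \<phi> - g)"
    unfolding has_Lp_deriv_def
  proof (intro conjI ballI)
    show "l *\<^sub>C \<phi> - g \<in> Lp p ?S"
      using p by (intro Lp_diff Lp_scaleC \<phi>_Lp g) auto
    fix t assume t: "t \<in> ?S"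
    have "has_Lp_deriv p (-1) 0 v \<phi>"
      unfolding \<phi>_def using p v_deriv w_cont by (intro has_Lp_deriv_C1) auto
    then have "(rep_ae \<phi> has_integral v t - v (-1)) {-1..t}"
      using t by (simp add: has_Lp_deriv_def)
    moreover have "(rep_ae g has_integral h (-1) - h t) {-1..t}"
      using integrable_subinterval_real[OF g_int(2), of "-1" t] t by (simp add: h_def has_integral_integral)
    ultimately have "(rep_ae (l *\<^sub>C \<phi> + (-1) *\<^sub>C g) has_integral l *\<^sub>C (v t - v (-1)) + (-1) *\<^sub>C (h (-1) - h t)) {-1..t}"
      by (intro has_integral_rep_ae_add has_integral_rep_ae_scaleC)
    then show "(rep_ae (l *\<^sub>C \<phi> - g) has_integral w t - w (-1)) {-1..t}"
      by (simp add: scaleC_minus_one w_def scaleC_diff_right algebra_simps)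
  qed
  note W = W1pI[OF p _ this, simplified, folded \<phi>_def]
  have "crep (-1) 0 \<phi> 0 = 0"
    using W(3)[of 0] by (simp add: w_def h_def v_def q_def)
  \<comment> \<open>The factor 4 is 2 times 2: one from bounding an L^p norm by a supremum on
    [-1,0], one from bounding an L^1 norm by an L^p norm.\<close>
  moreover have "Lp_norm p \<phi> \<le> 4 * (1 + cmod l * exp (cmod l) * exp (cmod l)) * Lp_norm p g"
  proof -
    let ?C = "1 + cmod l * exp (cmod l) * exp (cmod l)"
    have "Lp_norm p \<phi> \<le> 2 * (?C * \<gamma>)"
      using \<phi>_Lp(2) by simp
    also have "\<dots> \<le> 2 * (?C * (2 * Lp_norm p g))"
      by (intro mult_left_mono \<gamma>) auto
    also have "\<dots> = 4 * ?C * Lp_norm p g"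
      by simp
    finally show ?thesis .
  qed
  ultimately show ?thesis
    using W by (intro bexI[of _ \<phi>]) auto
qed

section \<open>Riemann-Stieltjes integrals\<close>

definition variation_le :: "real \<Rightarrow> real \<Rightarrow> (real \<Rightarrow> 'v::real_normed_vector) \<Rightarrow> real \<Rightarrow> bool" where
  "variation_le a b m V \<longleftrightarrow> (\<forall>d. d division_of {a..b} \<longrightarrow> (\<Sum>k\<in>d. norm (m (Sup k) - m (Inf k))) \<le> V)"

definition stieltjes_sum ::
    "(real \<Rightarrow> 'x::real_normed_vector \<Rightarrow>\<^sub>L 'y::real_normed_vector) \<Rightarrow> (real \<Rightarrow> 'x) \<Rightarrow> (real \<times> real set) set \<Rightarrow> 'y" where
  "stieltjes_sum m f q = (\<Sum>(s, k)\<in>q. blinfun_apply (m (Sup k) - m (Inf k)) (f s))"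

lemma tagged_division_Icc:
  fixes a b :: real
  assumes "q tagged_division_of {a..b}" "(s, k) \<in> q"
  obtains u v where "k = {u..v}" "a \<le> u" "u \<le> s" "s \<le> v" "v \<le> b"
proof -
  obtain u v where k: "k = {u..v}"
    using tagged_division_ofD(4)[OF assms] by (metis box_real(2))
  show thesis
    using that[OF k] tagged_division_ofD(2,3)[OF assms] k by auto
qed

lemma stieltjes_sum_cong:
  assumes "q tagged_division_of {a..b}" "\<And>t. t \<in> {a..b} \<Longrightarrow> f t = g t"
  shows "stieltjes_sum m f q = stieltjes_sum m g q"
  unfolding stieltjes_sum_def
proof (rule sum.cong[OF refl], clarify)
  fix s k assume "(s, k) \<in> q"
  then have "s \<in> {a..b}"
    using tagged_division_Icc[OF assms(1)] by (metis atLeastAtMost_iff order_trans)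
  then show "blinfun_apply (m (Sup k) - m (Inf k)) (f s) = blinfun_apply (m (Sup k) - m (Inf k)) (g s)"
    by (simp add: assms(2))
qed

lemma stieltjes_sum_add: "stieltjes_sum m (\<lambda>t. f t + g t) q = stieltjes_sum m f q + stieltjes_sum m g q"
  by (simp add: stieltjes_sum_def case_prod_unfold blinfun.add_right sum.distrib)

text \<open>Two different tags can share an interval only if its interior is empty, and such an
  interval contributes no increment. The sum over tags is therefore a sum over a division.\<close>

lemma variation_le_tagged:
  fixes m :: "real \<Rightarrow> 'v::real_normed_vector"
  assumes V: "variation_le a b m V" and q: "q tagged_division_of {a..b}"
  shows "(\<Sum>(s, k)\<in>q. norm (m (Sup k) - m (Inf k))) \<le> V"
proof -
  \<comment> \<open>\<open>Sup {}\<close> and \<open>Inf {}\<close> carry no information, so the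
    empty set is given the value 0 explicitly; the reindexing lemma asks for 0 on every interval
    without interior.\<close>
  define e where "e k = (if k = {} then 0 else norm (m (Sup k) - m (Inf k)))" for k
  have nonempty: "k \<noteq> {}" if "(s, k) \<in> q" for s k
    using tagged_division_ofD(2)[OF q that] by auto
  have "(\<Sum>(s, k)\<in>q. norm (m (Sup k) - m (Inf k))) = (\<Sum>(s, k)\<in>q. e k)"
    by (intro sum.cong) (auto simp: e_def dest: nonempty)
  also have "\<dots> = sum e (snd ` q)"
    by (rule sum.over_tagged_division_lemma[OF q]) (auto simp: e_def)
  also have "\<dots> = (\<Sum>k\<in>snd ` q. norm (m (Sup k) - m (Inf k)))"
    by (intro sum.cong) (auto simp: e_def dest: nonempty)
  also have "\<dots> \<le> V"
    using V division_of_tagged_division[OF q] by (simp add: variation_le_def)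
  finally show ?thesis .
qed

lemma variation_le_bounded:
  assumes V: "variation_le a b m V" and t: "t \<in> {a..b}"
  shows "norm (m t) \<le> norm (m a) + V"
proof -
  have d: "{{a..t}, {t..b}} division_of {a..b}"
    using t by (auto simp: division_of_def)
  have "norm (m t - m a) \<le> (\<Sum>k\<in>{{a..t}, {t..b}}. norm (m (Sup k) - m (Inf k)))"
    using t by (cases "{a..t} = {t..b}") auto
  also have "\<dots> \<le> V"
    using V d by (simp add: variation_le_def)
  finally show ?thesis
    using norm_triangle_sub[of "m t" "m a"] by simp
qed

text \<open>Clamping arguments to [u,v] sends the endpoints of a piece to those of its intersection
  with [u,v], or to a single point if the intersection is empty. The sum thus telescopes for
  \<open>m\<close> composed with the clamp.\<close>

lemma increment_over_tagged_division:
  fixes m :: "real \<Rightarrow> 'v::real_normed_vector"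
  assumes q: "q tagged_division_of {a..b}" and "a \<le> u" "u \<le> v" "v \<le> b"
  shows "(\<Sum>(s, k)\<in>q. if {u..v} \<inter> k = {} then 0 else m (Sup ({u..v} \<inter> k)) - m (Inf ({u..v} \<inter> k))) = m v - m u"
proof -
  let ?c = "\<lambda>t. max u (min v t)"
  have "(\<Sum>(s, k)\<in>q. if {u..v} \<inter> k = {} then 0 else m (Sup ({u..v} \<inter> k)) - m (Inf ({u..v} \<inter> k)))
      = (\<Sum>(s, k)\<in>q. m (?c (Sup k)) - m (?c (Inf k)))"
  proof (rule sum.cong[OF refl], clarify)
    fix s k assume "(s, k) \<in> q"
    then obtain x y where k: "k = {x..y}" and xy: "x \<le> y"
      using tagged_division_Icc[OF q] by (metis order_trans)
    have "{u..v} \<inter> k = {max u x..min v y}"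
      using k by auto
    then show "(if {u..v} \<inter> k = {} then 0 else m (Sup ({u..v} \<inter> k)) - m (Inf ({u..v} \<inter> k)))
        = m (?c (Sup k)) - m (?c (Inf k))"
      using k xy assms by (auto simp: max_def min_def)
  qed
  also have "\<dots> = m (?c b) - m (?c a)"
    using additive_tagged_division_1[OF _ q, of "\<lambda>t. m (?c t)"] assms by simp
  also have "?c b = v"
    using assms by (simp add: max_def min_def)
  also have "?c a = u"
    using assms by (auto simp: max_def min_def)
  finally show ?thesis .
qed

text \<open>The nonempty intersections form a division of the interval. The work lies in passing
  from pairs of tagged pieces to distinct intersections: when two pairs give the same set, its
  interior is empty, so it is at most a point and counts as 0.\<close>

lemma variation_le_common_refinement:
  fixes m :: "real \<Rightarrow> 'v::real_normed_vector"
  assumes V: "variation_le a b m V" and q1: "q1 tagged_division_of {a..b}" and q2: "q2 tagged_division_of {a..b}"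
  shows "(\<Sum>(s1, k1)\<in>q1. \<Sum>(s2, k2)\<in>q2. if k1 \<inter> k2 = {} then 0 else norm (m (Sup (k1 \<inter> k2)) - m (Inf (k1 \<inter> k2)))) \<le> V"
proof -
  define e where "e k = (if k = {} then 0 else norm (m (Sup k) - m (Inf k)))" for k
  let ?p1 = "snd ` q1" and ?p2 = "snd ` q2"
  have d1: "?p1 division_of {a..b}" and d2: "?p2 division_of {a..b}"
    using division_of_tagged_division q1 q2 by auto
  have e_degenerate: "e K = 0" if "box u v = {}" "K \<subseteq> cbox u v" for K and u v :: real
  proof (cases "K = {}")
    case False
    then have "u = v"
      using that by fastforce
    then have "K = {u}"
      using that False by auto
    then show ?thesis by (simp add: e_def)
  qed (simp add: e_def)
  have "(\<Sum>(s1, k1)\<in>q1. \<Sum>(s2, k2)\<in>q2. e (k1 \<inter> k2)) = (\<Sum>(s1, k1)\<in>q1. \<Sum>k2\<in>?p2. e (k1 \<inter> k2))"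
    by (intro sum.cong refl, clarify, rule sum.over_tagged_division_lemma[OF q2]) (rule e_degenerate, auto)
  also have "\<dots> = (\<Sum>k1\<in>?p1. \<Sum>k2\<in>?p2. e (k1 \<inter> k2))"
    by (rule sum.over_tagged_division_lemma[OF q1]) (auto intro!: sum.neutral e_degenerate)
  also have "\<dots> = sum (e \<circ> (\<lambda>(k1, k2). k1 \<inter> k2)) (?p1 \<times> ?p2)"
    by (simp add: sum.cartesian_product case_prod_unfold)
  also have "\<dots> = sum e ((\<lambda>(k1, k2). k1 \<inter> k2) ` (?p1 \<times> ?p2))"
  proof (rule sum.reindex_nontrivial[symmetric])
    show "finite (?p1 \<times> ?p2)"
      using d1 d2 by (simp add: division_of_finite)
    fix x y assume x: "x \<in> ?p1 \<times> ?p2" and y: "y \<in> ?p1 \<times> ?p2" and ne: "x \<noteq> y"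
      and eq: "(\<lambda>(k1, k2). k1 \<inter> k2) x = (\<lambda>(k1, k2). k1 \<inter> k2) y"
    obtain k1 k2 l1 l2 where xy: "x = (k1, k2)" "y = (l1, l2)" by fastforce
    have k: "k1 \<in> ?p1" "k2 \<in> ?p2" "l1 \<in> ?p1" "l2 \<in> ?p2" and eq: "k1 \<inter> k2 = l1 \<inter> l2"
      using x y eq xy by auto
    have "interior k1 \<inter> interior l1 = {} \<or> interior k2 \<inter> interior l2 = {}"
      using ne xy division_ofD(5)[OF d1 k(1,3)] division_ofD(5)[OF d2 k(2,4)] by auto
    moreover have "interior (k1 \<inter> k2) = interior (l1 \<inter> l2)"
      by (simp only: eq)
    ultimately have int: "interior (k1 \<inter> k2) = {}"
      unfolding interior_Int by blast
    obtain u1 v1 where "k1 = cbox u1 v1"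
      using division_ofD(4)[OF d1 k(1)] by auto
    moreover obtain u2 v2 where "k2 = cbox u2 v2"
      using division_ofD(4)[OF d2 k(2)] by auto
    ultimately have k12: "k1 \<inter> k2 = cbox (max u1 u2) (min v1 v2)"
      by auto
    then have "box (max u1 u2) (min v1 v2) = {}"
      using int by (simp add: interior_cbox)
    then show "e ((\<lambda>(k1, k2). k1 \<inter> k2) x) = 0"
      using e_degenerate[of "max u1 u2" "min v1 v2" "k1 \<inter> k2"] k12 xy by simp
  qed
  also have "\<dots> = sum e {k1 \<inter> k2 | k1 k2. k1 \<in> ?p1 \<and> k2 \<in> ?p2 \<and> k1 \<inter> k2 \<noteq> {}}"
  proof (rule sum.mono_neutral_right)
    show "finite ((\<lambda>(k1, k2). k1 \<inter> k2) ` (?p1 \<times> ?p2))"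
      using d1 d2 by (simp add: division_of_finite)
    show "\<forall>K \<in> (\<lambda>(k1, k2). k1 \<inter> k2) ` (?p1 \<times> ?p2)
        - {k1 \<inter> k2 | k1 k2. k1 \<in> ?p1 \<and> k2 \<in> ?p2 \<and> k1 \<inter> k2 \<noteq> {}}. e K = 0"
    proof
      fix K assume "K \<in> (\<lambda>(k1, k2). k1 \<inter> k2) ` (?p1 \<times> ?p2)
        - {k1 \<inter> k2 | k1 k2. k1 \<in> ?p1 \<and> k2 \<in> ?p2 \<and> k1 \<inter> k2 \<noteq> {}}"
      then have "K = {}" by blast
      then show "e K = 0" by (simp add: e_def)
    qed
  qed blast
  also have "\<dots> = (\<Sum>k\<in>{k1 \<inter> k2 | k1 k2. k1 \<in> ?p1 \<and> k2 \<in> ?p2 \<and> k1 \<inter> k2 \<noteq> {}}. norm (m (Sup k) - m (Inf k)))"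
    by (intro sum.cong) (auto simp: e_def)
  also have "\<dots> \<le> V"
    using V division_inter[OF d1 d2] by (simp add: variation_le_def)
  finally show ?thesis
    by (simp add: e_def)
qed

text \<open>Both sums are written over the common refinement. There the increments of
  \<open>m\<close> coincide and only the tags differ, so the difference is at most the variation
  times the oscillation of \<open>f\<close> between tags of overlapping pieces.\<close>

lemma norm_diff_stieltjes_sum_le:
  fixes m :: "real \<Rightarrow> 'x::real_normed_vector \<Rightarrow>\<^sub>L 'y::real_normed_vector"
  assumes V: "variation_le a b m V" and q1: "q1 tagged_division_of {a..b}" and q2: "q2 tagged_division_of {a..b}"
    and le: "\<And>s1 k1 s2 k2. (s1, k1) \<in> q1 \<Longrightarrow> (s2, k2) \<in> q2 \<Longrightarrow> k1 \<inter> k2 \<noteq> {} \<Longrightarrow> norm (f s1 - f s2) \<le> \<omega>" and "\<omega> \<ge> 0"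
  shows "norm (stieltjes_sum m f q1 - stieltjes_sum m f q2) \<le> V * \<omega>"
proof -
  define E where "E k = (if k = {} then 0 else m (Sup k) - m (Inf k))" for k
  have split: "m (Sup k) - m (Inf k) = (\<Sum>(s', k')\<in>q'. E (k \<inter> k'))"
    if q: "q tagged_division_of {a..b}" and q': "q' tagged_division_of {a..b}" and sk: "(s, k) \<in> q" for q q' s k
  proof -
    obtain u v where k: "k = {u..v}" "a \<le> u" "u \<le> s" "s \<le> v" "v \<le> b"
      using tagged_division_Icc[OF q sk] .
    then show ?thesis
      using increment_over_tagged_division[OF q', of u v m] by (simp add: E_def)
  qed
  have "stieltjes_sum m f q1 = (\<Sum>(s1, k1)\<in>q1. \<Sum>(s2, k2)\<in>q2. blinfun_apply (E (k1 \<inter> k2)) (f s1))"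
    unfolding stieltjes_sum_def
    by (intro sum.cong refl) (clarify, simp add: split[OF q1 q2] blinfun.sum_left case_prod_unfold)
  moreover have "stieltjes_sum m f q2 = (\<Sum>(s2, k2)\<in>q2. \<Sum>(s1, k1)\<in>q1. blinfun_apply (E (k1 \<inter> k2)) (f s2))"
    unfolding stieltjes_sum_def
    by (intro sum.cong refl) (clarify, simp add: split[OF q2 q1] blinfun.sum_left case_prod_unfold Int_commute)
  moreover have "(\<Sum>(s2, k2)\<in>q2. \<Sum>(s1, k1)\<in>q1. blinfun_apply (E (k1 \<inter> k2)) (f s2))
      = (\<Sum>(s1, k1)\<in>q1. \<Sum>(s2, k2)\<in>q2. blinfun_apply (E (k1 \<inter> k2)) (f s2))"
    unfolding case_prod_unfold by (rule sum.swap)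
  ultimately have "norm (stieltjes_sum m f q1 - stieltjes_sum m f q2)
      = norm (\<Sum>(s1, k1)\<in>q1. \<Sum>(s2, k2)\<in>q2. blinfun_apply (E (k1 \<inter> k2)) (f s1 - f s2))"
    by (simp add: case_prod_unfold sum_subtractf blinfun.diff_right)
  also have "\<dots> \<le> (\<Sum>(s1, k1)\<in>q1. \<Sum>(s2, k2)\<in>q2. norm (blinfun_apply (E (k1 \<inter> k2)) (f s1 - f s2)))"
    unfolding case_prod_unfold by (rule order_trans[OF norm_sum sum_mono[OF norm_sum]])
  also have "\<dots> \<le> (\<Sum>(s1, k1)\<in>q1. \<Sum>(s2, k2)\<in>q2. norm (E (k1 \<inter> k2)) * \<omega>)"
  proof (intro sum_mono, clarify, intro sum_mono, clarify)
    fix s1 k1 s2 k2 assume sk: "(s1, k1) \<in> q1" "(s2, k2) \<in> q2"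
    show "norm (blinfun_apply (E (k1 \<inter> k2)) (f s1 - f s2)) \<le> norm (E (k1 \<inter> k2)) * \<omega>"
    proof (cases "k1 \<inter> k2 = {}")
      case False
      then show ?thesis
        using order_trans[OF norm_blinfun mult_left_mono[OF le[OF sk False]]] by simp
    qed (simp add: E_def)
  qed
  also have "\<dots> = (\<Sum>(s1, k1)\<in>q1. \<Sum>(s2, k2)\<in>q2. norm (E (k1 \<inter> k2))) * \<omega>"
    by (simp add: case_prod_unfold sum_distrib_right)
  also have "\<dots> \<le> V * \<omega>"
    using variation_le_common_refinement[OF V q1 q2] assms(5)
    by (intro mult_right_mono) (simp_all add: E_def if_distrib cong: if_cong)
  finally show ?thesis .
qed

lemma has_stieltjes_integral_alt:
  "has_stieltjes_integral a b m f I \<longleftrightarrow>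
    (\<forall>\<epsilon>>0. \<exists>\<delta>>0. \<forall>q. q tagged_division_of {a..b} \<and> (\<lambda>s. ball s \<delta>) fine q \<longrightarrow> norm (stieltjes_sum m f q - I) < \<epsilon>)"
  by (simp add: has_stieltjes_integral_def stieltjes_sum_def)

lemma ex_fine_tagged_division:
  fixes a b :: real
  assumes "\<delta> > 0"
  obtains q where "q tagged_division_of {a..b}" "(\<lambda>s. ball s \<delta>) fine q"
  using fine_division_exists_real[OF gauge_ball[OF assms]] by blast

lemma fine_ball_mono: "(\<lambda>s. ball s \<delta>) fine q \<Longrightarrow> \<delta> \<le> \<delta>' \<Longrightarrow> (\<lambda>s. ball s \<delta>') fine q"
  by (fastforce simp: fine_def)

lemma stieltjes_sum_Cauchy:
  fixes m :: "real \<Rightarrow> 'x::real_normed_vector \<Rightarrow>\<^sub>L 'y::real_normed_vector"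
  assumes V: "variation_le a b m V" and f: "continuous_on {a..b} f" and \<epsilon>: "\<epsilon> > 0"
  obtains \<delta> where "\<delta> > 0" "\<And>q1 q2. q1 tagged_division_of {a..b} \<Longrightarrow> (\<lambda>s. ball s \<delta>) fine q1 \<Longrightarrow>
    q2 tagged_division_of {a..b} \<Longrightarrow> (\<lambda>s. ball s \<delta>) fine q2 \<Longrightarrow>
    norm (stieltjes_sum m f q1 - stieltjes_sum m f q2) < \<epsilon>"
proof -
  \<comment> \<open>Strictly larger than \<open>V\<close> and positive, so that it can serve as a
    divisor and leaves a strict inequality at the end.\<close>
  define W where "W = max V 0 + 1"
  have W: "W > 0" "V < W" by (auto simp: W_def)
  obtain \<delta> where \<delta>: "\<delta> > 0"
    and unif: "\<And>s t. s \<in> {a..b} \<Longrightarrow> t \<in> {a..b} \<Longrightarrow> dist t s < \<delta> \<Longrightarrow> dist (f t) (f s) < \<epsilon> / W"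
    using compact_uniformly_continuous[OF f compact_Icc] \<epsilon> W(1) unfolding uniformly_continuous_on_def
    by (metis divide_pos_pos)
  show thesis
  \<comment> \<open>Half of the modulus suffices: tags of overlapping pieces are each within that
    distance of a common point.\<close>
  proof (rule that[of "\<delta> / 2"])
    fix q1 q2 assume q1: "q1 tagged_division_of {a..b}" "(\<lambda>s. ball s (\<delta> / 2)) fine q1"
      and q2: "q2 tagged_division_of {a..b}" "(\<lambda>s. ball s (\<delta> / 2)) fine q2"
    have "norm (stieltjes_sum m f q1 - stieltjes_sum m f q2) \<le> V * (\<epsilon> / W)"
    proof (rule norm_diff_stieltjes_sum_le[OF V q1(1) q2(1)])
      fix s1 k1 s2 k2 assume sk: "(s1, k1) \<in> q1" "(s2, k2) \<in> q2" and "k1 \<inter> k2 \<noteq> {}"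
      then obtain r where "r \<in> k1" "r \<in> k2" by blast
      then have "dist s1 r < \<delta> / 2" "dist s2 r < \<delta> / 2"
        using fineD[OF q1(2) sk(1)] fineD[OF q2(2) sk(2)] by auto
      then have "dist s1 s2 < \<delta>"
        using dist_triangle_half_l by (metis dist_commute)
      moreover have "s1 \<in> {a..b}" "s2 \<in> {a..b}"
        using tagged_division_ofD(2,3)[OF q1(1) sk(1)] tagged_division_ofD(2,3)[OF q2(1) sk(2)] by blast+
      ultimately show "norm (f s1 - f s2) \<le> \<epsilon> / W"
        using unif[of s2 s1] by (simp add: dist_norm)
    qed (use \<epsilon> W in simp)
    also have "\<dots> < W * (\<epsilon> / W)"
      using \<epsilon> W by (intro mult_strict_right_mono) auto
    finally show "norm (stieltjes_sum m f q1 - stieltjes_sum m f q2) < \<epsilon>"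
      using W by simp
  qed (use \<delta> in simp)
qed

lemma ex_stieltjes_integral:
  fixes m :: "real \<Rightarrow> 'x::real_normed_vector \<Rightarrow>\<^sub>L 'y::banach"
  assumes V: "variation_le a b m V" and f: "continuous_on {a..b} f"
  shows "\<exists>I. has_stieltjes_integral a b m f I"
proof -
  have "\<exists>q. q tagged_division_of {a..b} \<and> (\<lambda>s. ball s (1 / real (Suc n))) fine q" for n
    by (rule ex_fine_tagged_division[of "1 / real (Suc n)" a b]) auto
  then obtain Q where Q: "\<And>n. Q n tagged_division_of {a..b}" "\<And>n. (\<lambda>s. ball s (1 / real (Suc n))) fine Q n"
    by metis
  have Q_fine: "\<exists>N. \<forall>n\<ge>N. (\<lambda>s. ball s \<delta>) fine Q n" if \<delta>: "\<delta> > 0" for \<delta>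
  proof -
    obtain N where N: "1 / real (Suc N) < \<delta>"
      using nat_approx_posE[OF \<delta>] by auto
    have "(\<lambda>s. ball s \<delta>) fine Q n" if "n \<ge> N" for n
    proof (rule fine_ball_mono[OF Q(2)])
      have "1 / real (Suc n) \<le> 1 / real (Suc N)"
        using that by (simp add: frac_le)
      then show "1 / real (Suc n) \<le> \<delta>"
        using N by simp
    qed
    then show ?thesis by blast
  qed
  have "Cauchy (\<lambda>n. stieltjes_sum m f (Q n))"
  proof (rule CauchyI)
    fix \<epsilon> :: real assume "\<epsilon> > 0"
    then obtain \<delta> where \<delta>: "\<delta> > 0" and close: "\<And>q1 q2. q1 tagged_division_of {a..b} \<Longrightarrow> (\<lambda>s. ball s \<delta>) fine q1 \<Longrightarrow>
      q2 tagged_division_of {a..b} \<Longrightarrow> (\<lambda>s. ball s \<delta>) fine q2 \<Longrightarrow>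
      norm (stieltjes_sum m f q1 - stieltjes_sum m f q2) < \<epsilon>"
      using stieltjes_sum_Cauchy[OF V f] by metis
    then show "\<exists>N. \<forall>i\<ge>N. \<forall>n\<ge>N. norm (stieltjes_sum m f (Q i) - stieltjes_sum m f (Q n)) < \<epsilon>"
      using Q_fine[OF \<delta>] Q(1) by metis
  qed
  then obtain I where I: "(\<lambda>n. stieltjes_sum m f (Q n)) \<longlonglongrightarrow> I"
    using Cauchy_convergent_iff convergent_def by blast
  have "\<exists>\<delta>>0. \<forall>q. q tagged_division_of {a..b} \<and> (\<lambda>s. ball s \<delta>) fine q \<longrightarrow> norm (stieltjes_sum m f q - I) < \<epsilon>"
    if \<epsilon>: "\<epsilon> > 0" for \<epsilon>
  proof -
    obtain \<delta> where \<delta>: "\<delta> > 0" and close: "\<And>q1 q2. q1 tagged_division_of {a..b} \<Longrightarrow> (\<lambda>s. ball s \<delta>) fine q1 \<Longrightarrow>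
      q2 tagged_division_of {a..b} \<Longrightarrow> (\<lambda>s. ball s \<delta>) fine q2 \<Longrightarrow>
      norm (stieltjes_sum m f q1 - stieltjes_sum m f q2) < \<epsilon> / 2"
      using stieltjes_sum_Cauchy[OF V f half_gt_zero[OF \<epsilon>]] by metis
    have "norm (stieltjes_sum m f q - I) < \<epsilon>" if q: "q tagged_division_of {a..b}" "(\<lambda>s. ball s \<delta>) fine q" for q
    proof -
      obtain N where N: "\<And>n. n \<ge> N \<Longrightarrow> (\<lambda>s. ball s \<delta>) fine Q n"
        using Q_fine[OF \<delta>] by blast
      have "(\<lambda>n. norm (stieltjes_sum m f q - stieltjes_sum m f (Q n))) \<longlonglongrightarrow> norm (stieltjes_sum m f q - I)"
        by (intro tendsto_intros I)
      moreover have "norm (stieltjes_sum m f q - stieltjes_sum m f (Q n)) \<le> \<epsilon> / 2" if "n \<ge> N" for n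
        using close[OF q Q(1) N[OF that]] by simp
      ultimately have "norm (stieltjes_sum m f q - I) \<le> \<epsilon> / 2"
        by (intro LIMSEQ_le_const2) auto
      then show ?thesis
        using \<epsilon> by simp
    qed
    then show ?thesis
      using \<delta> by blast
  qed
  then show ?thesis
    unfolding has_stieltjes_integral_alt by blast
qed

section \<open>Bounds, additivity and uniqueness of the Stieltjes integral\<close>

lemma norm_stieltjes_integral_le:
  fixes m :: "real \<Rightarrow> 'x::real_normed_vector \<Rightarrow>\<^sub>L 'y::real_normed_vector"
  assumes I: "has_stieltjes_integral a b m f I" and \<delta>: "\<delta> > 0"
    and le: "\<And>q. q tagged_division_of {a..b} \<Longrightarrow> (\<lambda>s. ball s \<delta>) fine q \<Longrightarrow> norm (stieltjes_sum m f q) \<le> c"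
  shows "norm I \<le> c"
proof (rule field_le_epsilon)
  fix \<epsilon> :: real assume "\<epsilon> > 0"
  then obtain \<delta>' where \<delta>': "\<delta>' > 0" and close: "\<And>q. q tagged_division_of {a..b} \<Longrightarrow> (\<lambda>s. ball s \<delta>') fine q \<Longrightarrow>
      norm (stieltjes_sum m f q - I) < \<epsilon>"
    using I unfolding has_stieltjes_integral_alt by metis
  obtain q where q: "q tagged_division_of {a..b}" "(\<lambda>s. ball s (min \<delta> \<delta>')) fine q"
    using ex_fine_tagged_division[of "min \<delta> \<delta>'"] \<delta> \<delta>' by auto
  then have "norm (stieltjes_sum m f q) \<le> c" "norm (stieltjes_sum m f q - I) < \<epsilon>"
    using le close fine_ball_mono[OF q(2)] by auto
  then show "norm I \<le> c + \<epsilon>"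
    using norm_triangle_sub[of I "stieltjes_sum m f q"] by (simp add: norm_minus_commute)
qed

lemma has_stieltjes_integral_add:
  assumes "has_stieltjes_integral a b m f I" "has_stieltjes_integral a b m g I'"
  shows "has_stieltjes_integral a b m (\<lambda>t. f t + g t) (I + I')"
  unfolding has_stieltjes_integral_alt
proof (intro allI impI)
  fix \<epsilon> :: real assume \<epsilon>: "\<epsilon> > 0"
  obtain \<delta> where \<delta>: "\<delta> > 0" and f: "\<And>q. q tagged_division_of {a..b} \<Longrightarrow> (\<lambda>s. ball s \<delta>) fine q \<Longrightarrow>
      norm (stieltjes_sum m f q - I) < \<epsilon> / 2"
    using assms(1) half_gt_zero[OF \<epsilon>] unfolding has_stieltjes_integral_alt by metis
  obtain \<delta>' where \<delta>': "\<delta>' > 0" and g: "\<And>q. q tagged_division_of {a..b} \<Longrightarrow> (\<lambda>s. ball s \<delta>') fine q \<Longrightarrow>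
      norm (stieltjes_sum m g q - I') < \<epsilon> / 2"
    using assms(2) half_gt_zero[OF \<epsilon>] unfolding has_stieltjes_integral_alt by metis
  have "norm (stieltjes_sum m (\<lambda>t. f t + g t) q - (I + I')) < \<epsilon>"
    if q: "q tagged_division_of {a..b}" "(\<lambda>s. ball s (min \<delta> \<delta>')) fine q" for q
  proof -
    have "norm (stieltjes_sum m f q - I) < \<epsilon> / 2" "norm (stieltjes_sum m g q - I') < \<epsilon> / 2"
      using q f g fine_ball_mono[OF q(2)] by auto
    then show ?thesis
      using norm_triangle_ineq[of "stieltjes_sum m f q - I" "stieltjes_sum m g q - I'"]
      by (simp add: stieltjes_sum_add algebra_simps)
  qed
  then show "\<exists>\<delta>>0. \<forall>q. q tagged_division_of {a..b} \<and> (\<lambda>s. ball s \<delta>) fine q \<longrightarrow>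
      norm (stieltjes_sum m (\<lambda>t. f t + g t) q - (I + I')) < \<epsilon>"
    using \<delta> \<delta>' by (intro exI[of _ "min \<delta> \<delta>'"]) auto
qed

lemma has_stieltjes_integral_cong:
  assumes "\<And>t. t \<in> {a..b} \<Longrightarrow> f t = g t"
  shows "has_stieltjes_integral a b m f I \<longleftrightarrow> has_stieltjes_integral a b m g I"
proof -
  have "stieltjes_sum m f q = stieltjes_sum m g q" if "q tagged_division_of {a..b}" for q
    using stieltjes_sum_cong[OF that] assms by blast
  then show ?thesis
    unfolding has_stieltjes_integral_alt by (intro all_cong ex_cong) auto
qed

lemma has_stieltjes_integral_unique:
  fixes m :: "real \<Rightarrow> 'x::real_normed_vector \<Rightarrow>\<^sub>L 'y::real_normed_vector"
  assumes "has_stieltjes_integral a b m f I" "has_stieltjes_integral a b m f I'"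
  shows "I = I'"
proof -
  have "norm (I - I') \<le> 0 + \<epsilon>" if \<epsilon>: "\<epsilon> > 0" for \<epsilon>
  proof -
    obtain \<delta> where \<delta>: "\<delta> > 0" and I: "\<And>q. q tagged_division_of {a..b} \<Longrightarrow> (\<lambda>s. ball s \<delta>) fine q \<Longrightarrow>
        norm (stieltjes_sum m f q - I) < \<epsilon> / 2"
      using assms(1) half_gt_zero[OF \<epsilon>] unfolding has_stieltjes_integral_alt by metis
    obtain \<delta>' where \<delta>': "\<delta>' > 0" and I': "\<And>q. q tagged_division_of {a..b} \<Longrightarrow> (\<lambda>s. ball s \<delta>') fine q \<Longrightarrow>
        norm (stieltjes_sum m f q - I') < \<epsilon> / 2"
      using assms(2) half_gt_zero[OF \<epsilon>] unfolding has_stieltjes_integral_alt by metis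
    obtain q where q: "q tagged_division_of {a..b}" "(\<lambda>s. ball s (min \<delta> \<delta>')) fine q"
      using ex_fine_tagged_division[of "min \<delta> \<delta>'"] \<delta> \<delta>' by auto
    then have "norm (stieltjes_sum m f q - I) < \<epsilon> / 2" "norm (stieltjes_sum m f q - I') < \<epsilon> / 2"
      using I I' fine_ball_mono[OF q(2)] by auto
    then show ?thesis
      using norm_triangle_ineq4[of "stieltjes_sum m f q - I'" "stieltjes_sum m f q - I"] by simp
  qed
  then have "norm (I - I') \<le> 0"
    by (rule field_le_epsilon)
  then show ?thesis by simp
qed

text \<open>The estimate behind the solvability of the boundary equation: continuity of the kernel at \<open>0\<close>
  makes the integral of \<open>e\<^sup>k\<^sup>\<theta> x\<close> small for large \<open>k\<close>.  Summation by parts moves the increments from the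
  kernel to the increasing function \<open>e\<^sup>k\<^sup>\<theta>\<close>, whose mass concentrates near \<open>0\<close>.\<close>

lemma stieltjes_sum_exp_small:
  fixes m :: "real \<Rightarrow> 'x::real_normed_vector \<Rightarrow>\<^sub>L 'y::real_normed_vector"
  assumes V: "variation_le (-1) 0 m V" and cont: "continuous (at 0 within {-1..0}) m" and m0: "m 0 = 0" and \<eta>: "\<eta> > 0"
  shows "\<exists>k::real. \<exists>\<delta>>0. \<forall>x q. q tagged_division_of {-1..0} \<longrightarrow> (\<lambda>s. ball s \<delta>) fine q \<longrightarrow>
    norm (stieltjes_sum m (\<lambda>t. exp (k * t) *\<^sub>R x) q) \<le> \<eta> * norm x"
proof -
  obtain d where d: "d > 0" and near: "\<And>t. t \<in> {-1..0} \<Longrightarrow> dist t 0 < d \<Longrightarrow> dist (m t) (m 0) < \<eta> / 4"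
    using cont \<eta> unfolding continuous_within_eps_delta by (metis zero_less_divide_iff zero_less_numeral)
  define r where "r = min (d / 2) 1"
  have r: "r > 0" "r \<le> 1" "r < d"
    using d by (auto simp: r_def)
  have small: "norm (m t) \<le> \<eta> / 4" if "t \<in> {-r..0}" for t
    using near[of t] that r m0 by (auto simp: dist_norm)
  \<comment> \<open>One positive constant that dominates both the variation and every value
    \<open>norm (m t)\<close>.\<close>
  define C where "C = norm (m (-1)) + max V 0 + 1"
  have C: "C > 0" "V \<le> C"
    using norm_ge_zero[of "m (-1)"] max.cobounded1[of V 0] max.cobounded2[of 0 V] unfolding C_def by linarith+
  have m_le: "norm (m t) \<le> C" if "t \<in> {-1..0}" for t
    using variation_le_bounded[OF V that] by (auto simp: C_def)
  \<comment> \<open>Chosen so that k r = 8 C / \<eta>. Then e^{k r} >= 8 C / \<eta>, and the mass of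
    e^{k t} to the left of -r, weighted by 2 C, is at most \<eta> / 4.\<close>
  define k where "k = 8 * C / (\<eta> * r)"
  have k: "k > 0"
    using C \<eta> r by (simp add: k_def)
  define F where "F t = exp (k * t)" for t
  have F_mono: "F s \<le> F t" if "s \<le> t" for s t
    using that k by (simp add: F_def)
  have F_pos: "F t > 0" for t
    by (simp add: F_def)
  have C_F: "2 * C * F (-r) \<le> \<eta> / 4"
  proof -
    have "8 * C / \<eta> = k * r"
      using r \<eta> by (simp add: k_def)
    also have "\<dots> \<le> exp (k * r)"
      using exp_ge_add_one_self[of "k * r"] by linarith
    finally have "8 * C / \<eta> \<le> exp (k * r)" .
    then show ?thesis
      using \<eta> by (simp add: F_def exp_minus field_simps)
  qed
  have "continuous_on {-1..0} F"
    unfolding F_def by (intro continuous_intros)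
  then obtain \<delta> where \<delta>: "\<delta> > 0"
    and unif: "\<And>s t. s \<in> {-1..0} \<Longrightarrow> t \<in> {-1..0} \<Longrightarrow> dist t s < \<delta> \<Longrightarrow> dist (F t) (F s) < \<eta> / (4 * C)"
    using compact_uniformly_continuous[OF _ compact_Icc] C \<eta> unfolding uniformly_continuous_on_def
    by (metis divide_pos_pos mult_pos_pos zero_less_numeral)
  have "norm (\<Sum>(s, K)\<in>q. F s *\<^sub>R (m (Sup K) - m (Inf K))) \<le> \<eta>"
    if q: "q tagged_division_of {-1..0}" and fine: "(\<lambda>s. ball s \<delta>) fine q" for q
  proof -
    \<comment> \<open>\<open>F\<close> frozen beyond -r, so that its increments record only the mass
      to the left of -r. They pay for pieces ending there, where \<open>m\<close> is merely bounded
      by \<open>C\<close>.\<close>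
    let ?g = "\<lambda>t. F (min t (-r))"
    have telescope: "(\<Sum>(s, K)\<in>q. h (Sup K) - h (Inf K)) = h 0 - h (-1)" for h :: "real \<Rightarrow> 'v::real_normed_vector"
      using additive_tagged_division_1[OF _ q, of h] by simp
    \<comment> \<open>\<open>?X\<close> is the error of moving the tag to the left endpoint, small
      by uniform continuity of \<open>F\<close>. \<open>?Y\<close> telescopes to its value at -1
      because \<open>m 0 = 0\<close>. In \<open>?Z\<close> the increments fall on \<open>F\<close>,
      so the smallness of \<open>m\<close> near 0 can be used.\<close>
    let ?X = "\<Sum>(s, K)\<in>q. (F s - F (Inf K)) *\<^sub>R (m (Sup K) - m (Inf K))"
    let ?Y = "\<Sum>(s, K)\<in>q. F (Sup K) *\<^sub>R m (Sup K) - F (Inf K) *\<^sub>R m (Inf K)"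
    let ?Z = "\<Sum>(s, K)\<in>q. (F (Sup K) - F (Inf K)) *\<^sub>R m (Sup K)"
    have by_parts: "(\<Sum>(s, K)\<in>q. F s *\<^sub>R (m (Sup K) - m (Inf K))) = ?X + ?Y - ?Z"
      unfolding sum.distrib[symmetric] sum_subtractf[symmetric]
      by (intro sum.cong refl) (auto simp: algebra_simps)
    have X: "norm ?X \<le> \<eta> / 4"
    proof -
      have "norm ?X
          \<le> (\<Sum>(s, K)\<in>q. \<eta> / (4 * C) * norm (m (Sup K) - m (Inf K)))"
      proof (rule sum_norm_le, clarify)
        fix s K assume sK: "(s, K) \<in> q"
        obtain u v where K: "K = {u..v}" "-1 \<le> u" "u \<le> s" "s \<le> v" "v \<le> 0"
          using tagged_division_Icc[OF q sK] .
        then have "u \<in> K"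
          by simp
        then have "u \<in> ball s \<delta>"
          using fineD[OF fine sK] by blast
        then have "\<bar>F s - F (Inf K)\<bar> \<le> \<eta> / (4 * C)"
          using unif[of u s] K by (auto simp: dist_norm)
        then show "norm ((F s - F (Inf K)) *\<^sub>R (m (Sup K) - m (Inf K))) \<le> \<eta> / (4 * C) * norm (m (Sup K) - m (Inf K))"
          unfolding norm_scaleR by (intro mult_right_mono) auto
      qed
      also have "\<dots> = \<eta> / (4 * C) * (\<Sum>(s, K)\<in>q. norm (m (Sup K) - m (Inf K)))"
        by (simp add: sum_distrib_left case_prod_unfold)
      also have "\<dots> \<le> \<eta> / (4 * C) * C"
        using variation_le_tagged[OF V q] C \<eta> by (intro mult_left_mono) auto
      also have "\<dots> = \<eta> / 4"
        using C by simp
      finally show ?thesis .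
    qed
    have Y: "norm ?Y \<le> C * F (-r)"
    proof -
      have "norm ?Y = F (-1) * norm (m (-1))"
        using F_pos[of "-1"] by (subst telescope[of "\<lambda>t. F t *\<^sub>R m t"]) (simp add: m0)
      also have "\<dots> \<le> F (-r) * C"
        using m_le[of "-1"] F_mono[of "-1" "-r"] r F_pos[of "-r"] by (intro mult_mono) auto
      finally show ?thesis by (simp add: mult.commute)
    qed
    have Z: "norm ?Z \<le> \<eta> / 4 + C * F (-r)"
    proof -
      have "norm ?Z
          \<le> (\<Sum>(s, K)\<in>q. \<eta> / 4 * (F (Sup K) - F (Inf K)) + C * (?g (Sup K) - ?g (Inf K)))"
      proof (rule sum_norm_le, clarify)
        fix s K assume sK: "(s, K) \<in> q"
        obtain u v where K: "K = {u..v}" "-1 \<le> u" "u \<le> s" "s \<le> v" "v \<le> 0"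
          using tagged_division_Icc[OF q sK] .
        have Fuv: "F u \<le> F v" and guv: "?g u \<le> ?g v"
          using K by (auto intro!: F_mono)
        have "(F v - F u) * norm (m v) \<le> \<eta> / 4 * (F v - F u) + C * (?g v - ?g u)"
        proof (cases "v \<ge> -r")
          case True
          then have "(F v - F u) * norm (m v) \<le> (F v - F u) * (\<eta> / 4)"
            using small[of v] K Fuv by (intro mult_left_mono) auto
          moreover have "0 \<le> C * (?g v - ?g u)"
            using guv C by simp
          ultimately show ?thesis by (simp add: mult.commute)
        next
          case False
          then have "?g v = F v" "?g u = F u"
            using K by auto
          moreover have "(F v - F u) * norm (m v) \<le> (F v - F u) * C"
            using m_le[of v] K Fuv by (intro mult_left_mono) auto
          moreover have "0 \<le> \<eta> / 4 * (F v - F u)"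
            using Fuv \<eta> by simp
          ultimately show ?thesis by (simp add: mult.commute)
        qed
        then show "norm ((F (Sup K) - F (Inf K)) *\<^sub>R m (Sup K))
            \<le> \<eta> / 4 * (F (Sup K) - F (Inf K)) + C * (?g (Sup K) - ?g (Inf K))"
          using K Fuv by simp
      qed
      also have "\<dots> = \<eta> / 4 * (\<Sum>(s, K)\<in>q. F (Sup K) - F (Inf K)) + C * (\<Sum>(s, K)\<in>q. ?g (Sup K) - ?g (Inf K))"
        by (simp only: sum_distrib_left sum.distrib case_prod_unfold)
      also have "\<dots> = \<eta> / 4 * (F 0 - F (-1)) + C * (?g 0 - ?g (-1))"
        using telescope[of F] telescope[of ?g] by simp
      also have "\<dots> \<le> \<eta> / 4 * 1 + C * F (-r)"
        using F_pos[of "-1"] r C \<eta> by (intro add_mono mult_left_mono) (auto simp: F_def)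
      finally show ?thesis by simp
    qed
    have "norm (?X + ?Y - ?Z) \<le> norm ?X + norm ?Y + norm ?Z"
      using norm_triangle_ineq4[of "?X + ?Y" ?Z] norm_triangle_ineq[of ?X ?Y] by linarith
    also have "\<dots> \<le> \<eta> / 4 + C * F (-r) + (\<eta> / 4 + C * F (-r))"
      using X Y Z by linarith
    also have "\<dots> \<le> \<eta>"
      using C_F \<eta> by linarith
    finally show ?thesis
      unfolding by_parts .
  qed
  note bound = this
  have "stieltjes_sum m (\<lambda>t. exp (k * t) *\<^sub>R x) q
      = blinfun_apply (\<Sum>(s, K)\<in>q. F s *\<^sub>R (m (Sup K) - m (Inf K))) x" for x q
    by (simp add: stieltjes_sum_def F_def case_prod_unfold blinfun.sum_left blinfun.scaleR_left blinfun.scaleR_right)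
  then have "norm (stieltjes_sum m (\<lambda>t. exp (k * t) *\<^sub>R x) q) \<le> \<eta> * norm x"
    if "q tagged_division_of {-1..0}" "(\<lambda>s. ball s \<delta>) fine q" for x q
    using order_trans[OF norm_blinfun mult_right_mono[OF bound[OF that] norm_ge_zero]] by simp
  then show ?thesis
    using \<delta> by blast
qed

section \<open>Delay operators\<close>

lemma delay_kernelD:
  assumes "delay_kernel m"
  obtains V where "variation_le (-1) 0 m V" "V \<ge> 0"
proof -
  obtain K where "variation_le (-1) 0 m K"
    using assms by (auto simp: delay_kernel_def bounded_variation_on_def variation_le_def)
  then have "variation_le (-1) 0 m (max K 0)"
    by (fastforce simp: variation_le_def)
  then show thesis
    using that by simp
qed

lemma delay_operator_has_integral:
  assumes "p \<ge> 1" "delay_kernel m" "\<phi> \<in> W1p p (-1) 0"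
  shows "has_stieltjes_integral (-1) 0 m (crep (-1) 0 \<phi>) (delay_operator m \<phi>)"
proof -
  obtain V where V: "variation_le (-1) 0 m V"
    using delay_kernelD[OF assms(2)] .
  have "continuous_on {-1..0} (crep (-1) 0 \<phi>)"
    using W1pD(3)[OF assms(1) _ assms(3)] by simp
  from ex_stieltjes_integral[OF V this] show ?thesis
    unfolding delay_operator_def using has_stieltjes_integral_unique by (metis (mono_tags, lifting) theI)
qed

lemma delay_operator_add:
  assumes "p \<ge> 1" "delay_kernel m" "\<phi> \<in> W1p p (-1) 0" "\<psi> \<in> W1p p (-1) 0"
  shows "delay_operator m (\<phi> + \<psi>) = delay_operator m \<phi> + delay_operator m \<psi>"
proof -
  have "has_stieltjes_integral (-1) 0 m (\<lambda>t. crep (-1) 0 \<phi> t + crep (-1) 0 \<psi> t) (delay_operator m (\<phi> + \<psi>))"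
    using delay_operator_has_integral[OF assms(1,2) W1p_add(1)[OF assms(1) _ assms(3,4)]]
    by (subst has_stieltjes_integral_cong[OF W1p_add(3)[OF assms(1) _ assms(3,4), symmetric]]) auto
  moreover have "has_stieltjes_integral (-1) 0 m (\<lambda>t. crep (-1) 0 \<phi> t + crep (-1) 0 \<psi> t)
      (delay_operator m \<phi> + delay_operator m \<psi>)"
    by (rule has_stieltjes_integral_add[OF delay_operator_has_integral[OF assms(1,2,3)] delay_operator_has_integral[OF assms(1,2,4)]])
  ultimately show ?thesis
    by (rule has_stieltjes_integral_unique)
qed

lemma delay_operator_bounded:
  assumes "p \<ge> 1" "delay_kernel m"
  shows "\<exists>C\<ge>0. \<forall>\<phi>\<in>W1p p (-1) 0. norm (delay_operator m \<phi>) \<le> C * W1p_norm p (-1) 0 \<phi>"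
proof -
  obtain V where V: "variation_le (-1) 0 m V" "V \<ge> 0"
    using delay_kernelD[OF assms(2)] .
  have "norm (delay_operator m \<phi>) \<le> V * 4 * W1p_norm p (-1) 0 \<phi>" if \<phi>: "\<phi> \<in> W1p p (-1) 0" for \<phi>
  proof (rule norm_stieltjes_integral_le[OF delay_operator_has_integral[OF assms \<phi>], of 1])
    let ?c = "4 * W1p_norm p (-1) 0 \<phi>"
    fix q :: "(real \<times> real set) set" assume q: "q tagged_division_of {-1..0}"
    have "norm (stieltjes_sum m (crep (-1) 0 \<phi>) q) \<le> (\<Sum>(s, k)\<in>q. norm (m (Sup k) - m (Inf k)) * ?c)"
      unfolding stieltjes_sum_def
    proof (rule sum_norm_le, clarify)
      fix s k assume "(s, k) \<in> q"
      then have "s \<in> {-1..0}"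
        using tagged_division_ofD(2,3)[OF q] by blast
      then have "norm (crep (-1) 0 \<phi> s) \<le> ?c"
        using W1p_sup_bound[OF assms(1) _ \<phi>] by simp
      then show "norm (blinfun_apply (m (Sup k) - m (Inf k)) (crep (-1) 0 \<phi> s)) \<le> norm (m (Sup k) - m (Inf k)) * ?c"
        by (rule order_trans[OF norm_blinfun mult_left_mono]) simp
    qed
    also have "\<dots> = (\<Sum>(s, k)\<in>q. norm (m (Sup k) - m (Inf k))) * ?c"
      by (simp add: case_prod_unfold sum_distrib_right)
    also have "\<dots> \<le> V * ?c"
      using variation_le_tagged[OF V(1) q] by (intro mult_right_mono) (auto simp: W1p_norm_nonneg)
    finally show "norm (stieltjes_sum m (crep (-1) 0 \<phi>) q) \<le> V * 4 * W1p_norm p (-1) 0 \<phi>"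
      by simp
  qed simp
  then show ?thesis
    using V(2) by (intro exI[of _ "V * 4"]) auto
qed

lemma delay_operator_exp_fun_small:
  fixes m :: "real \<Rightarrow> 'x::complex_banach \<Rightarrow>\<^sub>L 'y::complex_banach"
  assumes m: "delay_kernel m" and \<eta>: "\<eta> > 0"
  shows "\<exists>k::complex. \<forall>x. norm (delay_operator m (exp_fun k x)) \<le> \<eta> * norm x"
proof -
  obtain V where V: "variation_le (-1) 0 m V"
    using delay_kernelD[OF m] .
  obtain k \<delta> where \<delta>: "\<delta> > 0" and small: "\<And>x q. q tagged_division_of {-1..0} \<Longrightarrow> (\<lambda>s. ball s \<delta>) fine q \<Longrightarrow>
    norm (stieltjes_sum m (\<lambda>t. exp (k * t) *\<^sub>R x) q) \<le> \<eta> * norm x"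
    using stieltjes_sum_exp_small[OF V _ _ \<eta>] m unfolding delay_kernel_def by blast
  have "norm (delay_operator m (exp_fun (complex_of_real k) x)) \<le> \<eta> * norm x" for x
  \<comment> \<open>\<open>delay_operator\<close> does not mention the exponent, so the existence of
    the integral is taken from the case p = 1.\<close>
  proof (rule norm_stieltjes_integral_le[OF delay_operator_has_integral[OF order_refl m exp_fun_W1p(1)[OF order_refl]] \<delta>])
    fix q :: "(real \<times> real set) set" assume q: "q tagged_division_of {-1..0}" and fine: "(\<lambda>s. ball s \<delta>) fine q"
    have "crep (-1) 0 (exp_fun (complex_of_real k) x) t = exp (k * t) *\<^sub>R x" if "t \<in> {-1..0}" for t
    proof -
      have "exp (complex_of_real k * complex_of_real t) = complex_of_real (exp (k * t))"
        by (simp add: exp_of_real flip: of_real_mult)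
      then show ?thesis
        using exp_fun_W1p(3)[OF order_refl that, of "complex_of_real k" x] by (simp add: scaleC_of_real)
    qed
    then show "norm (stieltjes_sum m (crep (-1) 0 (exp_fun (complex_of_real k) x)) q) \<le> \<eta> * norm x"
      using small[OF q fine] by (subst stieltjes_sum_cong[OF q]) auto
  qed
  then show ?thesis by blast
qed

section \<open>The boundary value problem\<close>

lemma resolvent_set_bound:
  assumes "l \<in> resolvent_set V N A" "\<And>x. N x \<ge> 0"
  obtains K where "K \<ge> 0" "\<And>x w. (x, w) \<in> A \<Longrightarrow> N x \<le> K * N (l *\<^sub>C x - w)"
proof -
  obtain K where K: "\<And>x w. (x, w) \<in> A \<Longrightarrow> N x \<le> K * N (l *\<^sub>C x - w)"
    using assms(1) by (fastforce simp: resolvent_set_def)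
  have "N x \<le> max K 0 * N (l *\<^sub>C x - w)" if "(x, w) \<in> A" for x w
    using K[OF that] mult_right_mono[OF max.cobounded1[of K 0] assms(2)] order_trans by blast
  then show thesis
    using that[of "max K 0"] by simp
qed

lemma resolvent_set_ex1:
  "l \<in> resolvent_set V N A \<Longrightarrow> y \<in> V \<Longrightarrow> \<exists>!x. \<exists>w. (x, w) \<in> A \<and> l *\<^sub>C x - w = y"
  by (simp add: resolvent_set_def)

lemma resolvent_eqI:
  assumes "\<exists>!x. \<exists>w. (x, w) \<in> A \<and> l *\<^sub>C x - w = y" "\<exists>w. (x, w) \<in> A \<and> l *\<^sub>C x - w = y"
  shows "resolvent A l y = x"
  unfolding resolvent_def using assms by (rule the1_equality)

locale boundary_problem =
  fixes j Am :: "'z::complex_banach \<Rightarrow> 'x::complex_banach"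
    and G M :: "'z \<Rightarrow> 'u::complex_banach"
    and T :: "real \<Rightarrow> 'x \<Rightarrow> 'x"
    and l :: complex
  assumes system: "boundary_system j Am G M T"
    and l_A: "l \<in> resolvent_set UNIV norm (op_A j Am G)"
    and one_DM: "1 \<in> resolvent_set UNIV norm (op_DM j Am G M l)"
begin

lemma linear: "clinear j" "clinear Am" "clinear G" "clinear M"
  using system by (auto simp: boundary_system_def bounded_clinear_def)

lemmas additive = linear[THEN clinear_add] linear[THEN clinear_diff] linear[THEN clinear_zero]

lemma j_eq_iff: "j z = j z' \<longleftrightarrow> z = z'"
  using system by (auto simp: boundary_system_def dest: injD)

text \<open>The resolvent condition is a statement about elements of X; injectivity of
  \<open>j\<close> carries it over to Z.\<close>

lemma ex1_homogeneous: "\<exists>!z. l *\<^sub>C j z - Am z = y \<and> G z = 0"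
proof -
  have ex1: "\<exists>!x. \<exists>w. (x, w) \<in> op_A j Am G \<and> l *\<^sub>C x - w = y"
    using resolvent_set_ex1[OF l_A] by simp
  have solves: "(\<exists>w. (j z, w) \<in> op_A j Am G \<and> l *\<^sub>C j z - w = y) \<longleftrightarrow> l *\<^sub>C j z - Am z = y \<and> G z = 0" for z
    by (auto simp: op_A_def j_eq_iff)
  obtain z where z: "\<exists>w. (j z, w) \<in> op_A j Am G \<and> l *\<^sub>C j z - w = y"
    using ex1 by (auto simp: op_A_def)
  show ?thesis
  proof (rule ex1I[of _ z])
    show "l *\<^sub>C j z - Am z = y \<and> G z = 0"
      using z solves by simp
    fix z' assume "l *\<^sub>C j z' - Am z' = y \<and> G z' = 0"
    then have "j z' = j z"
      using ex1 z solves[of z'] by (elim ex1E) metis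
    then show "z' = z"
      by (simp add: j_eq_iff)
  qed
qed

text \<open>This is the decomposition of Z into D(A) and ker(l - A_m): lift \<open>u\<close> along
  the surjection \<open>G\<close> and subtract the element of ker \<open>G\<close> with the same
  image under l - A_m.\<close>

lemma dirichlet:
  shows "l *\<^sub>C j (dirichlet j Am G l u) - Am (dirichlet j Am G l u) = 0" "G (dirichlet j Am G l u) = u"
    and dirichlet_eqI: "l *\<^sub>C j z - Am z = 0 \<Longrightarrow> G z = u \<Longrightarrow> dirichlet j Am G l u = z"
proof -
  obtain z1 where z1: "G z1 = u"
    using system by (auto simp: boundary_system_def surj_def) metis
  obtain z2 where z2: "l *\<^sub>C j z2 - Am z2 = l *\<^sub>C j z1 - Am z1" "G z2 = 0"
    using ex1_homogeneous by blast
  have ex: "l *\<^sub>C j (z1 - z2) - Am (z1 - z2) = 0 \<and> G (z1 - z2) = u"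
    using z1 z2 by (simp add: additive scaleC_diff_right algebra_simps)
  have unique: "z = z1 - z2" if "l *\<^sub>C j z - Am z = 0 \<and> G z = u" for z
  proof -
    have "l *\<^sub>C j (z - (z1 - z2)) - Am (z - (z1 - z2))
        = (l *\<^sub>C j z - Am z) - (l *\<^sub>C j (z1 - z2) - Am (z1 - z2))"
      by (simp add: linear(1,2)[THEN clinear_diff] scaleC_diff_right)
    moreover have "G (z - (z1 - z2)) = G z - G (z1 - z2)"
      by (rule clinear_diff[OF linear(3)])
    ultimately have "l *\<^sub>C j (z - (z1 - z2)) - Am (z - (z1 - z2)) = 0 \<and> G (z - (z1 - z2)) = 0"
      using that ex by simp
    moreover have "l *\<^sub>C j 0 - Am 0 = 0 \<and> G 0 = 0"
      by (simp add: additive)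
    ultimately have "z - (z1 - z2) = 0"
      using ex1_homogeneous[of 0] by blast
    then show ?thesis by simp
  qed
  have D: "dirichlet j Am G l u = z1 - z2"
    unfolding dirichlet_def using ex unique by (rule the_equality)
  show "l *\<^sub>C j (dirichlet j Am G l u) - Am (dirichlet j Am G l u) = 0" "G (dirichlet j Am G l u) = u"
    using ex by (simp_all add: D)
  show "dirichlet j Am G l u = z" if "l *\<^sub>C j z - Am z = 0" "G z = u"
    using unique that D by simp
qed

lemma dirichlet_add: "dirichlet j Am G l (u + v) = dirichlet j Am G l u + dirichlet j Am G l v"
proof (rule dirichlet_eqI)
  have "l *\<^sub>C j (dirichlet j Am G l u + dirichlet j Am G l v) - Am (dirichlet j Am G l u + dirichlet j Am G l v)
      = (l *\<^sub>C j (dirichlet j Am G l u) - Am (dirichlet j Am G l u)) + (l *\<^sub>C j (dirichlet j Am G l v) - Am (dirichlet j Am G l v))"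
    by (simp add: additive scaleC_add_right)
  then show "l *\<^sub>C j (dirichlet j Am G l u + dirichlet j Am G l v) - Am (dirichlet j Am G l u + dirichlet j Am G l v) = 0"
    by (simp only: dirichlet(1)) simp
  show "G (dirichlet j Am G l u + dirichlet j Am G l v) = u + v"
    by (simp add: additive dirichlet(2))
qed

lemma dirichlet_bound: "\<exists>K\<ge>0. \<forall>u. norm (dirichlet j Am G l u) \<le> K * norm u"
  using system l_A by (intro bounded_clinearD(2)) (simp add: boundary_system_def)

lemma ex1_DM: "\<exists>!z. z - dirichlet j Am G l (M z) = z'"
  using resolvent_set_ex1[OF one_DM, of z'] by (simp add: op_DM_def graph_on_def)

lemma DM_bound:
  obtains K where "K \<ge> 0" "\<And>z. norm z \<le> K * norm (z - dirichlet j Am G l (M z))"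
proof -
  obtain K where "K \<ge> 0" "\<And>z w. (z, w) \<in> op_DM j Am G M l \<Longrightarrow> norm z \<le> K * norm (1 *\<^sub>C z - w)"
    by (rule resolvent_set_bound[OF one_DM norm_ge_zero], rule that)
  then show thesis
    using that by (simp add: op_DM_def graph_on_def)
qed

text \<open>A single solution operator for both ingredients of Delta(l): y = 0 gives D_l^M and u = 0
  gives R(l,A^M), the latter as an element of Z.\<close>

definition bvp :: "'x \<Rightarrow> 'u \<Rightarrow> 'z" where
  "bvp y u = (THE z. l *\<^sub>C j z - Am z = y \<and> G z - M z = u)"

text \<open>With \<open>z' = R(l,A) y\<close>, the solution is \<open>z' + w\<close> where \<open>w - D M w = D (M z' + u)\<close>.\<close>

lemma ex_bvp:
  assumes z': "l *\<^sub>C j z' - Am z' = y" "G z' = 0" and w: "w - dirichlet j Am G l (M w) = dirichlet j Am G l (M z' + u)"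
  shows "l *\<^sub>C j (z' + w) - Am (z' + w) = y \<and> G (z' + w) - M (z' + w) = u"
proof -
  have w': "w = dirichlet j Am G l (M w + (M z' + u))"
    using w by (simp add: dirichlet_add algebra_simps)
  have "l *\<^sub>C j w - Am w = 0" "G w = M w + (M z' + u)"
    using dirichlet(1,2)[of "M w + (M z' + u)"] w' by simp_all
  then show ?thesis
    using z' by (simp add: additive scaleC_add_right algebra_simps)
qed

text \<open>For uniqueness, a homogeneous solution satisfies z = D_l M z, and invertibility of I -
  D_l M forces z = 0.\<close>

lemma ex1_bvp: "\<exists>!z. l *\<^sub>C j z - Am z = y \<and> G z - M z = u"
proof -
  obtain z' where "l *\<^sub>C j z' - Am z' = y" "G z' = 0"
    using ex1_homogeneous by blast
  moreover obtain w where "w - dirichlet j Am G l (M w) = dirichlet j Am G l (M z' + u)"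
    using ex1_DM by blast
  ultimately have ex: "\<exists>z. l *\<^sub>C j z - Am z = y \<and> G z - M z = u"
    using ex_bvp by blast
  have zero: "z = 0" if z: "l *\<^sub>C j z - Am z = 0" "G z = M z" for z
  proof -
    have "z - dirichlet j Am G l (M z) = 0"
      using dirichlet_eqI[of z "M z"] z by simp
    moreover have "0 - dirichlet j Am G l (M 0) = 0"
      using dirichlet_eqI[of 0 "M 0"] by (simp add: additive)
    ultimately show ?thesis
      using ex1_DM[of 0] by blast
  qed
  show ?thesis
  proof (rule ex_ex1I[OF ex])
    fix z z' assume z: "l *\<^sub>C j z - Am z = y \<and> G z - M z = u" and z': "l *\<^sub>C j z' - Am z' = y \<and> G z' - M z' = u"
    have "l *\<^sub>C j (z - z') - Am (z - z') = (l *\<^sub>C j z - Am z) - (l *\<^sub>C j z' - Am z')"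
      "G (z - z') - M (z - z') = (G z - M z) - (G z' - M z')"
      by (simp_all add: additive scaleC_diff_right)
    then have "z - z' = 0"
      using z z' by (intro zero) simp_all
    then show "z = z'" by simp
  qed
qed

lemma bvp: "l *\<^sub>C j (bvp y u) - Am (bvp y u) = y" "G (bvp y u) - M (bvp y u) = u"
  unfolding bvp_def using theI'[OF ex1_bvp, of y u] by auto

lemma bvp_eqI: "l *\<^sub>C j z - Am z = y \<Longrightarrow> G z - M z = u \<Longrightarrow> bvp y u = z"
  unfolding bvp_def by (rule the1_equality[OF ex1_bvp]) simp

lemma bvp_add: "bvp (y + y') (u + u') = bvp y u + bvp y' u'"
proof (rule bvp_eqI)
  have "l *\<^sub>C j (bvp y u + bvp y' u') - Am (bvp y u + bvp y' u')
      = (l *\<^sub>C j (bvp y u) - Am (bvp y u)) + (l *\<^sub>C j (bvp y' u') - Am (bvp y' u'))"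
    by (simp add: additive scaleC_add_right)
  then show "l *\<^sub>C j (bvp y u + bvp y' u') - Am (bvp y u + bvp y' u') = y + y'"
    by (simp only: bvp(1))
  have "G (bvp y u + bvp y' u') - M (bvp y u + bvp y' u')
      = (G (bvp y u) - M (bvp y u)) + (G (bvp y' u') - M (bvp y' u'))"
    by (simp add: additive)
  then show "G (bvp y u + bvp y' u') - M (bvp y u + bvp y' u') = u + u'"
    by (simp only: bvp(2))
qed

lemma bvp_diff: "bvp (y - y') (u - u') = bvp y u - bvp y' u'"
  using bvp_add[of "y - y'" y' "u - u'" u'] by simp

lemma dirichlet_M_eq: "dirichlet_M j Am G M l u = bvp 0 u"
proof -
  obtain w where w: "w - dirichlet j Am G l (M w) = dirichlet j Am G l u"
    using ex1_DM by blast
  have "dirichlet_M j Am G M l u = w"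
    unfolding dirichlet_M_def
    using resolvent_set_ex1[OF one_DM, of "dirichlet j Am G l u"] w
    by (intro resolvent_eqI) (auto simp: op_DM_def graph_on_def)
  moreover have "bvp 0 u = 0 + w"
    using ex_bvp[of 0 0 w u] w by (intro bvp_eqI) (simp_all add: additive)
  ultimately show ?thesis by simp
qed

lemma resolvent_AM_eq: "resolvent (op_AM j Am G M) l y = j (bvp y 0)"
proof (rule resolvent_eqI)
  show ex: "\<exists>w. (j (bvp y 0), w) \<in> op_AM j Am G M \<and> l *\<^sub>C j (bvp y 0) - w = y"
    using bvp[of y 0] by (auto simp: op_AM_def)
  show "\<exists>!x. \<exists>w. (x, w) \<in> op_AM j Am G M \<and> l *\<^sub>C x - w = y"
  proof (rule ex1I[of _ "j (bvp y 0)"], rule ex)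
    fix x assume "\<exists>w. (x, w) \<in> op_AM j Am G M \<and> l *\<^sub>C x - w = y"
    then obtain z where "x = j z" "G z = M z" "l *\<^sub>C j z - Am z = y"
      by (auto simp: op_AM_def)
    then show "x = j (bvp y 0)"
      using bvp_eqI[of z y 0] by simp
  qed
qed

text \<open>Retraces the construction in \<open>ex_bvp\<close>. \<open>M\<close> is controlled only
  on ker \<open>G\<close> in the graph norm, so it is estimated on z', where A_m z' = l j z' - y
  bounds that norm; the remaining part is bounded through D_l and the inverse of I - D_l M.\<close>

lemma bvp_bound: "\<exists>C\<ge>0. \<forall>y u. norm (j (bvp y u)) \<le> C * (norm y + norm u)"
proof -
  obtain K1 where K1: "K1 \<ge> 0" "\<And>z. norm (j z) \<le> K1 * norm z"
    using system bounded_clinearD(2)[of j] by (auto simp: boundary_system_def)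
  obtain K2 where K2: "K2 \<ge> 0" "\<And>u. norm (dirichlet j Am G l u) \<le> K2 * norm u"
    using dirichlet_bound by blast
  obtain K3 where K3: "K3 \<ge> 0" "\<And>z. norm z \<le> K3 * norm (z - dirichlet j Am G l (M z))"
    by (rule DM_bound, rule that)
  obtain K4 where K4: "K4 \<ge> 0" "\<And>x w. (x, w) \<in> op_A j Am G \<Longrightarrow> norm x \<le> K4 * norm (l *\<^sub>C x - w)"
    by (rule resolvent_set_bound[OF l_A norm_ge_zero], rule that)
  obtain K5' where K5': "\<And>z. G z = 0 \<Longrightarrow> norm (M z) \<le> K5' * (norm (j z) + norm (Am z))"
    using system by (auto simp: boundary_system_def)
  define K5 where "K5 = max K5' 0"
  have K5: "K5 \<ge> 0" "norm (M z) \<le> K5 * (norm (j z) + norm (Am z))" if "G z = 0" for z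
    using order_trans[OF K5'[OF that] mult_right_mono[OF max.cobounded1[of K5' 0]]] by (auto simp: K5_def)
  define c where "c = K5 * (K4 + (cmod l * K4 + 1))"
  have c: "c \<ge> 0"
    using K4(1) by (simp add: c_def K5_def)
  have "norm (j (bvp y u)) \<le> (K4 + K1 * (K3 * (K2 * (c + 1)))) * (norm y + norm u)" for y u
  proof -
    obtain z' where z': "l *\<^sub>C j z' - Am z' = y" "G z' = 0"
      using ex1_homogeneous by blast
    obtain w where w: "w - dirichlet j Am G l (M w) = dirichlet j Am G l (M z' + u)"
      using ex1_DM by blast
    have bvp: "bvp y u = z' + w"
      using ex_bvp[OF z' w] by (intro bvp_eqI) auto
    have jz': "norm (j z') \<le> K4 * norm y"
      using K4(2)[of "j z'" "Am z'"] z' by (auto simp: op_A_def)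
    have "Am z' = l *\<^sub>C j z' - y"
      using z'(1) by (simp add: algebra_simps)
    then have "norm (Am z') \<le> cmod l * norm (j z') + norm y"
      using norm_triangle_ineq4[of "l *\<^sub>C j z'" y] by (simp add: norm_scaleC)
    also have "\<dots> \<le> (cmod l * K4 + 1) * norm y"
      using mult_left_mono[OF jz', of "cmod l"] by (simp add: algebra_simps)
    finally have "norm (j z') + norm (Am z') \<le> (K4 + (cmod l * K4 + 1)) * norm y"
      using jz' by (simp add: algebra_simps)
    from order_trans[OF K5(2)[OF z'(2)] mult_left_mono[OF this K5(1)[OF z'(2)]]]
    have "norm (M z') \<le> c * norm y"
      by (simp add: c_def mult.assoc)
    also have "\<dots> \<le> c * (norm y + norm u)"
      using c by (intro mult_left_mono) auto
    finally have "norm (M z' + u) \<le> (c + 1) * (norm y + norm u)"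
      using norm_triangle_ineq[of "M z'" u] norm_ge_zero[of y] unfolding distrib_right[of c 1] mult_1 by linarith
    then have "norm (dirichlet j Am G l (M z' + u)) \<le> K2 * ((c + 1) * (norm y + norm u))"
      using order_trans[OF K2(2) mult_left_mono[OF _ K2(1)]] by blast
    then have "norm w \<le> K3 * (K2 * ((c + 1) * (norm y + norm u)))"
      using order_trans[OF K3(2)[of w] mult_left_mono[OF _ K3(1)]] w by simp
    then have jw: "norm (j w) \<le> K1 * (K3 * (K2 * ((c + 1) * (norm y + norm u))))"
      using order_trans[OF K1(2) mult_left_mono[OF _ K1(1)]] by blast
    have "K4 * norm y \<le> K4 * (norm y + norm u)"
      using K4(1) by (intro mult_left_mono) auto
    then have "norm (j z' + j w) \<le> K4 * (norm y + norm u) + K1 * (K3 * (K2 * ((c + 1) * (norm y + norm u))))"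
      using norm_triangle_ineq[of "j z'" "j w"] jz' jw by linarith
    then show ?thesis
      by (simp add: bvp additive distrib_right mult.assoc)
  qed
  moreover have "K4 + K1 * (K3 * (K2 * (c + 1))) \<ge> 0"
    using K1(1) K2(1) K3(1) K4(1) c by simp
  ultimately show ?thesis by blast
qed

end

section \<open>The resolvent equation\<close>

text \<open>Existence and bound come from \<open>ex_solution_transport\<close>; two solutions differ
  by an exponential that vanishes at 0.\<close>

lemma resolvent_Q:
  fixes g :: "'x::complex_banach aefun"
  assumes p: "p \<ge> 1" and g: "g \<in> Lp p {-1..0}"
  shows "resolvent (op_Q p) l g \<in> W1p p (-1) 0" "crep (-1) 0 (resolvent (op_Q p) l g) 0 = 0"
    "l *\<^sub>C resolvent (op_Q p) l g - weak_deriv p (-1) 0 (resolvent (op_Q p) l g) = g"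
    "Lp_norm p (resolvent (op_Q p) l g) \<le> 4 * (1 + cmod l * exp (cmod l) * exp (cmod l)) * Lp_norm p g"
proof -
  obtain \<phi> where \<phi>: "\<phi> \<in> W1p p (-1) 0" "crep (-1) 0 \<phi> 0 = 0" "l *\<^sub>C \<phi> - weak_deriv p (-1) 0 \<phi> = g"
    and bound: "Lp_norm p \<phi> \<le> 4 * (1 + cmod l * exp (cmod l) * exp (cmod l)) * Lp_norm p g"
    using ex_solution_transport[OF p g] by blast
  have "resolvent (op_Q p) l g = \<phi>"
  proof (rule resolvent_eqI)
    show ex: "\<exists>w. (\<phi>, w) \<in> op_Q p \<and> l *\<^sub>C \<phi> - w = g"
      using \<phi> by (auto simp: op_Q_def)
    show "\<exists>!\<phi>. \<exists>w. (\<phi>, w) \<in> op_Q p \<and> l *\<^sub>C \<phi> - w = g"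
    proof (rule ex1I[of _ \<phi>], rule ex)
      fix \<psi> :: "'x aefun" assume "\<exists>w. (\<psi>, w) \<in> op_Q p \<and> l *\<^sub>C \<psi> - w = g"
      then have \<psi>: "\<psi> \<in> W1p p (-1) 0" "crep (-1) 0 \<psi> 0 = 0" "l *\<^sub>C \<psi> - weak_deriv p (-1) 0 \<psi> = g"
        by (auto simp: op_Q_def)
      note diff = W1p_diff[OF p _ \<psi>(1) \<phi>(1), simplified]
      have "weak_deriv p (-1) 0 (\<psi> - \<phi>) = l *\<^sub>C (\<psi> - \<phi>)"
        using \<phi>(3) \<psi>(3) by (simp add: diff(2) scaleC_diff_right algebra_simps)
      then have "\<psi> - \<phi> = exp_fun l 0"
        using eq_exp_fun_if_weak_deriv_eq[OF p diff(1)] diff(3)[of 0] \<phi>(2) \<psi>(2) by simp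
      then show "\<psi> = \<phi>"
        using exp_fun_diff[of l "0::'x" 0] by simp
    qed
  qed
  then show "resolvent (op_Q p) l g \<in> W1p p (-1) 0" "crep (-1) 0 (resolvent (op_Q p) l g) 0 = 0"
    "l *\<^sub>C resolvent (op_Q p) l g - weak_deriv p (-1) 0 (resolvent (op_Q p) l g) = g"
    "Lp_norm p (resolvent (op_Q p) l g) \<le> 4 * (1 + cmod l * exp (cmod l) * exp (cmod l)) * Lp_norm p g"
    using \<phi> bound by simp_all
qed

locale delay_problem = boundary_problem j Am G M T l
  for j Am :: "'z::complex_banach \<Rightarrow> 'x::complex_banach"
    and G M :: "'z \<Rightarrow> 'u::complex_banach"
    and T :: "real \<Rightarrow> 'x \<Rightarrow> 'x"
    and l :: complex +
  fixes p :: real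
    and \<mu> :: "real \<Rightarrow> 'x \<Rightarrow>\<^sub>L 'x"
    and \<nu> :: "real \<Rightarrow> 'x \<Rightarrow>\<^sub>L 'u"
  assumes p: "p \<ge> 1"
    and \<mu>: "delay_kernel \<mu>"
    and \<nu>: "delay_kernel \<nu>"
begin

abbreviation "W \<equiv> W1p p (-1) 0 :: 'x aefun set"
abbreviation "W_norm \<equiv> W1p_norm p (-1) 0 :: 'x aefun \<Rightarrow> real"
abbreviation "point \<equiv> crep (-1) 0 :: 'x aefun \<Rightarrow> real \<Rightarrow> 'x"
abbreviation "wderiv \<equiv> weak_deriv p (-1) 0 :: 'x aefun \<Rightarrow> 'x aefun"
abbreviation "P \<equiv> delay_operator \<mu>"
abbreviation "L \<equiv> delay_operator \<nu>"
abbreviation "APL \<equiv> op_APL p j Am G M P L"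
abbreviation "\<Delta> \<equiv> Delta j Am G M P L l"
abbreviation "RQ \<equiv> resolvent (op_Q p) l"

lemmas W_add = W1p_add[OF p, of "-1" 0, simplified]
lemmas W_diff = W1p_diff[OF p, of "-1" 0, simplified]
lemmas W_imp_Lp = W1p_imp_Lp[OF p, of "-1" 0, simplified]
lemmas exp_fun_W = exp_fun_W1p(1,2)[OF p]

lemma L_add: "\<phi> \<in> W \<Longrightarrow> \<psi> \<in> W \<Longrightarrow> L (\<phi> + \<psi>) = L \<phi> + L \<psi>"
  and P_add: "\<phi> \<in> W \<Longrightarrow> \<psi> \<in> W \<Longrightarrow> P (\<phi> + \<psi>) = P \<phi> + P \<psi>"
  using delay_operator_add[OF p \<nu>] delay_operator_add[OF p \<mu>] by auto

lemma exp_fun_solves: "l *\<^sub>C exp_fun l x - wderiv (exp_fun l x) = 0"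
  by (simp add: exp_fun_W)

lemma eq_exp_fun: "\<phi> \<in> W \<Longrightarrow> l *\<^sub>C \<phi> - wderiv \<phi> = 0 \<Longrightarrow> \<phi> = exp_fun l (point \<phi> 0)"
  by (rule eq_exp_fun_if_weak_deriv_eq[OF p]) simp_all

text \<open>This is e_{-l} Delta(l) \<phi>, kept in Z instead of X so that \<open>Am\<close>,
  \<open>G\<close> and \<open>M\<close> can be applied to it.\<close>

definition H :: "'x aefun \<Rightarrow> 'z" where
  "H \<phi> = bvp (P \<phi>) (L \<phi>)"

lemma H_add: "\<phi> \<in> W \<Longrightarrow> \<psi> \<in> W \<Longrightarrow> H (\<phi> + \<psi>) = H \<phi> + H \<psi>"
  by (simp add: H_def L_add P_add bvp_add)

lemma H: "l *\<^sub>C j (H \<phi>) - Am (H \<phi>) = P \<phi>" "G (H \<phi>) - M (H \<phi>) = L \<phi>"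
  by (simp_all add: H_def bvp)

lemma Delta_eq: "\<Delta> \<phi> = exp_fun l (j (H \<phi>))"
proof -
  have "bvp 0 (L \<phi>) + bvp (P \<phi>) 0 = H \<phi>"
    by (simp add: H_def flip: bvp_add)
  then show ?thesis
    by (simp add: Delta_def dirichlet_M_eq resolvent_AM_eq flip: additive(1))
qed

lemma Delta_W: "\<Delta> \<phi> \<in> W"
  by (simp add: Delta_eq exp_fun_W)

lemma Delta_add: "\<phi> \<in> W \<Longrightarrow> \<psi> \<in> W \<Longrightarrow> \<Delta> (\<phi> + \<psi>) = \<Delta> \<phi> + \<Delta> \<psi>"
  by (simp add: Delta_eq H_add additive exp_fun_add)

lemma Delta_graph:
  "(\<exists>w. (\<phi>, w) \<in> graph_on W \<Delta> \<and> 1 *\<^sub>C \<phi> - w = \<psi>) \<longleftrightarrow> \<phi> \<in> W \<and> \<phi> - \<Delta> \<phi> = \<psi>"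
  by (auto simp: graph_on_def)

lemma APL_graph:
  "(\<exists>w. (x, w) \<in> APL \<and> l *\<^sub>C x - w = (y, g)) \<longleftrightarrow>
    (\<exists>z \<phi>. x = (j z, \<phi>) \<and> \<phi> \<in> W \<and> G z - M z = L \<phi> \<and> j z = point \<phi> 0 \<and>
      l *\<^sub>C j z - Am z = y + P \<phi> \<and> l *\<^sub>C \<phi> - wderiv \<phi> = g)"
proof -
  have "l *\<^sub>C (j z, \<phi>) - (Am z + P \<phi>, wderiv \<phi>) = (y, g) \<longleftrightarrow>
      l *\<^sub>C j z - Am z = y + P \<phi> \<and> l *\<^sub>C \<phi> - wderiv \<phi> = g" for z \<phi>
    by (auto simp: scaleC_prod_def algebra_simps)
  then show ?thesis
    unfolding op_APL_def by blast
qed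

text \<open>As R(l,Q) g vanishes at 0, the difference of \<phi> and R(l,Q) g is the exponential with
  initial value x = j z. The boundary problem identifies z as
  \<open>bvp (y + P \<phi>) (L \<phi>)\<close>, which splits by additivity into
  \<open>H \<phi>\<close> and \<open>bvp y 0\<close>.\<close>

lemma solution_iff:
  assumes g: "g \<in> Lp p {-1..0}"
  shows "(\<exists>w. (x, w) \<in> APL \<and> l *\<^sub>C x - w = (y, g)) \<longleftrightarrow>
    snd x \<in> W \<and> snd x - \<Delta> (snd x) = exp_fun l (j (bvp y 0)) + RQ g \<and> fst x = j (H (snd x) + bvp y 0)"
    (is "?l \<longleftrightarrow> ?r")
proof -
  note RQ = resolvent_Q[OF p g]
  obtain x1 \<phi> where x: "x = (x1, \<phi>)" by fastforce
  have sum: "bvp (y + P \<phi>) (L \<phi>) = H \<phi> + bvp y 0"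
    using bvp_add[of "P \<phi>" y "L \<phi>" 0] by (simp add: H_def add.commute)
  show ?thesis
  proof
    assume ?l
    then obtain z where z: "x1 = j z" and \<phi>: "\<phi> \<in> W" and bc: "G z - M z = L \<phi>" and jz: "j z = point \<phi> 0"
      and eq: "l *\<^sub>C j z - Am z = y + P \<phi>" and ode: "l *\<^sub>C \<phi> - wderiv \<phi> = g"
      unfolding APL_graph x by blast
    have z': "z = H \<phi> + bvp y 0"
      using bvp_eqI[OF eq bc] sum by simp
    note diff = W_diff[OF \<phi> RQ(1)]
    have "l *\<^sub>C (\<phi> - RQ g) - wderiv (\<phi> - RQ g) = 0"
      using ode RQ(3) by (simp add: diff(2) scaleC_diff_right algebra_simps)
    then have "\<phi> - RQ g = exp_fun l (point (\<phi> - RQ g) 0)"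
      by (rule eq_exp_fun[OF diff(1)])
    also have "point (\<phi> - RQ g) 0 = j (H \<phi>) + j (bvp y 0)"
      using diff(3)[of 0] RQ(2) jz z' by (simp add: additive)
    finally have "\<phi> - \<Delta> \<phi> = exp_fun l (j (bvp y 0)) + RQ g"
      by (simp add: Delta_eq exp_fun_add algebra_simps)
    then show ?r
      using \<phi> z z' x by simp
  next
    assume ?r
    then have \<phi>: "\<phi> \<in> W" and eq: "\<phi> - \<Delta> \<phi> = exp_fun l (j (bvp y 0)) + RQ g" and x1: "x1 = j (H \<phi> + bvp y 0)"
      using x by auto
    let ?e = "exp_fun l (j (H \<phi> + bvp y 0))"
    have \<phi>_eq: "\<phi> = ?e + RQ g"
      using eq by (simp add: Delta_eq additive exp_fun_add algebra_simps)
    note add = W_add[OF exp_fun_W(1) RQ(1)]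
    have "point \<phi> 0 = j (H \<phi> + bvp y 0)"
      by (subst (1) \<phi>_eq) (use RQ(2) in \<open>simp add: add(3) crep_exp_fun_zero\<close>)
    moreover have "l *\<^sub>C \<phi> - wderiv \<phi> = g"
    proof -
      have "l *\<^sub>C (?e + RQ g) - wderiv (?e + RQ g) = (l *\<^sub>C ?e - wderiv ?e) + (l *\<^sub>C RQ g - wderiv (RQ g))"
        by (simp add: add(2) scaleC_add_right)
      then show ?thesis
        using RQ(3) exp_fun_solves \<phi>_eq by simp
    qed
    moreover have "G (H \<phi> + bvp y 0) - M (H \<phi> + bvp y 0) = L \<phi>"
      "l *\<^sub>C j (H \<phi> + bvp y 0) - Am (H \<phi> + bvp y 0) = y + P \<phi>"
      unfolding sum[symmetric] by (rule bvp)+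
    ultimately show ?l
      unfolding APL_graph using \<phi> x x1 by metis
  qed
qed

text \<open>The equation itself expresses the derivative as l R(l,Q) g - g, so the L^p bound already
  controls the full Sobolev norm.\<close>

lemma RQ_W_norm: "\<exists>C\<ge>0. \<forall>g\<in>Lp p {-1..0}. W_norm (RQ g) \<le> C * Lp_norm p g"
proof -
  define K where "K = 4 * (1 + cmod l * exp (cmod l) * exp (cmod l))"
  have "W_norm (RQ g) \<le> (K + cmod l * K + 1) * Lp_norm p g" if g: "g \<in> Lp p {-1..0}" for g
  proof -
    note RQ = resolvent_Q[OF p g, where l = l, folded K_def]
    have RQ_Lp: "RQ g \<in> Lp p {-1..0}"
      using W_imp_Lp(1)[OF RQ(1)] .
    have "wderiv (RQ g) = l *\<^sub>C RQ g - g"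
      using RQ(3) by (simp add: algebra_simps)
    then have "Lp_norm p (wderiv (RQ g)) \<le> cmod l * Lp_norm p (RQ g) + Lp_norm p g"
      using Lp_norm_triangle_diff[OF p Lp_scaleC[OF RQ_Lp] g] Lp_norm_scaleC[OF RQ_Lp] p by simp
    also have "\<dots> \<le> cmod l * (K * Lp_norm p g) + Lp_norm p g"
      using RQ(4) by (intro add_right_mono mult_left_mono) auto
    finally show ?thesis
      using RQ(4) by (simp add: W1p_norm_def algebra_simps)
  qed
  moreover have "K + cmod l * K + 1 \<ge> 0"
    by (simp add: K_def)
  ultimately show ?thesis by blast
qed

lemma exp_fun_W_norm: "\<exists>C\<ge>0. \<forall>x. W_norm (exp_fun k x) \<le> C * norm x"
  using W1p_norm_exp_fun_le(2)[OF p, of k] by (intro exI[of _ "(1 + cmod k) * (2 * exp (cmod k))"]) auto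

lemma APL_graphD: "(x, w) \<in> APL \<Longrightarrow> snd (l *\<^sub>C x - w) \<in> Lp p {-1..0} \<and> snd x \<in> W"
  by (auto simp: op_APL_def scaleC_prod_def intro!: Lp_diff[OF p] Lp_scaleC dest: W_imp_Lp)

text \<open>The first component of an element of the domain is the value at 0 of the second, so a
  bound for the second component in W^{1,p} controls the whole state.\<close>

lemma resolvent_APL_if_resolvent_Delta:
  assumes one: "1 \<in> resolvent_set W W_norm (graph_on W \<Delta>)"
  shows "l \<in> resolvent_set (state_space p) (state_norm p) APL"
proof -
  have ex1: "\<exists>!\<phi>. \<phi> \<in> W \<and> \<phi> - \<Delta> \<phi> = \<psi>" if "\<psi> \<in> W" for \<psi>
    using resolvent_set_ex1[OF one that] unfolding Delta_graph .
  obtain K where K: "K \<ge> 0" "\<And>\<phi> w. (\<phi>, w) \<in> graph_on W \<Delta> \<Longrightarrow> W_norm \<phi> \<le> K * W_norm (1 *\<^sub>C \<phi> - w)"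
    by (rule resolvent_set_bound[OF one W1p_norm_nonneg], rule that)
  have K': "W_norm \<phi> \<le> K * W_norm (\<phi> - \<Delta> \<phi>)" if "\<phi> \<in> W" for \<phi>
    using K(2)[of \<phi> "\<Delta> \<phi>"] that by (simp add: graph_on_def)
  obtain C1 where C1: "C1 \<ge> 0" "\<And>y u. norm (j (bvp y u)) \<le> C1 * (norm y + norm u)"
    using bvp_bound by blast
  obtain C2 where C2: "C2 \<ge> 0" "\<And>x. W_norm (exp_fun l x) \<le> C2 * norm x"
    using exp_fun_W_norm by blast
  obtain C3 where C3: "C3 \<ge> 0" "\<And>g. g \<in> Lp p {-1..0} \<Longrightarrow> W_norm (RQ g) \<le> C3 * Lp_norm p g"
    using RQ_W_norm by blast
  have "\<exists>!x. \<exists>w. (x, w) \<in> APL \<and> l *\<^sub>C x - w = (y, g)" if g: "g \<in> Lp p {-1..0}" for y g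
  proof -
    have "exp_fun l (j (bvp y 0)) + RQ g \<in> W"
      by (intro W_add(1) exp_fun_W(1) resolvent_Q(1)[OF p g])
    from ex1[OF this] obtain \<phi> where \<phi>: "\<phi> \<in> W" "\<phi> - \<Delta> \<phi> = exp_fun l (j (bvp y 0)) + RQ g"
      and unique: "\<And>\<psi>. \<psi> \<in> W \<Longrightarrow> \<psi> - \<Delta> \<psi> = exp_fun l (j (bvp y 0)) + RQ g \<Longrightarrow> \<psi> = \<phi>"
      by blast
    show ?thesis
      unfolding solution_iff[OF g]
    proof (rule ex1I[of _ "(j (H \<phi> + bvp y 0), \<phi>)"])
      fix x assume x: "snd x \<in> W \<and> snd x - \<Delta> (snd x) = exp_fun l (j (bvp y 0)) + RQ g \<and> fst x = j (H (snd x) + bvp y 0)"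
      then have "snd x = \<phi>"
        using unique by blast
      then show "x = (j (H \<phi> + bvp y 0), \<phi>)"
        using x by (simp add: prod_eq_iff)
    qed (use \<phi> in simp)
  qed
  moreover have "state_norm p x \<le> (8 * K * max (C2 * C1) C3) * state_norm p (l *\<^sub>C x - w)" if xw: "(x, w) \<in> APL" for x w
  proof -
    obtain y g where yg: "l *\<^sub>C x - w = (y, g)" by fastforce
    have g: "g \<in> Lp p {-1..0}" and \<phi>: "snd x \<in> W"
      using APL_graphD[OF xw] yg by auto
    have sol: "snd x - \<Delta> (snd x) = exp_fun l (j (bvp y 0)) + RQ g"
      using solution_iff[OF g, of x y] xw yg by blast
    have "point (snd x) 0 = fst x"
      using xw by (auto simp: op_APL_def)
    then have "norm (fst x) \<le> 4 * W_norm (snd x)"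
      using W1p_sup_bound[OF p _ \<phi>, of 0] by simp
    moreover have "Lp_norm p (snd x) \<le> W_norm (snd x)"
      by (simp add: W1p_norm_def Lp_norm_nonneg)
    \<comment> \<open>The embedding constant 4 and the L^p part add up to 5; 8 is a convenient
      larger number.\<close>
    ultimately have "state_norm p x \<le> 8 * W_norm (snd x)"
      using W1p_norm_nonneg[of p "-1" 0 "snd x"] by (simp add: state_norm_def case_prod_unfold)
    also have "W_norm (snd x) \<le> K * W_norm (exp_fun l (j (bvp y 0)) + RQ g)"
      using K'[OF \<phi>] sol by simp
    also have "W_norm (exp_fun l (j (bvp y 0)) + RQ g) \<le> W_norm (exp_fun l (j (bvp y 0))) + W_norm (RQ g)"
      using W1p_norm_triangle[OF p _ exp_fun_W(1) resolvent_Q(1)[OF p g]] by simp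
    also have "\<dots> \<le> C2 * (C1 * norm y) + C3 * Lp_norm p g"
      using C2(2)[of "j (bvp y 0)"] mult_left_mono[OF C1(2)[of y 0] C2(1)] C3(2)[OF g] by simp
    also have "\<dots> \<le> max (C2 * C1) C3 * norm y + max (C2 * C1) C3 * Lp_norm p g"
      by (intro add_mono) (auto simp: Lp_norm_nonneg mult.assoc[symmetric] intro!: mult_right_mono)
    also have "\<dots> = max (C2 * C1) C3 * state_norm p (y, g)"
      by (simp add: state_norm_def distrib_left)
    finally show ?thesis
      using K(1) yg by (simp add: mult.assoc mult_left_mono)
  qed
  ultimately have "\<forall>y\<in>state_space p. \<exists>!x. \<exists>w. (x, w) \<in> APL \<and> l *\<^sub>C x - w = y"
    "\<exists>K. \<forall>(x, w)\<in>APL. state_norm p x \<le> K * state_norm p (l *\<^sub>C x - w)"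
    by (simp add: state_space_def split_paired_Ball_Sigma, blast)
  then show ?thesis
    unfolding resolvent_set_def by simp
qed

text \<open>With C bounding \<open>j (bvp 0 u)\<close>, the value 1 / (2 (C + 1)) makes u -> L e_k
  D_l^M u Lipschitz with constant 1/2. The fixed point then satisfies |u| <= 2 |v|, whence the
  constant 2 C.\<close>

lemma ex_boundary_corrector:
  "\<exists>k c. c \<ge> 0 \<and> (\<forall>v. \<exists>u. u - L (exp_fun k (j (bvp 0 u))) = v \<and> norm (j (bvp 0 u)) \<le> c * norm v)"
proof -
  obtain C where C: "C \<ge> 0" "\<And>y u. norm (j (bvp y u)) \<le> C * (norm y + norm u)"
    using bvp_bound by blast
  obtain k where k: "\<And>x. norm (L (exp_fun k x)) \<le> 1 / (2 * (C + 1)) * norm x"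
    using delay_operator_exp_fun_small[OF \<nu>, of "1 / (2 * (C + 1))"] C(1) by auto
  let ?f = "\<lambda>u. L (exp_fun k (j (bvp 0 u)))"
  have f_le: "norm (?f u) \<le> 1 / 2 * norm u" for u
  proof -
    have "norm (?f u) \<le> 1 / (2 * (C + 1)) * (C * norm u)"
      using order_trans[OF k mult_left_mono[OF C(2)[of 0 u]]] C(1) by simp
    also have "\<dots> \<le> 1 / 2 * norm u"
      using C(1) by (simp add: field_simps)
    finally show ?thesis .
  qed
  have f_diff: "?f u - ?f u' = ?f (u - u')" for u u'
  proof -
    have "?f u = ?f (u - u') + ?f u'"
      using bvp_add[of 0 0 "u - u'" u'] by (simp add: additive exp_fun_add L_add exp_fun_W)
    then show ?thesis by simp
  qed
  have "\<exists>u. u - ?f u = v \<and> norm (j (bvp 0 u)) \<le> (2 * C) * norm v" for v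
  proof -
    have "\<exists>!u. v + ?f u = u"
    proof (rule banach_fix_type)
      show "\<forall>u u'. dist (v + ?f u) (v + ?f u') \<le> 1 / 2 * dist u u'"
        using f_le f_diff by (simp add: dist_norm)
    qed auto
    then obtain u where u: "v + ?f u = u" by blast
    then have "norm u \<le> norm v + 1 / 2 * norm u"
      using norm_triangle_ineq[of v "?f u"] f_le[of u] by simp
    then have "norm u \<le> 2 * norm v" by simp
    then have "norm (j (bvp 0 u)) \<le> C * (2 * norm v)"
      using order_trans[OF C(2)[of 0 u] mult_left_mono[OF _ C(1)]] by simp
    moreover have "u - ?f u = v"
      using u by (simp add: algebra_simps)
    ultimately show ?thesis
      by (intro exI[of _ u]) simp
  qed
  then show ?thesis
    using C(1) by (intro exI[of _ k] exI[of _ "2 * C"]) simp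
qed

text \<open>If \<open>\<chi>\<close> corrects the boundary defect \<open>L \<psi>\<close>, then the substitution \<open>\<phi> = \<psi> + \<eta> + \<chi>\<close> turns
  \<open>\<phi> - \<Delta> \<phi> = \<psi>\<close> into the resolvent equation of \<open>\<A>\<^sub>P\<^sub>,\<^sub>L\<close> for \<open>\<eta>\<close>.\<close>

lemma Delta_equation_iff:
  assumes \<psi>: "\<psi> \<in> W" and \<phi>: "\<phi> \<in> W" and u: "u - L (exp_fun k (j (bvp 0 u))) = L \<psi>"
    and \<chi>_def: "\<chi>' = exp_fun k (j (bvp 0 u))"
  shows "\<phi> - \<Delta> \<phi> = \<psi> \<longleftrightarrow> (\<exists>x w. (x, w) \<in> APL \<and> l *\<^sub>C x - w = (P (\<psi> + \<chi>'), (k - l) *\<^sub>C \<chi>') \<and>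
    snd x = \<phi> - \<psi> - \<chi>')"
proof -
  let ?\<eta> = "\<phi> - \<psi> - \<chi>'"
  have \<chi>: "\<chi>' \<in> W" "point \<chi>' 0 = j (bvp 0 u)" "wderiv \<chi>' = k *\<^sub>C \<chi>'"
    by (simp_all add: \<chi>_def exp_fun_W crep_exp_fun_zero)
  note d1 = W_diff[OF \<phi> \<psi>] and d2 = W_diff[OF W_diff(1)[OF \<phi> \<psi>] \<chi>(1)]
  have \<phi>_eq: "\<phi> = ?\<eta> + (\<psi> + \<chi>')"
    by simp
  \<comment> \<open>The corrector condition says exactly that L (\<psi> + \<chi>') = u. Subtracting
    \<open>bvp 0 u\<close> from \<open>H \<phi>\<close> therefore leaves the boundary value
    \<open>L ?\<eta>\<close> that the domain of the delay operator demands.\<close>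
  have L_eq: "L \<phi> = L ?\<eta> + u"
    using L_add[OF d2(1) W_add(1)[OF \<psi> \<chi>(1)]] L_add[OF \<psi> \<chi>(1)] u by (simp add: \<chi>_def algebra_simps)
  have P_eq: "P \<phi> = P ?\<eta> + P (\<psi> + \<chi>')"
    using P_add[OF d2(1) W_add(1)[OF \<psi> \<chi>(1)]] by simp
  have ode: "l *\<^sub>C ?\<eta> - wderiv ?\<eta> = (l *\<^sub>C (\<phi> - \<psi>) - wderiv (\<phi> - \<psi>)) + (k - l) *\<^sub>C \<chi>'"
  proof -
    have "(k - l) *\<^sub>C \<chi>' = k *\<^sub>C \<chi>' - l *\<^sub>C \<chi>'"
      by (simp add: eq_diff_eq flip: scaleC_add_left)
    then show ?thesis
      by (simp only: d2(2) \<chi>(3) scaleC_diff_right) (simp add: algebra_simps)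
  qed
  have H_eq: "bvp (P (\<psi> + \<chi>') + P ?\<eta>) (L ?\<eta>) = H \<phi> - bvp 0 u"
    by (simp add: H_def L_eq P_eq add.commute flip: bvp_diff)
  show ?thesis
  proof
    assume "\<phi> - \<Delta> \<phi> = \<psi>"
    then have diff: "\<phi> - \<psi> = exp_fun l (j (H \<phi>))"
      by (simp add: Delta_eq algebra_simps)
    let ?z = "H \<phi> - bvp 0 u"
    have "G ?z - M ?z = L ?\<eta>" "l *\<^sub>C j ?z - Am ?z = P (\<psi> + \<chi>') + P ?\<eta>"
      unfolding H_eq[symmetric] by (rule bvp)+
    moreover have "j ?z = point ?\<eta> 0"
      using d2(3)[of 0] by (simp add: diff crep_exp_fun_zero \<chi>(2) additive)
    moreover have "l *\<^sub>C ?\<eta> - wderiv ?\<eta> = (k - l) *\<^sub>C \<chi>'"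
      unfolding ode by (simp add: diff exp_fun_solves)
    ultimately have "\<exists>w. ((j ?z, ?\<eta>), w) \<in> APL \<and> l *\<^sub>C (j ?z, ?\<eta>) - w = (P (\<psi> + \<chi>'), (k - l) *\<^sub>C \<chi>')"
      unfolding APL_graph using d2(1) by blast
    then show "\<exists>x w. (x, w) \<in> APL \<and> l *\<^sub>C x - w = (P (\<psi> + \<chi>'), (k - l) *\<^sub>C \<chi>') \<and> snd x = ?\<eta>"
      by (metis snd_conv)
  next
    assume "\<exists>x w. (x, w) \<in> APL \<and> l *\<^sub>C x - w = (P (\<psi> + \<chi>'), (k - l) *\<^sub>C \<chi>') \<and> snd x = ?\<eta>"
    then obtain x where x: "\<exists>w. (x, w) \<in> APL \<and> l *\<^sub>C x - w = (P (\<psi> + \<chi>'), (k - l) *\<^sub>C \<chi>')" and snd: "snd x = ?\<eta>"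
      by blast
    obtain z where bc: "G z - M z = L ?\<eta>" and jz: "j z = point ?\<eta> 0"
      and eq: "l *\<^sub>C j z - Am z = P (\<psi> + \<chi>') + P ?\<eta>" and ode': "l *\<^sub>C ?\<eta> - wderiv ?\<eta> = (k - l) *\<^sub>C \<chi>'"
      using x snd unfolding APL_graph by auto
    have "z = H \<phi> - bvp 0 u"
      using bvp_eqI[OF eq bc] H_eq by simp
    then have "point (\<phi> - \<psi>) 0 = j (H \<phi>)"
      using jz d2(3)[of 0] by (simp add: \<chi>(2) additive)
    moreover have "l *\<^sub>C (\<phi> - \<psi>) - wderiv (\<phi> - \<psi>) = 0"
      using ode ode' by simp
    ultimately have "\<phi> - \<psi> = \<Delta> \<phi>"
      using eq_exp_fun[OF d1(1)] by (simp add: Delta_eq)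
    then show "\<phi> - \<Delta> \<phi> = \<psi>"
      by (simp add: algebra_simps)
  qed
qed

text \<open>The corrected data (P (\<psi> + chi), (k - l) chi) lie in the state space, so unique
  solvability is transported through \<open>Delta_equation_iff\<close>. Since the corrector depends
  boundedly on \<psi>, so does the solution.\<close>

lemma resolvent_Delta_if_resolvent_APL:
  assumes l_APL: "l \<in> resolvent_set (state_space p) (state_norm p) APL"
  shows "1 \<in> resolvent_set W W_norm (graph_on W \<Delta>)"
proof -
  obtain k c where c: "c \<ge> 0"
    and corrector: "\<And>v. \<exists>u. u - L (exp_fun k (j (bvp 0 u))) = v \<and> norm (j (bvp 0 u)) \<le> c * norm v"
    using ex_boundary_corrector by blast
  have state_norm_nonneg: "state_norm p x \<ge> 0" for x :: "'x \<times> 'x aefun"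
    by (simp add: state_norm_def case_prod_unfold Lp_norm_nonneg)
  obtain K where K: "K \<ge> 0" "\<And>x w. (x, w) \<in> APL \<Longrightarrow> state_norm p x \<le> K * state_norm p (l *\<^sub>C x - w)"
    by (rule resolvent_set_bound[OF l_APL state_norm_nonneg], rule that)
  obtain C1 where C1: "C1 \<ge> 0" "\<And>x. W_norm (exp_fun k x) \<le> C1 * norm x"
    using exp_fun_W_norm by blast
  obtain C2 where C2: "C2 \<ge> 0" "\<And>\<phi>. \<phi> \<in> W \<Longrightarrow> norm (L \<phi>) \<le> C2 * W_norm \<phi>"
    using delay_operator_bounded[OF p \<nu>] by blast
  obtain C3 where C3: "C3 \<ge> 0" "\<And>\<phi>. \<phi> \<in> W \<Longrightarrow> norm (P \<phi>) \<le> C3 * W_norm \<phi>"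
    using delay_operator_bounded[OF p \<mu>] by blast
  have ex1: "\<exists>!\<phi>. \<phi> \<in> W \<and> \<phi> - \<Delta> \<phi> = \<psi>" if \<psi>: "\<psi> \<in> W" for \<psi>
  proof -
    obtain u where u: "u - L (exp_fun k (j (bvp 0 u))) = L \<psi>"
      using corrector by blast
    \<comment> \<open>Here \<open>\<eta>\<close> is the corrector, written chi in the overview; the
      unknown called eta there is \<open>snd x\<close>.\<close>
    define \<eta> where "\<eta> = exp_fun k (j (bvp 0 u))"
    have \<eta>: "\<eta> \<in> W"
      by (simp add: \<eta>_def exp_fun_W)
    note iff = Delta_equation_iff[OF \<psi> _ u \<eta>_def]
    have "(P (\<psi> + \<eta>), (k - l) *\<^sub>C \<eta>) \<in> state_space p"
      by (simp add: state_space_def Lp_scaleC W_imp_Lp(1)[OF \<eta>])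
    from resolvent_set_ex1[OF l_APL this]
    obtain x where x: "\<exists>w. (x, w) \<in> APL \<and> l *\<^sub>C x - w = (P (\<psi> + \<eta>), (k - l) *\<^sub>C \<eta>)"
      and unique: "\<And>x'. \<exists>w. (x', w) \<in> APL \<and> l *\<^sub>C x' - w = (P (\<psi> + \<eta>), (k - l) *\<^sub>C \<eta>) \<Longrightarrow> x' = x"
      by blast
    have snd_x: "snd x \<in> W"
      using x APL_graphD by blast
    show ?thesis
    proof (rule ex1I[of _ "snd x + (\<psi> + \<eta>)"], intro conjI)
      show W: "snd x + (\<psi> + \<eta>) \<in> W"
        by (intro W_add(1) snd_x \<psi> \<eta>)
      show "snd x + (\<psi> + \<eta>) - \<Delta> (snd x + (\<psi> + \<eta>)) = \<psi>"
      proof -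
        have "snd x + (\<psi> + \<eta>) - \<psi> - \<eta> = snd x" by simp
        then show ?thesis
          unfolding iff[OF W] using x by metis
      qed
      fix \<phi> assume \<phi>: "\<phi> \<in> W \<and> \<phi> - \<Delta> \<phi> = \<psi>"
      then obtain x' where "\<exists>w. (x', w) \<in> APL \<and> l *\<^sub>C x' - w = (P (\<psi> + \<eta>), (k - l) *\<^sub>C \<eta>)" "snd x' = \<phi> - \<psi> - \<eta>"
        using iff[of \<phi>] by blast
      then have "snd x = \<phi> - \<psi> - \<eta>"
        using unique by blast
      then show "\<phi> = snd x + (\<psi> + \<eta>)"
        by (simp add: algebra_simps)
    qed
  qed
  \<comment> \<open>\<open>D\<close> bounds the corrector in W^{1,p} relative to \<psi>. The
    constant \<open>E\<close> below adds to \<open>D\<close> the resolvent bound \<open>K\<close>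
    times the size of the corrected data and will bound Delta(l) \<phi> in L^p.\<close>
  define D where "D = C1 * (c * C2)"
  have D: "D \<ge> 0"
    using C1(1) c C2(1) by (simp add: D_def)
  define E where "E = K * (C3 * (1 + D) + cmod (k - l) * D) + D"
  have "W_norm \<phi> \<le> (1 + (1 + cmod l) * E) * W_norm (\<phi> - \<Delta> \<phi>)" if \<phi>: "\<phi> \<in> W" for \<phi>
  proof -
    define \<psi> where "\<psi> = \<phi> - \<Delta> \<phi>"
    have \<psi>: "\<psi> \<in> W"
      unfolding \<psi>_def by (intro W_diff(1) \<phi> Delta_W)
    let ?N = "W_norm \<psi>"
    have N: "?N \<ge> 0" by (rule W1p_norm_nonneg)
    obtain u where u: "u - L (exp_fun k (j (bvp 0 u))) = L \<psi>" and u_le: "norm (j (bvp 0 u)) \<le> c * norm (L \<psi>)"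
      using corrector by blast
    define \<eta> where "\<eta> = exp_fun k (j (bvp 0 u))"
    have \<eta>: "\<eta> \<in> W"
      by (simp add: \<eta>_def exp_fun_W)
    have "norm (j (bvp 0 u)) \<le> c * (C2 * ?N)"
      using order_trans[OF u_le mult_left_mono[OF C2(2)[OF \<psi>] c]] .
    then have "C1 * norm (j (bvp 0 u)) \<le> C1 * (c * (C2 * ?N))"
      using C1(1) by (rule mult_left_mono)
    then have \<eta>_le: "W_norm \<eta> \<le> D * ?N"
      using C1(2)[of "j (bvp 0 u)"] by (simp add: \<eta>_def D_def mult.assoc)
    have Lp_le: "Lp_norm p \<xi> \<le> W_norm \<xi>" for \<xi> :: "'x aefun"
      by (simp add: W1p_norm_def Lp_norm_nonneg)
    obtain x w where x: "(x, w) \<in> APL" "l *\<^sub>C x - w = (P (\<psi> + \<eta>), (k - l) *\<^sub>C \<eta>)" and snd_x: "snd x = \<phi> - \<psi> - \<eta>"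
      using Delta_equation_iff[OF \<psi> \<phi> u \<eta>_def] \<psi>_def by blast
    have snd_x_W: "snd x \<in> W"
      using APL_graphD[OF x(1)] by blast
    have "norm (P (\<psi> + \<eta>)) \<le> C3 * W_norm (\<psi> + \<eta>)"
      by (rule C3(2)[OF W_add(1)[OF \<psi> \<eta>]])
    also have "\<dots> \<le> C3 * ((1 + D) * ?N)"
      using W1p_norm_triangle[OF p _ \<psi> \<eta>] \<eta>_le C3(1) by (intro mult_left_mono) (simp_all add: distrib_right)
    finally have P_le: "norm (P (\<psi> + \<eta>)) \<le> C3 * ((1 + D) * ?N)" .
    have "Lp_norm p ((k - l) *\<^sub>C \<eta>) = cmod (k - l) * Lp_norm p \<eta>"
      using Lp_norm_scaleC[OF W_imp_Lp(1)[OF \<eta>]] p by simp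
    also have "\<dots> \<le> cmod (k - l) * (D * ?N)"
      using order_trans[OF Lp_le \<eta>_le] by (intro mult_left_mono) auto
    finally have Q_le: "Lp_norm p ((k - l) *\<^sub>C \<eta>) \<le> cmod (k - l) * (D * ?N)" .
    have "Lp_norm p (snd x) \<le> state_norm p x"
      by (simp add: state_norm_def case_prod_unfold)
    also have "\<dots> \<le> K * (norm (P (\<psi> + \<eta>)) + Lp_norm p ((k - l) *\<^sub>C \<eta>))"
      using K(2)[OF x(1)] by (simp add: x(2) state_norm_def)
    also have "\<dots> \<le> K * (C3 * ((1 + D) * ?N) + cmod (k - l) * (D * ?N))"
      using P_le Q_le K(1) by (intro mult_left_mono add_mono)
    finally have "Lp_norm p (snd x) + W_norm \<eta> \<le> E * ?N"
      using \<eta>_le by (simp add: E_def algebra_simps)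
    then have Lp_le': "Lp_norm p (\<Delta> \<phi>) \<le> E * ?N"
    proof -
      have "\<Delta> \<phi> = snd x + \<eta>"
        by (simp add: snd_x \<psi>_def)
      then show ?thesis
        using Lp_norm_triangle[OF p W_imp_Lp(1)[OF snd_x_W] W_imp_Lp(1)[OF \<eta>]] Lp_le[of \<eta>]
          \<open>Lp_norm p (snd x) + W_norm \<eta> \<le> E * ?N\<close> by simp
    qed
    \<comment> \<open>The resolvent gave only an L^p estimate; for an exponential the Sobolev norm
      is 1 + |l| times the L^p norm.\<close>
    have "wderiv (\<Delta> \<phi>) = l *\<^sub>C \<Delta> \<phi>"
      by (simp add: Delta_eq exp_fun_W)
    then have "W_norm (\<Delta> \<phi>) = (1 + cmod l) * Lp_norm p (\<Delta> \<phi>)"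
      using Lp_norm_scaleC[OF W_imp_Lp(1)[OF Delta_W[of \<phi>]]] p by (simp add: W1p_norm_def distrib_right)
    also have "\<dots> \<le> (1 + cmod l) * (E * ?N)"
      using Lp_le' by (intro mult_left_mono) auto
    finally have "W_norm (\<Delta> \<phi>) \<le> (1 + cmod l) * (E * ?N)" .
    moreover have "W_norm \<phi> \<le> ?N + W_norm (\<Delta> \<phi>)"
      using W1p_norm_triangle[OF p _ \<psi> Delta_W[of \<phi>]] by (simp add: \<psi>_def)
    ultimately have "W_norm \<phi> \<le> (1 + (1 + cmod l) * E) * ?N"
      by (simp add: distrib_right mult.assoc)
    then show ?thesis
      by (simp only: \<psi>_def)
  qed
  then have "\<exists>K. \<forall>(\<phi>, w) \<in> graph_on W \<Delta>. W_norm \<phi> \<le> K * W_norm (1 *\<^sub>C \<phi> - w)"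
    by (intro exI[of _ "1 + (1 + cmod l) * E"]) (auto simp: graph_on_def)
  then show ?thesis
    using ex1 unfolding resolvent_set_def mem_Collect_eq Delta_graph by blast
qed

text \<open>By linearity the two parts of the right-hand side are solved separately. The entries of
  the first row differ in shape because \<open>R (exp_fun l (RAM y))\<close> is itself an
  exponential, whose coefficient includes \<open>RAM y\<close>, whereas \<open>R (RQ g)\<close>
  contains the summand \<open>RQ g\<close>, and only its image under Delta(l) is guaranteed to be an
  exponential.\<close>

lemma resolvent_APL_eq:
  assumes l_APL: "l \<in> resolvent_set (state_space p) (state_norm p) APL" and yg: "(y, g) \<in> state_space p"
  defines "R \<equiv> resolvent (graph_on W \<Delta>) 1" and "RAM \<equiv> resolvent (op_AM j Am G M) l"
  shows "resolvent APL l (y, g) =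
    (inv (exp_fun l) (R (exp_fun l (RAM y))) + inv (exp_fun l) (\<Delta> (R (RQ g))), R (exp_fun l (RAM y)) + R (RQ g))"
proof -
  have g: "g \<in> Lp p {-1..0}"
    using yg by (simp add: state_space_def)
  have RAM: "RAM y = j (bvp y 0)"
    by (simp add: RAM_def resolvent_AM_eq)
  have R: "R \<psi> \<in> W" "R \<psi> - \<Delta> (R \<psi>) = \<psi>" if "\<psi> \<in> W" for \<psi>
  proof -
    note ex1 = resolvent_set_ex1[OF resolvent_Delta_if_resolvent_APL[OF l_APL] that]
    have "\<exists>w. (R \<psi>, w) \<in> graph_on W \<Delta> \<and> 1 *\<^sub>C R \<psi> - w = \<psi>"
      unfolding R_def resolvent_def by (rule theI'[OF ex1])
    then show "R \<psi> \<in> W" "R \<psi> - \<Delta> (R \<psi>) = \<psi>"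
      unfolding Delta_graph by auto
  qed
  note R1 = R[OF exp_fun_W(1)[of l "RAM y"]] and R2 = R[OF resolvent_Q(1)[OF p g, of l]]
  let ?\<phi>1 = "R (exp_fun l (RAM y))" and ?\<phi>2 = "R (RQ g)"
  have "?\<phi>1 = exp_fun l (j (H ?\<phi>1) + RAM y)"
    using R1(2) by (simp add: Delta_eq exp_fun_add algebra_simps)
  then have "inv (exp_fun l) ?\<phi>1 = j (H ?\<phi>1) + RAM y"
    by (metis inv_f_f inj_exp_fun)
  moreover have "inv (exp_fun l) (\<Delta> ?\<phi>2) = j (H ?\<phi>2)"
    by (simp add: Delta_eq inv_f_f inj_exp_fun)
  ultimately have fst: "inv (exp_fun l) ?\<phi>1 + inv (exp_fun l) (\<Delta> ?\<phi>2) = j (H (?\<phi>1 + ?\<phi>2) + bvp y 0)"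
    by (simp add: H_add R1(1)[unfolded RAM] R2(1) additive RAM)
  have "?\<phi>1 + ?\<phi>2 - \<Delta> (?\<phi>1 + ?\<phi>2) = (?\<phi>1 - \<Delta> ?\<phi>1) + (?\<phi>2 - \<Delta> ?\<phi>2)"
    by (simp add: Delta_add R1(1) R2(1))
  also have "\<dots> = exp_fun l (j (bvp y 0)) + RQ g"
    by (simp only: R1(2) R2(2)) (simp only: RAM)
  finally have "\<exists>w. ((j (H (?\<phi>1 + ?\<phi>2) + bvp y 0), ?\<phi>1 + ?\<phi>2), w) \<in> APL \<and>
      l *\<^sub>C (j (H (?\<phi>1 + ?\<phi>2) + bvp y 0), ?\<phi>1 + ?\<phi>2) - w = (y, g)"
    unfolding solution_iff[OF g] using W_add(1)[OF R1(1) R2(1)] by simp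
  then have "resolvent APL l (y, g) = (j (H (?\<phi>1 + ?\<phi>2) + bvp y 0), ?\<phi>1 + ?\<phi>2)"
    by (rule resolvent_eqI[OF resolvent_set_ex1[OF l_APL yg]])
  then show ?thesis
    by (simp only: fst)
qed

end

theorem theorem4p1:
  fixes p :: real
    and j Am :: "'z::complex_banach \<Rightarrow> 'x::complex_banach"
    and G M :: "'z \<Rightarrow> 'u::complex_banach"
    and T :: "real \<Rightarrow> 'x \<Rightarrow> 'x"
    and J A1 :: "'x \<Rightarrow> 'e::complex_banach"
    and T1 :: "real \<Rightarrow> 'e \<Rightarrow> 'e"
    and B :: "'u \<Rightarrow> 'e"
    and F :: "real \<Rightarrow> 'u aefun \<Rightarrow> 'u aefun"
    and \<mu> :: "real \<Rightarrow> 'x \<Rightarrow>\<^sub>L 'x"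
    and \<nu> :: "real \<Rightarrow> 'x \<Rightarrow>\<^sub>L 'u"
    and P :: "'x aefun \<Rightarrow> 'x"
    and L :: "'x aefun \<Rightarrow> 'u"
    and A :: "('x \<times> 'x) set"
    and APL :: "(('x \<times> 'x aefun) \<times> ('x \<times> 'x aefun)) set"
    and \<Delta> :: "'x aefun \<Rightarrow> 'x aefun"
    and RAM :: "'x \<Rightarrow> 'x"
    and RQ I\<Delta>_inv :: "'x aefun \<Rightarrow> 'x aefun"
    and l :: complex
  assumes p: "p \<ge> 1"
    and system: "boundary_system j Am G M T"
    and control: "control_operator j Am G T J T1 A1 B"
    and regular: "regular_triple p j Am G M T J T1 B F"
    and feedback: "\<exists>\<tau>>0. 1 \<in> resolvent_set (Lp p {0..\<tau>}) (Lp_norm p) (graph_on (Lp p {0..\<tau>}) (F \<tau>))"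
    and delays: "delay_kernel \<mu>" "delay_kernel \<nu>"
    and P: "P = delay_operator \<mu>"
    and L: "L = delay_operator \<nu>"
    and A: "A = op_A j Am G"
    and APL: "APL = op_APL p j Am G M P L"
    and \<Delta>: "\<Delta> = Delta j Am G M P L l"
    and RAM: "RAM = resolvent (op_AM j Am G M) l"
    and RQ: "RQ = resolvent (op_Q p) l"
    and I\<Delta>_inv: "I\<Delta>_inv = resolvent (graph_on (W1p p (-1) 0) \<Delta>) 1"
    and l: "l \<in> resolvent_set UNIV norm A"
    and DM: "1 \<in> resolvent_set UNIV norm (op_DM j Am G M l)"
  shows "(l \<in> resolvent_set (state_space p) (state_norm p) APL \<longleftrightarrow>
      1 \<in> resolvent_set (W1p p (-1) 0) (W1p_norm p (-1) 0) (graph_on (W1p p (-1) 0) \<Delta>)) \<and>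
    (l \<in> resolvent_set (state_space p) (state_norm p) APL \<longrightarrow>
      (\<forall>(y, g) \<in> state_space p. resolvent APL l (y, g) =
        (inv (exp_fun l) (I\<Delta>_inv (exp_fun l (RAM y))) + inv (exp_fun l) (\<Delta> (I\<Delta>_inv (RQ g))),
         I\<Delta>_inv (exp_fun l (RAM y)) + I\<Delta>_inv (RQ g))))"
proof -
  interpret delay_problem j Am G M T l p \<mu> \<nu>
    by unfold_locales (use system l DM p delays in \<open>simp_all add: A\<close>)
  show ?thesis
    unfolding APL \<Delta> RAM RQ I\<Delta>_inv P L
    using resolvent_APL_if_resolvent_Delta resolvent_Delta_if_resolvent_APL resolvent_APL_eq
    by blast
qed

end
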